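(* Given an instance $G=(A\cup B,E)$ of the popular matching problem with $|A\cup B|=n$ together with $\kappa\in\{1,\dots,n-1\}$, a matching that is popular with penalty $\kappa$ can be computed in $O(n^{7/2}\cdot\kappa^{5/2})$ time, if $G$ admits such a matching.
   Context: $G$ is bipartite; each agent $a\in A$ has a strict partial order $\succ_a$ over her neighbors in $B$; objects have no preferences. For matchings $N,M$ and $a\in A$, $\mathsf{vote}^\kappa_a(N,M)$ equals $1$ if $a$ is matched in both and $N(a)\succ_a M(a)$; $-1$ if $a$ is matched in both and $M(a)\succ_a N(a)$; $\kappa$ if $a$ is matched in $N$ but not in $M$; $-\kappa$ if $a$ is matched in $M$ but not in $N$; and $0$ otherwise. A matching $M$ is popular with penalty $\kappa$ if $\sum_{a\in A}\mathsf{vote}^\kappa_a(N,M)\le 0$ for every matching $N$ of $G$. *)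

theory Defs
  imports Complex_Main
begin

section \<open>Popular matchings with penalty\<close>

text \<open>
  Agents and objects have separate types, so \<^term>\<open>A <+> B\<close> is the vertex set of the bipartite
  graph. An edge is a pair (agent, object), and \<open>(b, b') \<in> prefs G a\<close> means that \<open>a\<close> strictly
  prefers \<open>b\<close> to \<open>b'\<close>.
\<close>

record ('a, 'b) bipartite_prefs =
  agents :: "'a set"
  objects :: "'b set"
  edges :: "('a \<times> 'b) set"
  prefs :: "'a \<Rightarrow> ('b \<times> 'b) set"

definition vertices :: "('a, 'b) bipartite_prefs \<Rightarrow> ('a + 'b) set" where
  "vertices G = agents G <+> objects G"

definition neighbors :: "('a, 'b) bipartite_prefs \<Rightarrow> 'a \<Rightarrow> 'b set" where
  "neighbors G a = {b. (a, b) \<in> edges G}"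

locale popular_matching_instance =
  fixes G :: "('a, 'b) bipartite_prefs"
  assumes finite_agents: "finite (agents G)"
    and finite_objects: "finite (objects G)"
    and edges_subset: "edges G \<subseteq> agents G \<times> objects G"
    and prefs_subset: "a \<in> agents G \<Longrightarrow> prefs G a \<subseteq> neighbors G a \<times> neighbors G a"
    and prefs_irrefl: "a \<in> agents G \<Longrightarrow> irrefl (prefs G a)"
    and prefs_trans: "a \<in> agents G \<Longrightarrow> trans (prefs G a)"

definition matching :: "('a, 'b) bipartite_prefs \<Rightarrow> ('a \<times> 'b) set \<Rightarrow> bool" where
  "matching G M \<longleftrightarrow> M \<subseteq> edges G \<and> inj_on fst M \<and> inj_on snd M"

definition partner :: "('a \<times> 'b) set \<Rightarrow> 'a \<Rightarrow> 'b option" where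
  "partner M a = (if \<exists>b. (a, b) \<in> M then Some (THE b. (a, b) \<in> M) else None)"

definition vote ::
  "nat \<Rightarrow> ('a, 'b) bipartite_prefs \<Rightarrow> 'a \<Rightarrow> ('a \<times> 'b) set \<Rightarrow> ('a \<times> 'b) set \<Rightarrow> int" where
  "vote \<kappa> G a N M =
    (case (partner N a, partner M a) of
       (Some b, Some b') \<Rightarrow>
         if (b, b') \<in> prefs G a then 1 else if (b', b) \<in> prefs G a then - 1 else 0
     | (Some b, None) \<Rightarrow> int \<kappa>
     | (None, Some b') \<Rightarrow> - int \<kappa>
     | (None, None) \<Rightarrow> 0)"

definition popular_with_penalty ::
  "nat \<Rightarrow> ('a, 'b) bipartite_prefs \<Rightarrow> ('a \<times> 'b) set \<Rightarrow> bool" where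
  "popular_with_penalty \<kappa> G M \<longleftrightarrow>
    matching G M \<and> (\<forall>N. matching G N \<longrightarrow> (\<Sum>a\<in>agents G. vote \<kappa> G a N M) \<le> 0)"


section \<open>Word RAM\<close>

text \<open>
  Programs are while programs over registers and an indirectly addressed memory whose cells hold
  \<open>w\<close>-bit words. Arithmetic is modulo \<open>2 ^ w\<close>, except that subtraction is cut off at 0. Every
  operation, memory access and control step costs one time unit.
\<close>

datatype binop = Plus | Minus | Times | Less | Equal

datatype exp = Const nat | Reg nat | Mem exp | Op binop exp exp

datatype cmd =
    Skip
  | Assign nat exp
  | Store exp exp
  | Seq cmd cmd
  | If exp cmd cmd
  | While exp cmd

type_synonym state = "(nat \<Rightarrow> nat) \<times> (nat \<Rightarrow> nat)"  \<comment> \<open>registers, memory\<close>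

fun binop_val :: "binop \<Rightarrow> nat \<Rightarrow> nat \<Rightarrow> nat" where
  "binop_val Plus x y = x + y"
| "binop_val Minus x y = x - y"
| "binop_val Times x y = x * y"
| "binop_val Less x y = of_bool (x < y)"
| "binop_val Equal x y = of_bool (x = y)"

fun exp_val :: "nat \<Rightarrow> exp \<Rightarrow> state \<Rightarrow> nat" where
  "exp_val w (Const k) s = k mod 2 ^ w"
| "exp_val w (Reg r) s = fst s r"
| "exp_val w (Mem e) s = snd s (exp_val w e s)"
| "exp_val w (Op f e e') s = binop_val f (exp_val w e s) (exp_val w e' s) mod 2 ^ w"

fun exp_cost :: "exp \<Rightarrow> nat" where
  "exp_cost (Const k) = 1"
| "exp_cost (Reg r) = 1"
| "exp_cost (Mem e) = 1 + exp_cost e"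
| "exp_cost (Op f e e') = 1 + exp_cost e + exp_cost e'"

text \<open>
  \<open>exec w c s t s'\<close>: with word size \<open>w\<close>, the program \<open>c\<close> started in \<open>s\<close> halts in \<open>s'\<close> after exactly
  \<open>t\<close> time units.
\<close>

inductive exec :: "nat \<Rightarrow> cmd \<Rightarrow> state \<Rightarrow> nat \<Rightarrow> state \<Rightarrow> bool" for w :: nat where
  Skip: "exec w Skip s 1 s"
| Assign: "exec w (Assign r e) s (1 + exp_cost e) ((fst s)(r := exp_val w e s), snd s)"
| Store: "exec w (Store e e') s (1 + exp_cost e + exp_cost e')
            (fst s, (snd s)(exp_val w e s := exp_val w e' s))"
| Seq: "exec w c s t s' \<Longrightarrow> exec w c' s' t' s'' \<Longrightarrow> exec w (Seq c c') s (t + t') s''"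
| IfTrue: "exp_val w e s \<noteq> 0 \<Longrightarrow> exec w c s t s' \<Longrightarrow>
            exec w (If e c c') s (1 + exp_cost e + t) s'"
| IfFalse: "exp_val w e s = 0 \<Longrightarrow> exec w c' s t s' \<Longrightarrow>
            exec w (If e c c') s (1 + exp_cost e + t) s'"
| WhileFalse: "exp_val w e s = 0 \<Longrightarrow> exec w (While e c) s (1 + exp_cost e) s"
| WhileTrue: "exp_val w e s \<noteq> 0 \<Longrightarrow> exec w c s t s' \<Longrightarrow> exec w (While e c) s' t' s'' \<Longrightarrow>
            exec w (While e c) s (1 + exp_cost e + t + t') s''"

inductive_cases exec_SkipE: "exec w Skip s t s'"
  and exec_AssignE: "exec w (Assign r e) s t s'"
  and exec_StoreE: "exec w (Store e e') s t s'"
  and exec_SeqE: "exec w (Seq c c') s t s'"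
  and exec_IfE: "exec w (If e c c') s t s'"
  and exec_WhileE: "exec w (While e c) s t s'"

lemma exec_deterministic:
  "exec w c s t s' \<Longrightarrow> exec w c s u s'' \<Longrightarrow> u = t \<and> s'' = s'"
proof (induction arbitrary: u s'' rule: exec.induct)
  case (Skip s)
  from Skip.prems show ?case by (rule exec_SkipE) simp
next
  case (Assign r e s)
  from Assign.prems show ?case by (rule exec_AssignE) simp
next
  case (Store e e' s)
  from Store.prems show ?case by (rule exec_StoreE) simp
next
  case (Seq c s t s' c' t' s1)
  from Seq.prems show ?case
    by (rule exec_SeqE) (use Seq.IH in metis)
next
  case (IfTrue e s c t s' c')
  from IfTrue.prems show ?case
    by (rule exec_IfE) (use IfTrue.hyps(1) in \<open>auto dest!: IfTrue.IH\<close>)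
next
  case (IfFalse e s c' t s' c)
  from IfFalse.prems show ?case
    by (rule exec_IfE) (use IfFalse.hyps(1) in \<open>auto dest!: IfFalse.IH\<close>)
next
  case (WhileFalse e s c)
  from WhileFalse.prems show ?case
    by (rule exec_WhileE) (use WhileFalse.hyps in auto)
next
  case (WhileTrue e s c t s' t' s1)
  from WhileTrue.prems show ?case
  proof (rule exec_WhileE)
    fix v s2 v'
    assume "u = Suc (exp_cost e + v + v')" "exec w c s v s2" "exec w (While e c) s2 v' s''"
    with WhileTrue.IH show ?thesis by (metis plus_1_eq_Suc add_Suc)
  qed (use WhileTrue.hyps(1) in simp)
qed


section \<open>Input and output of the problem on the word RAM\<close>

definition numbered :: "(nat, nat) bipartite_prefs \<Rightarrow> bool" where
  "numbered G \<longleftrightarrow>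
    agents G = {..<card (agents G)} \<and> objects G = {..<card (objects G)}"

text \<open>
  The numbers \<open>p\<close> of agents and \<open>q\<close> of objects and the penalty are followed by the adjacency matrix
  (entry \<open>(a, b)\<close> at offset \<open>a * q + b\<close>) and the comparison tables of the agents
  (entry \<open>(b, b')\<close> of \<open>a\<close> at offset \<open>(a * q + b) * q + b'\<close>).
\<close>

definition input_words :: "(nat, nat) bipartite_prefs \<Rightarrow> nat \<Rightarrow> nat list" where
  "input_words G \<kappa> =
    (let p = card (agents G); q = card (objects G) in
     [p, q, \<kappa>]
     @ map (\<lambda>i. of_bool ((i div q, i mod q) \<in> edges G)) [0..<p * q]
     @ map (\<lambda>i. of_bool ((i div q mod q, i mod q) \<in> prefs G (i div (q * q)))) [0..<p * q * q])"

definition initial_state :: "nat list \<Rightarrow> state" where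
  "initial_state xs = (\<lambda>_. 0, \<lambda>i. if i < length xs then xs ! i else 0)"

text \<open>Cell \<open>a\<close> holds 0 if agent \<open>a\<close> is unmatched, and \<open>b + 1\<close> if she is matched to \<open>b\<close>.\<close>

definition output_matching :: "(nat, nat) bipartite_prefs \<Rightarrow> state \<Rightarrow> (nat \<times> nat) set" where
  "output_matching G s = {(a, b). a \<in> agents G \<and> snd s a = Suc b}"

end

theory Submission
  imports Defs
begin

text \<open>
  Give every agent a private last resort and add indifferent dummy agents, so that matchings become
  permutations. By linear programming duality, \<open>M\<close> is popular with penalty \<open>\<kappa>\<close> iff there are
  prices in \<open>{0..\<kappa>}\<close> under which every agent gets an object that she demands: the price of any
  other object exceeds its price by at least her vote for the other one. Start from prices \<open>\<kappa>\<close> and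
  keep them above those of a fixed solution. If no augmenting path of the demand graph starts from
  an unmatched object, then its price is too high and drops by 1; this ends at most \<open>n * \<kappa>\<close>
  rounds. In a round, an auction with labels capped at \<open>c = \<lceil>sqrt n\<rceil>\<close> leaves a matching with at most
  \<open>c\<close> edges less than the maximum, and at most \<open>c + 1\<close> breadth-first searches complete it or find
  such an object. A price drop changes the demand graph only through comparisons with one object, so
  it costs \<open>O(n\<^sup>2)\<close>, a round \<open>O(n\<^sup>2 * c)\<close>, and everything \<open>O(n powr (7 / 2) * \<kappa>)\<close>.
\<close>

section \<open>Prices and matchings\<close>

text \<open>The prices of the fixed solution occur only in the analysis: they are the invariant
  lower bound that makes every reduction safe, and this is where the existence of a popular matching
  enters. One reduction can remove demanded pairs at every other object and so destroy many matched
  pairs at once; therefore the matching is rebuilt from nothing in each round, and only the prices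
  and the demand relation persist. The cap balances two costs. With labels up to \<open>c\<close>
  there are about n * c bids, each a scan in O(n), while the auction may miss n / c pairs, each
  repaired by one search in O(n * n); both are of order n * n * sqrt n when \<open>c\<close> is near
  sqrt n. Integral prices suffice because they arise as longest path weights for integral votes. The
  running time is even linear in \<kappa>; the exponent 5 / 2 is reached only by a final
  estimate.\<close>

type_synonym vec = "nat \<Rightarrow> nat"

text \<open>
  The vote of \<open>a\<close> for \<open>b\<close> against \<open>b'\<close> is \<open>g a b b' - g a b' b\<close>. Both sides of the comparison of prices
  are moved so that no subtraction occurs.
\<close>

definition bad :: "(nat \<Rightarrow> nat \<Rightarrow> nat \<Rightarrow> nat) \<Rightarrow> vec \<Rightarrow> nat \<Rightarrow> nat \<Rightarrow> nat \<Rightarrow> bool" where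
  "bad g z a b b' \<longleftrightarrow> z b + g a b' b < z b' + g a b b'"

definition demand :: "nat \<Rightarrow> (nat \<Rightarrow> nat \<Rightarrow> nat \<Rightarrow> nat) \<Rightarrow> vec \<Rightarrow> nat \<Rightarrow> nat \<Rightarrow> bool" where
  "demand N g z a b \<longleftrightarrow> (\<forall>b'<N. \<not> bad g z a b' b)"

definition equilibrium :: "nat \<Rightarrow> (nat \<Rightarrow> nat \<Rightarrow> nat \<Rightarrow> nat) \<Rightarrow> vec \<Rightarrow> vec \<Rightarrow> bool" where
  "equilibrium N g z \<sigma> \<longleftrightarrow> bij_betw \<sigma> {..<N} {..<N} \<and> (\<forall>a<N. demand N g z a (\<sigma> a))"

text \<open>A partial matching is stored by agents, with \<open>0\<close> for unmatched and \<open>b + 1\<close> for object \<open>b\<close>.\<close>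

definition pmatch :: "nat \<Rightarrow> (nat \<Rightarrow> nat \<Rightarrow> bool) \<Rightarrow> vec \<Rightarrow> bool" where
  "pmatch N E m \<longleftrightarrow> (\<forall>a<N. m a \<noteq> 0 \<longrightarrow> m a \<le> N \<and> E a (m a - 1)) \<and>
    (\<forall>a<N. \<forall>a'<N. m a = m a' \<longrightarrow> m a \<noteq> 0 \<longrightarrow> a = a')"

definition msize :: "nat \<Rightarrow> vec \<Rightarrow> nat" where
  "msize N m = card {a. a < N \<and> m a \<noteq> 0}"

text \<open>With the price of \<open>b\<close> fixed, raising the other prices can only make
  \<open>b\<close> more attractive.\<close>

lemma demand_lift:
  assumes "demand N g z' a b" "\<forall>b<N. z' b \<le> z b" "z b = z' b"
  shows "demand N g z a b"
  unfolding demand_def bad_def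
proof (intro allI impI)
  fix b' assume "b' < N"
  with assms(1,2) have "z' b + g a b' b \<le> z' b' + g a b b'" "z' b' \<le> z b'"
    unfolding demand_def bad_def by (auto simp: not_less)
  with assms(3) show "\<not> z b' + g a b b' < z b + g a b' b" by linarith
qed

text \<open>The two demand inequalities bound the same vote from both sides; adding them cancels the
  votes and leaves \<open>z b1 \<le> z' b1\<close>. Hence tightness passes from the object an agent
  owns in the equilibrium to the one she holds now.\<close>

lemma demand_tight:
  assumes "demand N g z a b1" "demand N g z' a b" "\<forall>b<N. z' b \<le> z b" "z b = z' b" "b < N" "b1 < N"
  shows "z b1 = z' b1"
proof -
  have "z b1 + g a b b1 \<le> z b + g a b1 b" using assms(1,5) unfolding demand_def bad_def by (auto simp: not_less)
  moreover have "z' b + g a b1 b \<le> z' b1 + g a b b1"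
    using assms(2,6) unfolding demand_def bad_def by (auto simp: not_less)
  moreover have "z' b1 \<le> z b1" using assms by auto
  ultimately show ?thesis using assms(4) by linarith
qed

text \<open>
  \<open>V\<close> is the set of agents reached by a failed search from \<open>b\<close>, and \<open>R\<close> that of objects. If the
  price of \<open>b\<close> were tight, then going from an object to its equilibrium owner and on to her current
  object would map the tight objects of \<open>R\<close> injectively into themselves, but never to \<open>b\<close>.
\<close>

lemma overpriced:
  assumes eq: "equilibrium N g z' \<sigma>" and le: "\<forall>b<N. z' b \<le> z b"
    and m: "pmatch N (demand N g z) m" and b: "b < N" "\<forall>a<N. m a \<noteq> Suc b"
    and V: "V \<subseteq> {..<N}" "\<forall>a\<in>V. m a \<noteq> 0"
    and closed: "\<forall>a<N. demand N g z a b \<longrightarrow> a \<in> V"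
      "\<forall>v\<in>V. \<forall>a<N. demand N g z a (m v - 1) \<longrightarrow> a \<in> V"
  shows "z' b < z b"
proof (rule ccontr)
  assume "\<not> z' b < z b"
  then have zb: "z b = z' b" using le b by force
  define R where "R = insert b ((\<lambda>v. m v - 1) ` V)"
  define T where "T = {x \<in> R. z x = z' x}"
  define \<phi> where "\<phi> x = m (inv_into {..<N} \<sigma> x) - 1" for x
  have R: "R \<subseteq> {..<N}" using V b m unfolding R_def pmatch_def by fastforce
  have fin: "finite T" by (rule finite_subset[of _ "{..<N}"]) (use R in \<open>auto simp: T_def\<close>)
  have bij: "bij_betw \<sigma> {..<N} {..<N}" and dem: "\<forall>a<N. demand N g z' a (\<sigma> a)"
    using eq unfolding equilibrium_def by auto
  have own: "\<exists>a\<in>V. inv_into {..<N} \<sigma> x = a \<and> a < N \<and> \<sigma> a = x \<and> m a \<noteq> 0 \<and> \<phi> x \<in> T" if x: "x \<in> T" for x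
  proof -
    define a where "a = inv_into {..<N} \<sigma> x"
    have xN: "x < N" and zx: "z x = z' x" "x \<in> R" using x R unfolding T_def by auto
    have x_im: "x \<in> \<sigma> ` {..<N}" using bij xN unfolding bij_betw_def by simp
    have a: "a < N" "\<sigma> a = x" using inv_into_into[OF x_im] f_inv_into_f[OF x_im] unfolding a_def by auto
    have "demand N g z' a x" using dem a by auto
    \<comment> \<open>The owner of a tight object demands it at the current prices too, so the
      failed search has reached her.\<close>
    from demand_lift[OF this le zx(1)] have "demand N g z a x" .
    moreover have "x = b \<or> (\<exists>v\<in>V. x = m v - 1)" using zx(2) unfolding R_def by auto
    ultimately have aV: "a \<in> V" using closed a(1) by metis
    have m0: "m a \<noteq> 0" using V aV by auto
    have d: "demand N g z a (m a - 1)" "m a \<le> N" using m a m0 unfolding pmatch_def by auto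
    have "z (m a - 1) = z' (m a - 1)"
      using demand_tight[OF d(1) \<open>demand N g z' a x\<close> le zx(1) xN] d(2) m0 by linarith
    moreover have "m a - 1 \<in> R" using aV unfolding R_def by auto
    ultimately have "\<phi> x \<in> T" unfolding T_def \<phi>_def a_def by auto
    then show ?thesis using aV a m0 unfolding a_def by auto
  qed
  have "inj_on \<phi> T"
  proof (rule inj_onI)
    fix x x' assume h: "x \<in> T" "x' \<in> T" "\<phi> x = \<phi> x'"
    obtain a where a: "inv_into {..<N} \<sigma> x = a" "a < N" "\<sigma> a = x" "m a \<noteq> 0" using own[OF h(1)] by blast
    obtain a' where a': "inv_into {..<N} \<sigma> x' = a'" "a' < N" "\<sigma> a' = x'" "m a' \<noteq> 0" using own[OF h(2)] by blast
    have "m a = m a'" using h(3) a a' unfolding \<phi>_def by simp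
    then have "a = a'" using m a a' unfolding pmatch_def by blast
    then show "x = x'" using a a' by auto
  qed
  moreover have "\<phi> ` T \<subseteq> T" using own by auto
  ultimately have "\<phi> ` T = T" using fin by (simp add: endo_inj_surj)
  moreover have "b \<in> T" using zb unfolding T_def R_def by auto
  ultimately obtain x where x: "x \<in> T" "\<phi> x = b" by (metis imageE)
  obtain a where "inv_into {..<N} \<sigma> x = a" "a < N" "m a \<noteq> 0" using own[OF x(1)] by blast
  then have "m a = Suc b" using x(2) unfolding \<phi>_def by simp
  then show False using b \<open>a < N\<close> by auto
qed

text \<open>
  The labels \<open>y\<close> and the profits \<open>c + 1 - y a\<close> of the matched objects are a fractional vertex cover of
  value \<open>(c + 1) |m|\<close> in which every edge has weight at least \<open>c\<close>.
\<close>

lemma auction_bound: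
  assumes m: "pmatch N E m" and m': "pmatch N E m'"
    and y0: "\<forall>a<N. m a = 0 \<longrightarrow> y a = 0" and yc: "\<forall>a<N. y a \<le> c"
    and near: "\<forall>a<N. m a \<noteq> 0 \<longrightarrow> (\<forall>a'<N. E a' (m a - 1) \<longrightarrow> y a \<le> y a' + 1)"
    and free: "\<forall>b<N. (\<forall>a<N. m a \<noteq> Suc b) \<longrightarrow> (\<forall>a<N. E a b \<longrightarrow> c \<le> y a)"
    and c: "N \<le> c * c"
  shows "msize N m' \<le> msize N m + c"
proof (cases "c = 0")
  case True
  then show ?thesis using c by (simp add: msize_def)
next
  case False
  define D where "D = {a. a < N \<and> m a \<noteq> 0}"
  define D' where "D' = {a. a < N \<and> m' a \<noteq> 0}"
  have fin: "finite D" "finite D'" unfolding D_def D'_def by auto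
  \<comment> \<open>A sum with at most one nonzero term: the profit of \<open>b\<close> if it is
    matched, and 0 otherwise. In this form the order of summation can be exchanged.\<close>
  define \<pi> where "\<pi> b = (\<Sum>a\<in>D. if m a = Suc b then c + 1 - y a else 0)" for b
  have edge: "c \<le> y a + \<pi> b" if ab: "a < N" "b < N" "E a b" for a b
  proof (cases "\<exists>a'<N. m a' = Suc b")
    case True
    then obtain a' where a': "a' < N" "m a' = Suc b" by blast
    then have "a' \<in> D" unfolding D_def by auto
    then have "(if m a' = Suc b then c + 1 - y a' else 0) \<le> \<pi> b"
      unfolding \<pi>_def using fin by (intro member_le_sum) auto
    moreover have "y a' \<le> y a + 1" using near a' ab by force
    ultimately show ?thesis using a' by simp
  next
    case False
    then show ?thesis using free ab by (simp add: trans_le_add1)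
  qed
  have "c * card D' = (\<Sum>a\<in>D'. c)" by simp
  also have "\<dots> \<le> (\<Sum>a\<in>D'. y a + \<pi> (m' a - 1))"
    using m' by (intro sum_mono edge) (auto simp: D'_def pmatch_def)
  also have "\<dots> = sum y D' + (\<Sum>a\<in>D'. \<pi> (m' a - 1))" by (simp add: sum.distrib)
  also have "(\<Sum>a\<in>D'. \<pi> (m' a - 1)) = sum \<pi> ((\<lambda>a. m' a - 1) ` D')"
  proof (rule sum.reindex_cong[symmetric, OF _ refl refl], rule inj_onI)
    fix a a' assume h: "a \<in> D'" "a' \<in> D'" "m' a - 1 = m' a' - 1"
    then have "m' a = m' a'" unfolding D'_def by auto
    then show "a = a'" using m' h unfolding pmatch_def D'_def by auto
  qed
  also have "\<dots> \<le> sum \<pi> {..<N}"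
    using m' by (intro sum_mono2) (auto simp: D'_def pmatch_def)
  also have "sum y D' \<le> sum y {..<N}" by (intro sum_mono2) (auto simp: D'_def)
  also have "sum y {..<N} = sum y D"
    by (rule sum.mono_neutral_right) (use y0 in \<open>auto simp: D_def\<close>)
  also have "sum \<pi> {..<N} = (\<Sum>a\<in>D. \<Sum>b<N. if m a = Suc b then c + 1 - y a else 0)"
    unfolding \<pi>_def by (rule sum.swap)
  also have "\<dots> = (\<Sum>a\<in>D. c + 1 - y a)"
  proof (rule sum.cong[OF refl])
    fix a assume "a \<in> D"
    then have a: "m a \<noteq> 0" "m a \<le> N" using m unfolding D_def pmatch_def by auto
    then have "m a = Suc b \<longleftrightarrow> b = m a - 1" for b by auto
    then show "(\<Sum>b<N. if m a = Suc b then c + 1 - y a else 0) = c + 1 - y a"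
      using a by (simp add: sum.delta)
  qed
  finally have "c * card D' \<le> sum y D + (\<Sum>a\<in>D. c + 1 - y a)" by simp
  also have "\<dots> = (\<Sum>a\<in>D. c + 1)"
    unfolding sum.distrib[symmetric] by (rule sum.cong[OF refl]) (use yc in \<open>auto simp: D_def le_Suc_eq\<close>)
  finally have "c * card D' \<le> c * card D + card D" by (simp add: algebra_simps)
  \<comment> \<open>The factor (c + 1) / c costs at most card D / c, and \<open>card D\<close> is at
    most \<open>N\<close>, hence at most \<open>c * c\<close>.\<close>
  moreover have "card D \<le> N" using card_mono[of "{..<N}" D] unfolding D_def by auto
  ultimately have "c * card D' \<le> c * (card D + c)" using c by (simp add: algebra_simps)
  then show ?thesis using False unfolding msize_def D_def D'_def by simp
qed

section \<open>Popular matchings as equilibria\<close>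

fun path_weight :: "('a \<Rightarrow> 'a \<Rightarrow> int) \<Rightarrow> 'a list \<Rightarrow> int" where
  "path_weight u (x # y # xs) = u x y + path_weight u (y # xs)"
| "path_weight u _ = 0"

lemma path_weight_append:
  "path_weight u (xs @ b # ys) = path_weight u (xs @ [b]) + path_weight u (b # ys)"
  by (induction u xs rule: path_weight.induct) (cases ys; simp)+

lemma path_weight_snoc: "xs \<noteq> [] \<Longrightarrow> path_weight u (xs @ [b]) = path_weight u xs + u (last xs) b"
  by (induction u xs rule: path_weight.induct) auto

text \<open>A simple path closed to a cycle is a cyclic permutation of its vertices. The image of
  the last vertex is part of the claim because the induction splices the new head in there.\<close>

lemma cycle_permutation:
  assumes "distinct (x # xs)"
  shows "\<exists>\<pi>. bij_betw \<pi> (set (x # xs)) (set (x # xs)) \<and> \<pi> (last (x # xs)) = x \<and>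
    (\<Sum>v\<in>set (x # xs). u v (\<pi> v)) = path_weight u (x # xs) + u (last (x # xs)) x"
  using assms
proof (induction xs arbitrary: x)
  case Nil
  then show ?case by (intro exI[of _ id]) auto
next
  case (Cons y ys)
  define S where "S = set (y # ys)"
  define l where "l = last (y # ys)"
  have S: "finite S" "x \<notin> S" "l \<in> S" "y \<in> S" using Cons.prems unfolding S_def l_def by auto
  obtain \<pi> where \<pi>: "bij_betw \<pi> S S" "\<pi> l = y" "(\<Sum>v\<in>S. u v (\<pi> v)) = path_weight u (y # ys) + u l y"
    using Cons.IH[of y] Cons.prems unfolding S_def l_def by auto
  \<comment> \<open>The arc from the last vertex back to \<open>y\<close> is replaced by a detour
    through the new head \<open>x\<close>.\<close>
  let ?\<rho> = "\<pi>(l := x, x := y)"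
  have \<pi>y: "\<pi> v \<noteq> y" if "v \<in> S" "v \<noteq> l" for v
    using that \<pi>(1,2) S unfolding bij_betw_def inj_on_def by metis
  have \<pi>S: "\<pi> v \<in> S" if "v \<in> S" for v using \<pi>(1) that unfolding bij_betw_def by auto
  have inj: "inj_on ?\<rho> (insert x S)"
  proof (rule inj_onI)
    fix v v' assume h: "v \<in> insert x S" "v' \<in> insert x S" "?\<rho> v = ?\<rho> v'"
    have "\<pi> v = \<pi> v' \<Longrightarrow> v \<in> S \<Longrightarrow> v' \<in> S \<Longrightarrow> v = v'" using \<pi>(1) unfolding bij_betw_def inj_on_def by blast
    then show "v = v'" using h S \<pi>y[of v] \<pi>y[of v'] \<pi>S[of v] \<pi>S[of v'] by (auto split: if_splits)
  qed
  have "?\<rho> ` insert x S \<subseteq> insert x S" using \<pi>S S by auto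
  from endo_inj_surj[OF _ this inj] have bij: "bij_betw ?\<rho> (insert x S) (insert x S)"
    using S(1) inj unfolding bij_betw_def by blast
  have "(\<Sum>v\<in>insert x S. u v (?\<rho> v)) = u x y + (\<Sum>v\<in>S. u v (?\<rho> v))" using S by simp
  also have "(\<Sum>v\<in>S. u v (?\<rho> v)) = u l x + (\<Sum>v\<in>S - {l}. u v (?\<rho> v))"
    using S by (subst sum.remove[of S l]) auto
  also have "(\<Sum>v\<in>S - {l}. u v (?\<rho> v)) = (\<Sum>v\<in>S - {l}. u v (\<pi> v))"
    using S by (intro sum.cong) auto
  also have "\<dots> = path_weight u (y # ys)"
    using \<pi>(2,3) S sum.remove[of S l "\<lambda>v. u v (\<pi> v)"] by simp
  finally have "(\<Sum>v\<in>insert x S. u v (?\<rho> v)) = path_weight u (x # y # ys) + u l x"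
    by (simp del: fun_upd_apply)
  moreover have "?\<rho> l = x" using S by auto
  moreover have "set (x # y # ys) = insert x S" "last (x # y # ys) = l" unfolding S_def l_def by auto
  ultimately show ?case using bij by (intro exI[of _ ?\<rho>]) (simp del: fun_upd_apply)
qed

text \<open>Longest path weights are potentials when no cycle is positive. Simple paths keep the
  maximum over a finite set: an extension that would return to \<open>b\<close> is cut there, and
  the removed part closes to a cycle. Paths may start anywhere, and integral weights give integral
  potentials.\<close>

lemma potentials:
  fixes u :: "'a \<Rightarrow> 'a \<Rightarrow> int"
  assumes V: "finite V" and u0: "\<And>v. u v v = 0"
    and perm: "\<And>\<pi>. bij_betw \<pi> V V \<Longrightarrow> (\<Sum>v\<in>V. u v (\<pi> v)) \<le> 0"
  shows "\<exists>h. \<forall>v\<in>V. \<forall>b\<in>V. h v + u v b \<le> h b"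
proof -
  define P where "P b = {xs. distinct xs \<and> set xs \<subseteq> V \<and> xs \<noteq> [] \<and> last xs = b}" for b
  define h where "h b = Max (path_weight u ` P b)" for b
  have fin: "finite (P b)" for b
  proof (rule finite_subset)
    show "P b \<subseteq> {xs. set xs \<subseteq> V \<and> length xs \<le> card V}"
      unfolding P_def using V by (auto simp: distinct_card[symmetric] intro!: card_mono)
    show "finite {xs. set xs \<subseteq> V \<and> length xs \<le> card V}" using finite_lists_length_le[OF V] .
  qed
  have ge: "path_weight u xs \<le> h b" if "xs \<in> P b" for xs b
    unfolding h_def using fin that by simp
  have cycle: "path_weight u (x # xs) + u (last (x # xs)) x \<le> 0" if d: "distinct (x # xs)" "set (x # xs) \<subseteq> V" for x xs
  proof -
    obtain \<pi> where \<pi>: "bij_betw \<pi> (set (x # xs)) (set (x # xs))"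
      "(\<Sum>v\<in>set (x # xs). u v (\<pi> v)) = path_weight u (x # xs) + u (last (x # xs)) x"
      using cycle_permutation[OF d(1)] by blast
    \<comment> \<open>Fixing the vertices off the cycle adds only terms \<open>u v v = 0\<close>, so
      the hypothesis on permutations of all of \<open>V\<close> applies.\<close>
    define \<rho> where "\<rho> v = (if v \<in> set (x # xs) then \<pi> v else v)" for v
    have "bij_betw \<rho> (set (x # xs) \<union> (V - set (x # xs))) (set (x # xs) \<union> (V - set (x # xs)))"
    proof (rule bij_betw_combine)
      show "bij_betw \<rho> (set (x # xs)) (set (x # xs))"
        using \<pi>(1) by (rule bij_betw_cong[THEN iffD1, rotated]) (simp add: \<rho>_def)
      show "bij_betw \<rho> (V - set (x # xs)) (V - set (x # xs))"
        by (rule bij_betw_cong[THEN iffD1, rotated, OF bij_betw_id]) (simp add: \<rho>_def)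
    qed auto
    then have "bij_betw \<rho> V V" using d(2) by (simp only: Un_Diff_cancel Un_absorb1)
    from perm[OF this] have "(\<Sum>v\<in>V. u v (\<rho> v)) \<le> 0" .
    also have "(\<Sum>v\<in>V. u v (\<rho> v)) = (\<Sum>v\<in>set (x # xs). u v (\<rho> v))"
      by (rule sum.mono_neutral_right[OF V d(2)]) (auto simp: \<rho>_def u0)
    also have "\<dots> = (\<Sum>v\<in>set (x # xs). u v (\<pi> v))" by (rule sum.cong) (auto simp: \<rho>_def)
    finally show ?thesis using \<pi>(2) by simp
  qed
  have "h v + u v b \<le> h b" if vb: "v \<in> V" "b \<in> V" for v b
  proof -
    have "[v] \<in> P v" using vb by (simp add: P_def)
    then have "h v \<in> path_weight u ` P v" unfolding h_def by (intro Max_in) (use fin[of v] in auto)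
    then obtain xs where xs: "xs \<in> P v" "h v = path_weight u xs" by auto
    show ?thesis
    proof (cases "b \<in> set xs")
      case False
      then have "xs @ [b] \<in> P b" using xs vb by (simp add: P_def)
      from ge[OF this] show ?thesis using xs by (simp add: path_weight_snoc P_def)
    next
      case True
      then obtain ys zs where s: "xs = ys @ b # zs" by (meson split_list)
      \<comment> \<open>The prefix up to \<open>b\<close> competes for \<open>h b\<close>; the
        remainder together with the arc from \<open>v\<close> to \<open>b\<close> is a
        cycle.\<close>
      have "ys @ [b] \<in> P b" using xs(1) unfolding s P_def by auto
      from ge[OF this] have "path_weight u (ys @ [b]) \<le> h b" .
      moreover have "path_weight u (b # zs) + u v b \<le> 0"
        using cycle[of b zs] xs(1) unfolding s P_def by auto
      ultimately show ?thesis using xs(2) path_weight_append[of u ys b zs] unfolding s by linarith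
    qed
  qed
  then show ?thesis by blast
qed

text \<open>
  Object \<open>q + a\<close> is a private last resort of agent \<open>a\<close>, and the agents from \<open>p\<close> on are indifferent
  dummies that take the remaining objects, so that all matchings become permutations. The comparison
  \<open>\<kappa> + 1\<close> stands for a forbidden pair: it exceeds every gap between prices.
\<close>

definition ext_edge :: "(nat, nat) bipartite_prefs \<Rightarrow> nat \<Rightarrow> nat \<Rightarrow> bool" where
  "ext_edge G a b \<longleftrightarrow> (if b < card (objects G) then (a, b) \<in> edges G else b = card (objects G) + a)"

text \<open>The positive part of a vote. As a natural number it fits a memory cell, and the opposite
  sign is read off from the swapped arguments.\<close>

definition ext_gain :: "(nat, nat) bipartite_prefs \<Rightarrow> nat \<Rightarrow> nat \<Rightarrow> nat \<Rightarrow> nat \<Rightarrow> nat" where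
  "ext_gain G \<kappa> a b b' =
    (if \<not> a < card (agents G) \<or> \<not> ext_edge G a b then 0
    else if \<not> ext_edge G a b' then \<kappa> + 1
    else if b < card (objects G)
    then if b' < card (objects G) then of_bool ((b, b') \<in> prefs G a) else \<kappa>
    else 0)"

definition ext_wt :: "(nat, nat) bipartite_prefs \<Rightarrow> nat \<Rightarrow> nat \<Rightarrow> nat \<Rightarrow> nat \<Rightarrow> int" where
  "ext_wt G \<kappa> a b b' = int (ext_gain G \<kappa> a b b') - int (ext_gain G \<kappa> a b' b)"

definition assigned :: "(nat, nat) bipartite_prefs \<Rightarrow> (nat \<times> nat) set \<Rightarrow> nat \<Rightarrow> nat" where
  "assigned G M a = (case partner M a of Some b \<Rightarrow> b | None \<Rightarrow> card (objects G) + a)"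

section \<open>Matchings as permutations, votes as weights\<close>

locale numbered_instance = popular_matching_instance G for G :: "(nat, nat) bipartite_prefs" +
  fixes \<kappa> p q N :: nat
  assumes numbered: "numbered G"
  defines p_def: "p \<equiv> card (agents G)" and q_def: "q \<equiv> card (objects G)" and N_def: "N \<equiv> p + q"
begin

lemma agents_p: "agents G = {..<p}" and objects_q: "objects G = {..<q}"
  using numbered unfolding numbered_def p_def q_def by auto

lemma edge_bound: "(a, b) \<in> edges G \<Longrightarrow> a < p \<and> b < q"
  using edges_subset unfolding agents_p objects_q by auto

lemma partner_iff: "matching G M \<Longrightarrow> partner M a = Some b \<longleftrightarrow> (a, b) \<in> M"
proof -
  assume M: "matching G M"
  have u: "b = b'" if "(a, b) \<in> M" "(a, b') \<in> M" for b b'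
    using M that inj_onD[of fst M "(a, b)" "(a, b')"] unfolding matching_def by auto
  show ?thesis
  proof
    assume h: "partner M a = Some b"
    then have ex: "\<exists>b. (a, b) \<in> M" unfolding partner_def by (auto split: if_splits)
    then have "(a, THE b. (a, b) \<in> M) \<in> M" using u by (metis theI)
    then show "(a, b) \<in> M" using h ex unfolding partner_def by simp
  next
    assume h: "(a, b) \<in> M"
    then have "(THE b. (a, b) \<in> M) = b" using u by blast
    then show "partner M a = Some b" using h unfolding partner_def by auto
  qed
qed

text \<open>The real agents occupy \<open>p\<close> distinct objects, so exactly as many objects
  remain as there are dummies.\<close>

lemma assigned_extends:
  assumes M: "matching G M"
  shows "\<exists>\<sigma>. bij_betw \<sigma> {..<N} {..<N} \<and> (\<forall>a<p. \<sigma> a = assigned G M a)"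
proof -
  let ?f = "assigned G M"
  have real: "b < q \<and> (a, b) \<in> edges G" if "(a, b) \<in> M" for a b
    using that M edge_bound unfolding matching_def by blast
  have inj: "inj_on ?f {..<p}"
  proof (rule inj_onI)
    fix a a' assume h: "a \<in> {..<p}" "a' \<in> {..<p}" "?f a = ?f a'"
    have snd: "a = a'" if "(a, b) \<in> M" "(a', b) \<in> M" for b
      using M that inj_onD[of snd M "(a, b)" "(a', b)"] unfolding matching_def by auto
    show "a = a'"
      using h(3) snd real unfolding assigned_def q_def[symmetric]
      by (cases "partner M a"; cases "partner M a'") (force simp: partner_iff[OF M])+
  qed
  have im: "?f ` {..<p} \<subseteq> {..<N}"
    using real unfolding assigned_def q_def[symmetric] N_def
    by (auto simp: partner_iff[OF M] split: option.splits) (meson real trans_less_add2)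
  have "card ({..<N} - ?f ` {..<p}) = card {p..<N}"
    using card_Diff_subset[OF _ im] card_image[OF inj] by simp
  then obtain g where g: "bij_betw g {p..<N} ({..<N} - ?f ` {..<p})"
    using finite_same_card_bij[of "{p..<N}" "{..<N} - ?f ` {..<p}"] by auto
  define \<sigma> where "\<sigma> a = (if a < p then ?f a else g a)" for a
  have "bij_betw \<sigma> ({..<p} \<union> {p..<N}) (?f ` {..<p} \<union> ({..<N} - ?f ` {..<p}))"
  proof (rule bij_betw_combine)
    show "bij_betw \<sigma> {..<p} (?f ` {..<p})"
      by (rule bij_betw_cong[THEN iffD1, rotated, OF inj_on_imp_bij_betw[OF inj]]) (simp add: \<sigma>_def)
    show "bij_betw \<sigma> {p..<N} ({..<N} - ?f ` {..<p})"
      by (rule bij_betw_cong[THEN iffD1, rotated, OF g]) (simp add: \<sigma>_def)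
  qed auto
  moreover have "{..<p} \<union> {p..<N} = {..<N}" unfolding N_def by auto
  moreover have "?f ` {..<p} \<union> ({..<N} - ?f ` {..<p}) = {..<N}" using im by blast
  ultimately have "bij_betw \<sigma> {..<N} {..<N}" by simp
  moreover have "\<forall>a<p. \<sigma> a = ?f a" by (simp add: \<sigma>_def)
  ultimately show ?thesis by blast
qed

lemma ext_wt_dummy: "\<not> a < p \<Longrightarrow> ext_wt G \<kappa> a b b' = 0"
  by (simp add: ext_wt_def ext_gain_def p_def)

lemma assigned_edge: "matching G M \<Longrightarrow> ext_edge G a (assigned G M a)"
  using edge_bound unfolding assigned_def ext_edge_def q_def[symmetric]
  by (auto simp: matching_def partner_iff[of M] split: option.splits)

lemma assigned_real:
  assumes "matching G M"
  shows "partner M a = (if assigned G M a < q then Some (assigned G M a) else None)"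
proof (cases "partner M a")
  case (Some b)
  then have "b < q" using assms edge_bound unfolding partner_iff[OF assms] matching_def by blast
  then show ?thesis using Some by (simp add: assigned_def)
qed (simp add: assigned_def q_def)

text \<open>Assigned pairs are never forbidden, so the comparison \<open>\<kappa> + 1\<close> does
  not occur, and asymmetry of the preferences leaves at most one nonzero gain in the
  difference.\<close>

lemma vote_assigned:
  assumes "matching G M" "matching G M'" "a < p"
  shows "vote \<kappa> G a M' M = ext_wt G \<kappa> a (assigned G M' a) (assigned G M a)"
proof -
  let ?b = "assigned G M' a" and ?c = "assigned G M a"
  have e: "ext_edge G a ?b" "ext_edge G a ?c" using assigned_edge assms by auto
  have asym: "(c, b) \<notin> prefs G a" if "(b, c) \<in> prefs G a" for b c
    using that prefs_irrefl[of a] prefs_trans[of a] assms(3) agents_p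
    unfolding irrefl_def trans_def by blast
  have last: "b = q + a" if "ext_edge G a b" "\<not> b < q" for b
    using that unfolding ext_edge_def q_def[symmetric] by simp
  show ?thesis
    unfolding vote_def assigned_real[OF assms(1)] assigned_real[OF assms(2)] ext_wt_def ext_gain_def
      p_def[symmetric] q_def[symmetric]
    using e assms(3) asym by auto
qed

text \<open>Popularity says that no permutation has positive weight against the assignment of
  \<open>M\<close>, which is the cycle condition for potentials on the objects. What remains is to
  bring the potentials into the range up to \<kappa>.\<close>

lemma popular_imp_equilibrium:
  assumes pop: "popular_with_penalty \<kappa> G M"
  shows "\<exists>z \<sigma>. equilibrium N (ext_gain G \<kappa>) z \<sigma> \<and> (\<forall>b<N. z b \<le> \<kappa>)"
proof -
  have M: "matching G M" using pop unfolding popular_with_penalty_def by blast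
  obtain \<sigma> where \<sigma>: "bij_betw \<sigma> {..<N} {..<N}" "\<forall>a<p. \<sigma> a = assigned G M a"
    using assigned_extends[OF M] by blast
  define w where "w = ext_wt G \<kappa>"
  have w0: "w a b b = 0" for a b by (simp add: w_def ext_wt_def)
  have edge\<sigma>: "ext_edge G a (\<sigma> a)" if "a < p" for a using assigned_edge[OF M] \<sigma> that by simp
  \<comment> \<open>Dropping the forbidden pairs of \<open>\<tau>\<close> yields a matching. The
    agents concerned become unmatched and vote at least -\<kappa>, which is above the weight
    -(\<kappa> + 1) charged for a forbidden pair.\<close>
  have opt: "(\<Sum>a<N. w a (\<tau> a) (\<sigma> a)) \<le> 0" if \<tau>: "bij_betw \<tau> {..<N} {..<N}" for \<tau>
  proof -
    define M' where "M' = {(a, \<tau> a) |a. a < p \<and> \<tau> a < q \<and> (a, \<tau> a) \<in> edges G}"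
    have inj: "a = a'" if "a < p" "a' < p" "\<tau> a = \<tau> a'" for a a'
      using inj_onD[OF bij_betw_imp_inj_on[OF \<tau>] that(3)] that unfolding N_def by simp
    have M': "matching G M'" unfolding matching_def M'_def by (auto simp: inj_on_def inj)
    have le: "w a (\<tau> a) (\<sigma> a) \<le> vote \<kappa> G a M' M" if a: "a < p" for a
    proof (cases "ext_edge G a (\<tau> a)")
      case True
      have "assigned G M' a = \<tau> a"
      proof (cases "\<tau> a < q")
        case t: True
        then have "(a, \<tau> a) \<in> M'" using True a unfolding M'_def ext_edge_def q_def[symmetric] by auto
        then show ?thesis using partner_iff[OF M'] unfolding assigned_def by (metis option.simps(5))
      next
        case False
        then have "partner M' a = None" unfolding partner_def M'_def by simp
        then show ?thesis using True False unfolding assigned_def ext_edge_def q_def[symmetric] by simp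
      qed
      then show ?thesis using vote_assigned[OF M M' a] \<sigma> a by (simp add: w_def)
    next
      case False
      have "partner M' a = None"
        using False unfolding partner_def M'_def ext_edge_def q_def[symmetric] by auto
      then have "- int \<kappa> \<le> vote \<kappa> G a M' M" unfolding vote_def by (auto split: option.splits)
      moreover have "w a (\<tau> a) (\<sigma> a) = - int (\<kappa> + 1)"
        using False edge\<sigma>[OF a] a unfolding w_def ext_wt_def ext_gain_def p_def[symmetric] by simp
      ultimately show ?thesis by simp
    qed
    have "(\<Sum>a<N. w a (\<tau> a) (\<sigma> a)) = (\<Sum>a<p. w a (\<tau> a) (\<sigma> a))"
      by (rule sum.mono_neutral_right) (auto simp: N_def w_def ext_wt_dummy)
    also have "\<dots> \<le> (\<Sum>a<p. vote \<kappa> G a M' M)" by (rule sum_mono) (use le in simp)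
    also have "\<dots> \<le> 0" using pop M' unfolding popular_with_penalty_def agents_p by blast
    finally show ?thesis .
  qed
  define inv\<sigma> where "inv\<sigma> = inv_into {..<N} \<sigma>"
  have inv1: "inv\<sigma> (\<sigma> a) = a" if "a < N" for a
    using that \<sigma>(1) unfolding inv\<sigma>_def by (simp add: bij_betw_inv_into_left)
  have inv2: "\<sigma> (inv\<sigma> b) = b" "inv\<sigma> b < N" if "b < N" for b
    using that \<sigma>(1) bij_betw_inv_into_right[OF \<sigma>(1), of b] bij_betwE[OF bij_betw_inv_into[OF \<sigma>(1)]]
    unfolding inv\<sigma>_def by auto
  \<comment> \<open>The arc from object \<open>v\<close> to object \<open>b\<close> carries the vote
    of the owner of \<open>v\<close> for moving to \<open>b\<close>.\<close>
  have "\<exists>h. \<forall>v\<in>{..<N}. \<forall>b\<in>{..<N}. h v + w (inv\<sigma> v) b v \<le> h b"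
  proof (rule potentials)
    fix \<pi> assume \<pi>: "bij_betw \<pi> {..<N} {..<N}"
    have "(\<Sum>v<N. w (inv\<sigma> v) (\<pi> v) v) = (\<Sum>a<N. w (inv\<sigma> (\<sigma> a)) (\<pi> (\<sigma> a)) (\<sigma> a))"
      using sum.reindex_bij_betw[OF \<sigma>(1), of "\<lambda>v. w (inv\<sigma> v) (\<pi> v) v"] by simp
    also have "\<dots> = (\<Sum>a<N. w a ((\<pi> \<circ> \<sigma>) a) (\<sigma> a))" by (rule sum.cong) (auto simp: inv1)
    also have "\<dots> \<le> 0" by (rule opt) (rule bij_betw_trans[OF \<sigma>(1) \<pi>])
    finally show "(\<Sum>v<N. w (inv\<sigma> v) (\<pi> v) v) \<le> 0" .
  qed (auto simp: w0)
  then obtain h :: "nat \<Rightarrow> int" where h0: "\<forall>v<N. \<forall>b<N. h v + w (inv\<sigma> v) b v \<le> h b" by auto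
  have \<sigma>N: "\<sigma> a < N" if "a < N" for a using bij_betwE[OF \<sigma>(1)] that by auto
  have h: "h (\<sigma> a) + w a b (\<sigma> a) \<le> h b" if "a < N" "b < N" for a b
    using h0 \<sigma>N[OF that(1)] that(2) inv1[OF that(1)] by metis
  \<comment> \<open>The shift makes the minimum 0. A dummy, being indifferent, holds an object of
    minimal price, so her object costs 0.\<close>
  define z0 where "z0 b = nat (h b - Min (h ` {..<N}))" for b
  have z0: "int (z0 b) = h b - Min (h ` {..<N})" if "b < N" for b
    using that unfolding z0_def by simp
  have c0: "int (z0 (\<sigma> a)) + w a b (\<sigma> a) \<le> int (z0 b)" if "a < N" "b < N" for a b
    using h[OF that] z0[OF that(2)] z0[OF \<sigma>N[OF that(1)]] by simp
  have dummy: "z0 (\<sigma> a) = 0" if a: "a < N" "\<not> a < p" for a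
  proof -
    have "Min (h ` {..<N}) \<in> h ` {..<N}" using a(1) by (intro Min_in) auto
    then obtain b where b: "b < N" "Min (h ` {..<N}) = h b" by auto
    have "h (\<sigma> a) \<le> h b" using h[OF a(1) b(1)] ext_wt_dummy[OF a(2)] by (simp add: w_def)
    then show ?thesis using b unfolding z0_def by simp
  qed
  have lastN: "q + a < N" if "a < p" for a using that unfolding N_def by simp
  \<comment> \<open>Nothing bounds the potential of a last resort that its own agent holds. Setting
    its price to 0 is harmless: it is forbidden to the other real agents, and dummies hold objects
    of price 0.\<close>
  define own where "own b \<longleftrightarrow> \<not> b < q \<and> \<sigma> (b - q) = b" for b
  define z where "z b = (if own b then 0 else z0 b)" for b
  have last: "b = q + a" if "ext_edge G a b" "\<not> b < q" for a b
    using that unfolding ext_edge_def q_def[symmetric] by simp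
  have last_edge: "ext_edge G a (q + a)" for a unfolding ext_edge_def q_def[symmetric] by simp
  \<comment> \<open>The last resort of \<open>a\<close> is then left to a dummy and costs 0; her
    vote of -\<kappa> for moving there caps the price of the object she holds.\<close>
  have real_le: "z0 (\<sigma> a) \<le> \<kappa>" if a: "a < p" "\<sigma> a < q" for a
  proof -
    obtain a' where a': "a' < N" "\<sigma> a' = q + a" using inv2[OF lastN[OF a(1)]] by blast
    have "\<not> a' < p"
    proof
      assume "a' < p"
      then have "q + a = q + a'" using last[OF edge\<sigma>[of a']] a'(2) by simp
      then show False using a' a by simp
    qed
    then have "z0 (q + a) = 0" using dummy[of a'] a' by simp
    moreover have "w a (q + a) (\<sigma> a) = - int \<kappa>"
      using a edge\<sigma>[OF a(1)] last_edge unfolding w_def ext_wt_def ext_gain_def p_def[symmetric] q_def[symmetric] by simp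
    ultimately show ?thesis using c0[of a "q + a"] a lastN unfolding N_def by simp
  qed
  have forbidden: "w a b (\<sigma> a) = - int (\<kappa> + 1)" if "a < p" "\<not> ext_edge G a b" for a b
    using that edge\<sigma> unfolding w_def ext_wt_def ext_gain_def p_def[symmetric] by simp
  have own_edge: "b = q + a" if "own b" "ext_edge G a b" for a b
    using last that unfolding own_def by blast
  have z\<sigma>: "z (\<sigma> a) \<le> \<kappa> \<and> (if a < p \<and> \<sigma> a < q then z (\<sigma> a) = z0 (\<sigma> a) else z (\<sigma> a) = 0)" if a: "a < N" for a
  proof (cases "a < p")
    case True
    show ?thesis
    proof (cases "\<sigma> a < q")
      case False
      then have "\<sigma> a = q + a" using last edge\<sigma>[OF True] by blast
      then have "own (\<sigma> a)" unfolding own_def by simp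
      then show ?thesis using False unfolding z_def by simp
    qed (use real_le True in \<open>simp add: z_def own_def\<close>)
  qed (use dummy[OF a] in \<open>simp add: z_def\<close>)
  have c: "int (z (\<sigma> a)) + w a b (\<sigma> a) \<le> int (z b)" if a: "a < N" and b: "b < N" for a b
  proof (cases "a < p")
    case False
    then show ?thesis using z\<sigma>[OF a] ext_wt_dummy[OF False] by (simp add: w_def)
  next
    case ap: True
    show ?thesis
    proof (cases "ext_edge G a b")
      case False
      then show ?thesis using forbidden[OF ap False] z\<sigma>[OF a] by simp
    next
      case e: True
      show ?thesis
      proof (cases "\<sigma> a < q")
        case True
        have "\<not> own b"
        proof
          assume "own b"
          then have "b = q + a" using own_edge e by blast
          then show False using \<open>own b\<close> True unfolding own_def by simp
        qed
        then show ?thesis using c0[OF a b] z\<sigma>[OF a] ap True unfolding z_def by simp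
      next
        case False
        then have s: "\<sigma> a = q + a" using last edge\<sigma>[OF ap] by blast
        show ?thesis
        proof (cases "b < q")
          case True
          then have "z b = z0 b" unfolding z_def own_def by simp
          moreover have "z (\<sigma> a) = 0" using z\<sigma>[OF a] False by simp
          ultimately show ?thesis using c0[OF a b] by simp
        next
          case False
          then have "b = q + a" using last e by blast
          then show ?thesis using s w0 by simp
        qed
      qed
    qed
  qed
  have "equilibrium N (ext_gain G \<kappa>) z \<sigma>"
    unfolding equilibrium_def demand_def bad_def
    using \<sigma>(1) c unfolding w_def ext_wt_def by (force simp: not_less)
  moreover have "\<forall>b<N. z b \<le> \<kappa>" using z\<sigma> inv2 by metis
  ultimately show ?thesis by blast
qed

text \<open>Weak duality: for each agent the weight is at most a difference of prices, and these
  differences cancel over two permutations of the same objects.\<close>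

lemma equilibrium_imp_popular:
  assumes eq: "equilibrium N (ext_gain G \<kappa>) z \<sigma>" and z: "\<forall>b<N. z b \<le> \<kappa>"
  shows "popular_with_penalty \<kappa> G {(a, \<sigma> a) |a. a < p \<and> \<sigma> a < q}"
proof -
  let ?M = "{(a, \<sigma> a) |a. a < p \<and> \<sigma> a < q}"
  have \<sigma>: "bij_betw \<sigma> {..<N} {..<N}" using eq unfolding equilibrium_def by blast
  have c: "z (\<sigma> a) + ext_gain G \<kappa> a b (\<sigma> a) \<le> z b + ext_gain G \<kappa> a (\<sigma> a) b" if "a < N" "b < N" for a b
    using eq that unfolding equilibrium_def demand_def bad_def by (auto simp: not_less)
  have \<sigma>N: "\<sigma> a < N" if "a < N" for a using bij_betwE[OF \<sigma>] that by auto
  \<comment> \<open>For an agent with a forbidden object, her last resort would be better by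
    \<open>\<kappa> + 1\<close>, so it would have to cost more than \<kappa>.\<close>
  have edge: "ext_edge G a (\<sigma> a)" if a: "a < p" for a
  proof (rule ccontr)
    assume n: "\<not> ext_edge G a (\<sigma> a)"
    have l: "ext_edge G a (q + a)" unfolding ext_edge_def q_def[symmetric] by simp
    have aN: "a < N" "q + a < N" using a unfolding N_def by auto
    have "ext_gain G \<kappa> a (q + a) (\<sigma> a) = \<kappa> + 1" "ext_gain G \<kappa> a (\<sigma> a) (q + a) = 0"
      using n l a unfolding ext_gain_def p_def[symmetric] by auto
    then have "\<kappa> + 1 \<le> z (q + a)" using c[OF aN] by linarith
    then show False using z aN by fastforce
  qed
  have inj: "a = a'" if "a < p" "a' < p" "\<sigma> a = \<sigma> a'" for a a'
    using inj_onD[OF bij_betw_imp_inj_on[OF \<sigma>] that(3)] that unfolding N_def by simp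
  have M: "matching G ?M"
    using edge inj unfolding matching_def ext_edge_def q_def[symmetric] by (auto simp: inj_on_def split: if_splits)
  have as\<sigma>: "assigned G ?M a = \<sigma> a" if a: "a < p" for a
  proof (cases "\<sigma> a < q")
    case True
    then have "partner ?M a = Some (\<sigma> a)" using a unfolding partner_iff[OF M] by auto
    then show ?thesis by (simp add: assigned_def)
  next
    case False
    then have "partner ?M a = None" unfolding partner_def by simp
    then show ?thesis using edge[OF a] False unfolding assigned_def ext_edge_def q_def[symmetric] by simp
  qed
  have "(\<Sum>a\<in>agents G. vote \<kappa> G a M' ?M) \<le> 0" if M': "matching G M'" for M'
  proof -
    obtain \<tau> where \<tau>: "bij_betw \<tau> {..<N} {..<N}" "\<forall>a<p. \<tau> a = assigned G M' a"
      using assigned_extends[OF M'] by blast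
    have \<tau>N: "\<tau> a < N" if "a < N" for a using bij_betwE[OF \<tau>(1)] that by auto
    have "(\<Sum>a<p. vote \<kappa> G a M' ?M) = (\<Sum>a<p. ext_wt G \<kappa> a (\<tau> a) (\<sigma> a))"
      by (rule sum.cong) (auto simp: vote_assigned[OF M M'] as\<sigma> \<tau>(2))
    also have "\<dots> = (\<Sum>a<N. ext_wt G \<kappa> a (\<tau> a) (\<sigma> a))"
      by (rule sum.mono_neutral_left) (auto simp: N_def ext_wt_dummy)
    also have "\<dots> \<le> (\<Sum>a<N. int (z (\<tau> a)) - int (z (\<sigma> a)))"
    proof (rule sum_mono)
      fix a assume "a \<in> {..<N}"
      then show "ext_wt G \<kappa> a (\<tau> a) (\<sigma> a) \<le> int (z (\<tau> a)) - int (z (\<sigma> a))"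
        using c[of a "\<tau> a"] \<tau>N[of a] unfolding ext_wt_def by simp
    qed
    also have "\<dots> = 0"
      using sum.reindex_bij_betw[OF \<tau>(1), of "\<lambda>b. int (z b)"] sum.reindex_bij_betw[OF \<sigma>, of "\<lambda>b. int (z b)"]
      by (simp add: sum_subtractf)
    finally show ?thesis unfolding agents_p .
  qed
  then show ?thesis using M unfolding popular_with_penalty_def by blast
qed

end

section \<open>Programs with bounded running time\<close>

definition run :: "nat \<Rightarrow> cmd \<Rightarrow> state \<Rightarrow> nat \<Rightarrow> (state \<Rightarrow> bool) \<Rightarrow> bool" where
  "run w c s T Q \<longleftrightarrow> (\<exists>t s'. exec w c s t s' \<and> t \<le> T \<and> Q s')"

lemma run_mono:
  "run w c s T Q \<Longrightarrow> T \<le> T' \<Longrightarrow> (\<And>s'. Q s' \<Longrightarrow> Q' s') \<Longrightarrow> run w c s T' Q'"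
  unfolding run_def by (meson order_trans)

lemma run_Seq:
  assumes "run w c s T1 (\<lambda>s'. run w c' s' T2 Q)"
  shows "run w (Seq c c') s (T1 + T2) Q"
  using assms unfolding run_def by (meson exec.Seq add_mono)

lemma run_If:
  assumes "exp_val w e s \<noteq> 0 \<Longrightarrow> run w c s T Q" "exp_val w e s = 0 \<Longrightarrow> run w c' s T Q"
  shows "run w (If e c c') s (1 + exp_cost e + T) Q"
proof (cases "exp_val w e s = 0")
  case True
  then obtain t s' where "exec w c' s t s'" "t \<le> T" "Q s'"
    using assms(2) unfolding run_def by blast
  then show ?thesis unfolding run_def using exec.IfFalse[OF True] by (meson add_left_mono)
next
  case False
  then obtain t s' where "exec w c s t s'" "t \<le> T" "Q s'"
    using assms(1) unfolding run_def by blast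
  then show ?thesis unfolding run_def using exec.IfTrue[OF False] by (meson add_left_mono)
qed

text \<open>Every iteration is paid for by the potential \<open>\<Phi>\<close>, which therefore also bounds their number.\<close>

lemma run_While:
  assumes "J s"
    and step: "\<And>s. J s \<Longrightarrow> exp_val w e s \<noteq> 0 \<Longrightarrow>
      \<exists>T. run w c s T (\<lambda>s'. J s' \<and> \<Phi> s' + T + 1 + exp_cost e \<le> \<Phi> s)"
  shows "run w (While e c) s (\<Phi> s + 1 + exp_cost e) (\<lambda>s'. J s' \<and> exp_val w e s' = 0)"
  using \<open>J s\<close>
proof (induction "\<Phi> s" arbitrary: s rule: less_induct)
  case less
  show ?case
  proof (cases "exp_val w e s = 0")
    case True
    then show ?thesis unfolding run_def using exec.WhileFalse[OF True] less.prems by (meson le_add2 add_le_mono le_refl)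
  next
    case False
    obtain T t s' where 1: "exec w c s t s'" "t \<le> T" "J s'" "\<Phi> s' + T + 1 + exp_cost e \<le> \<Phi> s"
      using step[OF less.prems False] unfolding run_def by blast
    then have "\<Phi> s' < \<Phi> s" by linarith
    from less.hyps[OF this 1(3)] obtain t' s'' where
      2: "exec w (While e c) s' t' s''" "t' \<le> \<Phi> s' + 1 + exp_cost e" "J s''" "exp_val w e s'' = 0"
      unfolding run_def by blast
    have "exec w (While e c) s (1 + exp_cost e + t + t') s''"
      using exec.WhileTrue[OF False 1(1) 2(1)] .
    moreover have "1 + exp_cost e + t + t' \<le> \<Phi> s + 1 + exp_cost e" using 1 2 by linarith
    ultimately show ?thesis unfolding run_def using 2 by blast
  qed
qed

text \<open>Both branches of a conditional are charged, so the bound does not depend on the state.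
  Loops are excluded by \<open>wp\<close>.\<close>

fun straight_cost :: "cmd \<Rightarrow> nat" where
  "straight_cost Skip = 1"
| "straight_cost (Assign r e) = 1 + exp_cost e"
| "straight_cost (Store e e') = 1 + exp_cost e + exp_cost e'"
| "straight_cost (Seq c c') = straight_cost c + straight_cost c'"
| "straight_cost (If e c c') = 1 + exp_cost e + (straight_cost c + straight_cost c')"
| "straight_cost (While e c) = 0"

fun wp :: "nat \<Rightarrow> cmd \<Rightarrow> (state \<Rightarrow> bool) \<Rightarrow> state \<Rightarrow> bool" where
  "wp w Skip Q s = Q s"
| "wp w (Assign r e) Q s = Q ((fst s)(r := exp_val w e s), snd s)"
| "wp w (Store e e') Q s = Q (fst s, (snd s)(exp_val w e s := exp_val w e' s))"
| "wp w (Seq c c') Q s = wp w c (wp w c' Q) s"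
| "wp w (If e c c') Q s = (if exp_val w e s \<noteq> 0 then wp w c Q s else wp w c' Q s)"
| "wp w (While e c) Q s = False"

lemma wp_run: "wp w c Q s \<Longrightarrow> run w c s (straight_cost c) Q"
proof (induction c arbitrary: Q s)
  case Skip
  then show ?case unfolding run_def using exec.Skip by fastforce
next
  case (Assign r e)
  then show ?case unfolding run_def using exec.Assign by fastforce
next
  case (Store e e')
  then show ?case unfolding run_def using exec.Store by fastforce
next
  case (Seq c c')
  have "run w c s (straight_cost c) (wp w c' Q)" using Seq.IH(1) Seq.prems by simp
  then have "run w c s (straight_cost c) (\<lambda>s. run w c' s (straight_cost c') Q)"
    by (rule run_mono) (use Seq.IH(2) in auto)
  then show ?case using run_Seq by simp
next
  case (If e c c')
  show ?case unfolding straight_cost.simps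
  proof (rule run_If)
    assume "exp_val w e s \<noteq> 0"
    with If have "run w c s (straight_cost c) Q" by simp
    then show "run w c s (straight_cost c + straight_cost c') Q" by (rule run_mono) auto
  next
    assume "exp_val w e s = 0"
    with If have "run w c' s (straight_cost c') Q" by simp
    then show "run w c' s (straight_cost c + straight_cost c') Q" by (rule run_mono) auto
  qed
qed simp

section \<open>Decoded program states and rules for loops\<close>

type_synonym regs = "nat \<Rightarrow> nat"
type_synonym arrays = "nat \<Rightarrow> nat \<Rightarrow> nat"

definition Cell :: "nat \<Rightarrow> exp \<Rightarrow> exp" where
  "Cell k e = Op Plus (Reg 0) (Op Plus (Op Times (Const 8) e) (Const k))"

definition For :: "nat \<Rightarrow> cmd \<Rightarrow> cmd" where
  "For r c = Seq (Assign r (Const 0))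
    (While (Op Less (Reg r) (Reg 1)) (Seq c (Assign r (Op Plus (Reg r) (Const 1)))))"

text \<open>
  The memory from address \<open>X\<close> on is used as eight interleaved arrays of unbounded length, so that
  they cannot overlap: 0 prices, 1 auction labels, 2 mates of the agents, 3 visited agents, 4 search
  predecessors (plus 1), 5 search queue, 6 demand matrix, 7 comparisons. The cells before \<open>X\<close> form
  array 8. Registers 0 to 5 hold the constants \<open>X, N, K, cap, p, q\<close>; loops over agents use
  register 6, and the current object is in register 7, or in 9 during a bid or a search.
\<close>

locale ram =
  fixes w X N K cap p q :: nat
  assumes word: "X + 8 * (N * N * N) + 100 \<le> 2 ^ w"
    and N_cap: "N \<le> cap * cap"
    and N2: "2 \<le> N" and K_N: "K < N" and cap_N: "cap \<le> N" and N_pq: "N = p + q"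
    and X_p: "p \<le> X" and X_adj: "3 + p * q + p * q * q \<le> X"
begin

lemma N_N3: "N \<le> N * N * N" "N * N \<le> N * N * N"
  using N2 by auto

lemma N_square: "2 * N \<le> N * N" "4 \<le> N * N"
  using N2 mult_le_mono[OF N2 N2] by auto

lemma N_word: "8 * N + 100 \<le> 2 ^ w"
  using word N_N3 by linarith

definition cst :: regs where
  "cst r = (if r = 0 then X else if r = 1 then N else if r = 2 then K else
    if r = 3 then cap else if r = 4 then p else q)"

text \<open>The six constant registers are fixed by the encoding itself, which spares every loop
  invariant from preserving them. Decoding is not unique: several pairs \<open>R\<close>,
  \<open>A\<close> can denote one state.\<close>

definition mk :: "regs \<Rightarrow> arrays \<Rightarrow> state" where
  "mk R A = (\<lambda>r. if r < 6 then cst r else R r,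
    \<lambda>i. if i < X then A 8 i else A ((i - X) mod 8) ((i - X) div 8))"

definition ev :: "exp \<Rightarrow> regs \<Rightarrow> arrays \<Rightarrow> nat" where
  "ev e R A = exp_val w e (mk R A)"

lemma ev_Const [simp]: "k < 100 \<Longrightarrow> ev (Const k) R A = k"
  using word by (simp add: ev_def)

lemma ev_Reg [simp]: "ev (Reg r) R A = (if r < 6 then cst r else R r)"
  by (simp add: ev_def mk_def)

lemma ev_Plus [simp]:
  "ev e R A + ev e' R A < 2 ^ w \<Longrightarrow> ev (Op Plus e e') R A = ev e R A + ev e' R A"
  by (simp add: ev_def)

lemma ev_Times [simp]:
  "ev e R A * ev e' R A < 2 ^ w \<Longrightarrow> ev (Op Times e e') R A = ev e R A * ev e' R A"
  by (simp add: ev_def)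

lemma ev_Minus [simp]:
  "ev e R A - ev e' R A < 2 ^ w \<Longrightarrow> ev (Op Minus e e') R A = ev e R A - ev e' R A"
  by (simp add: ev_def)

lemma ev_Less [simp]: "ev (Op Less e e') R A = of_bool (ev e R A < ev e' R A)"
  and ev_Equal [simp]: "ev (Op Equal e e') R A = of_bool (ev e R A = ev e' R A)"
proof -
  have "1 < (2::nat) ^ w" using word by linarith
  then show "ev (Op Less e e') R A = of_bool (ev e R A < ev e' R A)"
    and "ev (Op Equal e e') R A = of_bool (ev e R A = ev e' R A)"
    by (auto simp: ev_def)
qed

lemma ev_Cell [simp]:
  assumes "k < 8" "ev e R A < N * N * N"
  shows "ev (Cell k e) R A = X + 8 * ev e R A + k"
proof -
  have "X + 8 * ev e R A + k < 2 ^ w" using assms word by linarith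
  then show ?thesis using assms word by (simp add: Cell_def cst_def)
qed

lemma ev_Mem_Cell [simp]:
  assumes "k < 8" "ev e R A < N * N * N"
  shows "ev (Mem (Cell k e)) R A = A k (ev e R A)"
proof -
  have "ev (Mem (Cell k e)) R A = snd (mk R A) (ev (Cell k e) R A)" by (simp add: ev_def)
  then show ?thesis using assms by (simp add: mk_def)
qed

lemma ev_Mem_input: "ev e R A < X \<Longrightarrow> ev (Mem e) R A = A 8 (ev e R A)"
  by (simp add: ev_def mk_def)

definition hr :: "cmd \<Rightarrow> regs \<Rightarrow> arrays \<Rightarrow> nat
  \<Rightarrow> (regs \<Rightarrow> arrays \<Rightarrow> bool) \<Rightarrow> bool" where
  "hr c R A T Q \<longleftrightarrow> run w c (mk R A) T (\<lambda>s. \<exists>R' A'. s = mk R' A' \<and> Q R' A')"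

lemma hr_mono:
  "hr c R A T Q \<Longrightarrow> T \<le> T' \<Longrightarrow> (\<And>R' A'. Q R' A' \<Longrightarrow> Q' R' A') \<Longrightarrow> hr c R A T' Q'"
  unfolding hr_def by (erule run_mono) auto

lemma hr_Seq:
  assumes "hr c R A T1 Q1" "\<And>R' A'. Q1 R' A' \<Longrightarrow> hr c' R' A' T2 Q" "T1 + T2 \<le> T"
  shows "hr (Seq c c') R A T Q"
proof -
  have "run w c (mk R A) T1 (\<lambda>s'. run w c' s' T2 (\<lambda>s. \<exists>R' A'. s = mk R' A' \<and> Q R' A'))"
    using assms(1) unfolding hr_def by (rule run_mono) (use assms(2) in \<open>auto simp: hr_def\<close>)
  from run_Seq[OF this] show ?thesis unfolding hr_def by (rule run_mono) (use assms(3) in auto)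
qed

lemma hr_If:
  assumes "ev e R A \<noteq> 0 \<Longrightarrow> hr c R A T Q" "ev e R A = 0 \<Longrightarrow> hr c' R A T Q"
    "1 + exp_cost e + T \<le> T'"
  shows "hr (If e c c') R A T' Q"
  unfolding hr_def
  by (rule run_mono[OF run_If[where T = T]]) (use assms in \<open>auto simp: hr_def ev_def\<close>)

text \<open>The bound \<open>T\<close> may differ between iterations, which lets cheap and expensive
  iterations be amortized.\<close>

lemma hr_While_potential:
  assumes J: "J R A"
    and step: "\<And>R A. J R A \<Longrightarrow> ev e R A \<noteq> 0 \<Longrightarrow>
      \<exists>T. hr c R A T (\<lambda>R' A'. J R' A' \<and> \<Phi> R' A' + T + 1 + exp_cost e \<le> \<Phi> R A)"
    and fin: "\<And>R A. J R A \<Longrightarrow> ev e R A = 0 \<Longrightarrow> Q R A"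
    and T: "\<Phi> R A + 1 + exp_cost e \<le> T"
  shows "hr (While e c) R A T Q"
proof -
  define J' where "J' = (\<lambda>(s, n). \<exists>R A. s = mk R A \<and> J R A \<and> \<Phi> R A = n)"
  \<comment> \<open>The potential belongs to a pair \<open>R\<close>, \<open>A\<close>, but
    different pairs may denote the same state. The least value over the pairs that satisfy the
    invariant is a function of the state.\<close>
  define M where "M s = (LEAST n. J' (s, n))" for s
  have M: "\<exists>R A. s = mk R A \<and> J R A \<and> \<Phi> R A = M s" if "J' (s, n)" for s n
    using LeastI[of "\<lambda>n. J' (s, n)", OF that] unfolding M_def J'_def by simp
  have M': "M s \<le> n" if "J' (s, n)" for s n
    using Least_le[of "\<lambda>n. J' (s, n)", OF that] unfolding M_def .
  have "run w (While e c) (mk R A) (M (mk R A) + 1 + exp_cost e)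
    (\<lambda>s'. (\<exists>n. J' (s', n)) \<and> exp_val w e s' = 0)"
  proof (rule run_While)
    show "\<exists>n. J' (mk R A, n)" using J unfolding J'_def by auto
  next
    fix s assume s: "\<exists>n. J' (s, n)" "exp_val w e s \<noteq> 0"
    then obtain R A where RA: "s = mk R A" "J R A" "\<Phi> R A = M s" using M by blast
    then obtain T where "hr c R A T (\<lambda>R' A'. J R' A' \<and> \<Phi> R' A' + T + 1 + exp_cost e \<le> \<Phi> R A)"
      using step s(2) unfolding ev_def by blast
    then have "run w c s T (\<lambda>s'. (\<exists>n. J' (s', n)) \<and> M s' + T + 1 + exp_cost e \<le> M s)"
      unfolding hr_def RA(1)
    proof (rule run_mono)
      fix s' assume "\<exists>R' A'. s' = mk R' A' \<and> J R' A' \<and> \<Phi> R' A' + T + 1 + exp_cost e \<le> \<Phi> R A"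
      then obtain R' A' where 1: "s' = mk R' A'" "J R' A'" "\<Phi> R' A' + T + 1 + exp_cost e \<le> \<Phi> R A"
        by blast
      then have 2: "J' (s', \<Phi> R' A')" unfolding J'_def by auto
      then show "(\<exists>n. J' (s', n)) \<and> M s' + T + 1 + exp_cost e \<le> M (mk R A)"
        using M'[OF 2] 1(3) RA by auto
    qed simp
    then show "\<exists>T. run w c s T (\<lambda>s'. (\<exists>n. J' (s', n)) \<and> M s' + T + 1 + exp_cost e \<le> M s)" by blast
  qed
  moreover have "M (mk R A) \<le> \<Phi> R A" by (rule M') (use J in \<open>auto simp: J'_def\<close>)
  ultimately show ?thesis unfolding hr_def
    by (elim run_mono) (use T fin[unfolded ev_def] in \<open>fastforce simp: J'_def\<close>)+
qed

lemma hr_While: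
  assumes J: "J R A"
    and step: "\<And>R A. J R A \<Longrightarrow> ev e R A \<noteq> 0 \<Longrightarrow> hr c R A T (\<lambda>R' A'. J R' A' \<and> \<mu> R' A' < \<mu> R A)"
    and fin: "\<And>R A. J R A \<Longrightarrow> ev e R A = 0 \<Longrightarrow> Q R A"
    and T: "(\<mu> R A :: nat) * (T + 1 + exp_cost e) + 1 + exp_cost e \<le> T'"
  shows "hr (While e c) R A T' Q"
proof (rule hr_While_potential[where J = J and \<Phi> = "\<lambda>R A. \<mu> R A * (T + 1 + exp_cost e)"])
  fix R A assume "J R A" "ev e R A \<noteq> 0"
  from step[OF this] show "\<exists>T'. hr c R A T'
    (\<lambda>R' A'. J R' A' \<and> \<mu> R' A' * (T + 1 + exp_cost e) + T' + 1 + exp_cost e \<le> \<mu> R A * (T + 1 + exp_cost e))"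
  proof (intro exI[of _ T], elim hr_mono)
    fix R' A' assume *: "J R' A' \<and> \<mu> R' A' < \<mu> R A"
    then have "(\<mu> R' A' + 1) * (T + 1 + exp_cost e) \<le> \<mu> R A * (T + 1 + exp_cost e)"
      by (intro mult_right_mono) auto
    then show "J R' A' \<and> \<mu> R' A' * (T + 1 + exp_cost e) + T + 1 + exp_cost e \<le> \<mu> R A * (T + 1 + exp_cost e)"
      using * by (simp add: algebra_simps)
  qed simp
qed (use assms in auto)

text \<open>Weakest preconditions on decoded states. A store must name the array cell to which its
  address decodes, and an assignment must spare the constant registers.\<close>

fun hwp :: "cmd \<Rightarrow> (regs \<Rightarrow> arrays \<Rightarrow> bool)
  \<Rightarrow> regs \<Rightarrow> arrays \<Rightarrow> bool" where
  "hwp Skip Q R A = Q R A"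
| "hwp (Assign r e) Q R A = (6 \<le> r \<and> Q (R(r := ev e R A)) A)"
| "hwp (Store e e') Q R A = (\<exists>k i. (k < 8 \<and> ev e R A = X + 8 * i + k \<or> k = 8 \<and> ev e R A = i \<and> i < X) \<and>
  Q R (A(k := (A k)(i := ev e' R A))))"
| "hwp (Seq c c') Q R A = hwp c (hwp c' Q) R A"
| "hwp (If e c c') Q R A = (if ev e R A \<noteq> 0 then hwp c Q R A else hwp c' Q R A)"
| "hwp (While e c) Q R A = False"

lemma hwp_wp: "hwp c Q R A \<Longrightarrow> wp w c (\<lambda>s. \<exists>R' A'. s = mk R' A' \<and> Q R' A') (mk R A)"
proof (induction c arbitrary: Q R A)
  case (Assign r e)
  then have "((fst (mk R A))(r := ev e R A), snd (mk R A)) = mk (R(r := ev e R A)) A"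
    by (auto simp: mk_def)
  then show ?case using Assign by (auto simp: ev_def)
next
  case (Store e e')
  then obtain k i where ki: "k < 8 \<and> ev e R A = X + 8 * i + k \<or> k = 8 \<and> ev e R A = i \<and> i < X"
    and Q: "Q R (A(k := (A k)(i := ev e' R A)))" by auto
  have "mk R (A(k := (A k)(i := ev e' R A))) = (fst (mk R A), (snd (mk R A))(ev e R A := ev e' R A))"
  proof -
    have "(if j < X then (A(k := (A k)(i := v))) 8 j else (A(k := (A k)(i := v))) ((j - X) mod 8) ((j - X) div 8)) =
      ((\<lambda>j. if j < X then A 8 j else A ((j - X) mod 8) ((j - X) div 8))(ev e R A := v)) j" for j v
      using ki
    proof (elim disjE conjE)
      assume k: "k < 8" "ev e R A = X + 8 * i + k"
      \<comment> \<open>Division with remainder recovers the array and the index from an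
        address.\<close>
      then have 1: "j = X + 8 * i + k \<longleftrightarrow> (j - X) mod 8 = k \<and> (j - X) div 8 = i" if "\<not> j < X"
        using that div_mult_mod_eq[of "j - X" 8] by auto
      show ?thesis
      proof (cases "j < X")
        case False
        show ?thesis using 1[OF False] k False by (cases "j = X + 8 * i + k") auto
      qed (use k in auto)
    next
      assume k: "k = 8" "ev e R A = i" "i < X"
      have "(j - X) mod 8 \<noteq> 8" by (metis less_irrefl mod_less_divisor zero_less_numeral)
      with k show ?thesis by auto
    qed
    then show ?thesis unfolding mk_def fst_conv snd_conv by (intro prod_eqI) (auto simp: fun_eq_iff)
  qed
  from this[symmetric] show ?case using Q by (auto simp: ev_def)
next
  case (Seq c c')
  have mono: "wp w c Q s \<Longrightarrow> (\<And>s. Q s \<Longrightarrow> Q' s) \<Longrightarrow> wp w c Q' s" for Q Q' c s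
  proof (induction c arbitrary: Q Q' s)
    case (Seq c1 c2)
    from Seq.prems have "wp w c1 (wp w c2 Q) s" by simp
    from Seq.IH(1)[OF this, of "wp w c2 Q'"] Seq.IH(2) Seq.prems(2) show ?case by auto
  qed (auto split: if_splits)
  from Seq.prems have "wp w c (\<lambda>s. \<exists>R' A'. s = mk R' A' \<and> hwp c' Q R' A') (mk R A)"
    by (intro Seq.IH) simp
  then have "wp w c (wp w c' (\<lambda>s. \<exists>R' A'. s = mk R' A' \<and> Q R' A')) (mk R A)"
    by (rule mono) (use Seq.IH(2) in blast)
  then show ?case by simp
qed (auto simp: ev_def split: if_splits)

lemma hr_straight:
  assumes "hwp c Q R A" "straight_cost c \<le> T"
  shows "hr c R A T Q"
  unfolding hr_def by (rule run_mono[OF wp_run[OF hwp_wp[OF assms(1)]]]) (use assms(2) in auto)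

text \<open>An address determines its array and index, so the existential in the store rule has only
  one witness and the rule becomes an equation.\<close>

lemma hwp_Store_Cell [simp]:
  assumes "k < 8" "ev e R A < N * N * N"
  shows "hwp (Store (Cell k e) e') Q R A = Q R (A(k := (A k)(ev e R A := ev e' R A)))"
proof -
  have "X + 8 * i + k = X + 8 * i' + k' \<longleftrightarrow> i' = i \<and> k' = k" if "k' < 8" for i i' k'
    using that assms(1) by (simp add: add.assoc) presburger
  then show ?thesis using assms by auto
qed

lemma hwp_Store_input:
  "ev e R A < X \<Longrightarrow> hwp (Store e e') Q R A = Q R (A(8 := (A 8)(ev e R A := ev e' R A)))"
  by auto

declare hwp.simps(3) [simp del]

text \<open>The postcondition of a loop body just before \<open>For\<close> increments the
  counter.\<close>

abbreviation counted :: "nat \<Rightarrow> nat \<Rightarrow> (nat \<Rightarrow> regs \<Rightarrow> arrays \<Rightarrow> bool) \<Rightarrow> regs \<Rightarrow> arrays \<Rightarrow> bool" where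
  "counted r i J \<equiv> \<lambda>R A. R r = i \<and> J (Suc i) (R(r := Suc i)) A"

text \<open>The 8 units per iteration are the test and the increment, 4 each; the final 6 are the
  initial assignment and the failing test.\<close>

lemma hr_For:
  assumes r: "6 \<le> r"
    and init: "J 0 (R(r := 0)) A"
    and step: "\<And>R A. R r < N \<Longrightarrow> J (R r) R A \<Longrightarrow>
      hr c R A T (counted r (R r) J)"
    and fin: "\<And>R A. J N R A \<Longrightarrow> R r = N \<Longrightarrow> Q R A"
    and T: "N * (T + 8) + 6 \<le> T'"
  shows "hr (For r c) R A T' Q"
  unfolding For_def
proof (rule hr_Seq)
  show "hr (Assign r (Const 0)) R A 2 (\<lambda>R' A'. R' r = 0 \<and> J 0 R' A')"
    by (rule hr_straight) (use r init in auto)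
next
  fix R A assume *: "R r = 0 \<and> J 0 R A"
  show "hr (While (Op Less (Reg r) (Reg 1)) (Seq c (Assign r (Op Plus (Reg r) (Const 1))))) R A
    (N * (T + 8) + 4) Q"
  proof (rule hr_While[where J = "\<lambda>R A. R r \<le> N \<and> J (R r) R A" and \<mu> = "\<lambda>R A. N - R r"])
    fix R A assume "R r \<le> N \<and> J (R r) R A" "ev (Op Less (Reg r) (Reg 1)) R A \<noteq> 0"
    then have 1: "R r < N" "J (R r) R A" using r by (auto simp: cst_def split: if_splits)
    show "hr (Seq c (Assign r (Op Plus (Reg r) (Const 1)))) R A (T + 4)
      (\<lambda>R' A'. (R' r \<le> N \<and> J (R' r) R' A') \<and> N - R' r < N - R r)"
    proof (rule hr_Seq[OF step[OF 1]])
      fix R' A' assume 2: "R' r = R r \<and> J (Suc (R r)) (R'(r := Suc (R r))) A'"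
      have "R r + 1 < 2 ^ w" using 1 N_word by linarith
      then show "hr (Assign r (Op Plus (Reg r) (Const 1))) R' A' 4
        (\<lambda>R' A'. (R' r \<le> N \<and> J (R' r) R' A') \<and> N - R' r < N - R r)"
        by (intro hr_straight) (use 1 2 r in auto)
    qed simp
  qed (use * fin r in \<open>auto simp: cst_def algebra_simps split: if_splits\<close>)
qed (use T in simp)

end

section \<open>Maintaining the demand relation\<close>

definition Ix2 :: "exp \<Rightarrow> exp \<Rightarrow> exp" where
  "Ix2 e f = Op Plus (Op Times e (Reg 1)) f"

definition Ix3 :: "exp \<Rightarrow> exp \<Rightarrow> exp \<Rightarrow> exp" where
  "Ix3 e f h = Op Plus (Op Times (Op Plus (Op Times e (Reg 1)) f) (Reg 1)) h"

definition same :: "nat set \<Rightarrow> (nat \<Rightarrow> 'b) \<Rightarrow> (nat \<Rightarrow> 'b) \<Rightarrow> bool" where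
  "same S f f' \<longleftrightarrow> (\<forall>r. r \<notin> S \<longrightarrow> f' r = f r)"

lemma same_refl [simp]: "same S f f"
  by (simp add: same_def)

lemma same_upd [simp]: "r \<in> S \<Longrightarrow> same S f (f'(r := x)) = same S f f'"
  by (auto simp: same_def)

lemma same_trans: "same S f f' \<Longrightarrow> same S' f' f'' \<Longrightarrow> S' \<subseteq> S \<Longrightarrow> same S f f''"
  unfolding same_def by (metis subsetD)

definition bad_exp :: "exp \<Rightarrow> exp \<Rightarrow> exp \<Rightarrow> exp" where
  "bad_exp a x y = Op Less (Op Plus (Mem (Cell 0 x)) (Mem (Cell 7 (Ix3 a y x))))
    (Op Plus (Mem (Cell 0 y)) (Mem (Cell 7 (Ix3 a x y))))"

definition and_not :: "exp \<Rightarrow> exp \<Rightarrow> cmd" where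
  "and_not e f = Store e (Op Times (Mem e) (Op Minus (Const 1) f))"

text \<open>The column of the object in register 7 is recomputed, whereas for every other object
  only the comparison with it is applied. Entries of other objects are cleared but never restored,
  which is right after a price reduction because that cannot add demand elsewhere.\<close>

definition refresh :: cmd where
  "refresh = For 6 (Seq (Store (Cell 6 (Ix2 (Reg 6) (Reg 7))) (Const 1))
    (For 8 (Seq (and_not (Cell 6 (Ix2 (Reg 6) (Reg 7))) (bad_exp (Reg 6) (Reg 8) (Reg 7)))
    (and_not (Cell 6 (Ix2 (Reg 6) (Reg 8))) (bad_exp (Reg 6) (Reg 7) (Reg 8))))))"

context ram
begin

lemma index2: "a < N \<Longrightarrow> b < N \<Longrightarrow> a * N + b < N * N"
  using mult_le_mono1[of "Suc a" N N] by simp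

lemma index3: "a < N \<Longrightarrow> b < N \<Longrightarrow> d < N \<Longrightarrow> (a * N + b) * N + d < N * N * N"
  using mult_le_mono1[of "Suc (a * N + b)" "N * N" N] index2[of a b] by simp

lemma index2': "a < N \<Longrightarrow> b < N \<Longrightarrow> a * N + b < N * N * N"
  using index2 N_N3 by (meson less_le_trans)

lemma index1: "a < N \<Longrightarrow> a < N * N * N"
  using N_N3 by linarith

lemma index_inj: "b < N \<Longrightarrow> b' < N \<Longrightarrow> a * N + b = a' * N + b' \<longleftrightarrow> a = a' \<and> b = b'"
proof
  assume h: "b < N" "b' < N" "a * N + b = a' * N + b'"
  have "a = (a * N + b) div N" using h(1) by simp
  also have "\<dots> = a'" unfolding h(3) using h(2) by simp
  finally show "a = a' \<and> b = b'" using h(3) by simp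
qed auto

lemma ev_Ix2 [simp]:
  assumes "ev e R A < N" "ev f R A < N"
  shows "ev (Ix2 e f) R A = ev e R A * N + ev f R A"
proof -
  have "ev e R A * N + ev f R A < 2 ^ w" using index2'[OF assms] word by linarith
  then show ?thesis by (simp add: Ix2_def cst_def)
qed

lemma ev_Ix3 [simp]:
  assumes "ev e R A < N" "ev f R A < N" "ev h R A < N"
  shows "ev (Ix3 e f h) R A = (ev e R A * N + ev f R A) * N + ev h R A"
proof -
  have "(ev e R A * N + ev f R A) * N + ev h R A < 2 ^ w" using index3[OF assms] word by linarith
  moreover have "ev e R A * N + ev f R A < 2 ^ w" using index2'[OF assms(1,2)] word by linarith
  ultimately show ?thesis by (simp add: Ix3_def cst_def)
qed

definition wt :: "arrays \<Rightarrow> nat \<Rightarrow> nat \<Rightarrow> nat \<Rightarrow> nat" where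
  "wt A a b b' = A 7 ((a * N + b) * N + b')"

text \<open>The bounds keep comparisons of prices and products with matrix entries free of
  overflow.\<close>

definition wf :: "arrays \<Rightarrow> bool" where
  "wf A \<longleftrightarrow> (\<forall>b<N. A 0 b \<le> K) \<and> (\<forall>a<N. \<forall>b<N. \<forall>b'<N. wt A a b b' \<le> Suc K) \<and>
    (\<forall>a<N. \<forall>b<N. A 6 (a * N + b) \<le> 1)"

definition badA :: "arrays \<Rightarrow> nat \<Rightarrow> nat \<Rightarrow> nat \<Rightarrow> bool" where
  "badA A = bad (wt A) (A 0)"

definition demandA :: "arrays \<Rightarrow> nat \<Rightarrow> nat \<Rightarrow> bool" where
  "demandA A = demand N (wt A) (A 0)"

lemma badA_cong: "A' 0 = A 0 \<Longrightarrow> A' 7 = A 7 \<Longrightarrow> badA A' = badA A"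
  by (simp add: badA_def wt_def fun_eq_iff bad_def)

lemma ev_bad_exp:
  assumes "wf A" "ev e R A < N" "ev f R A < N" "ev h R A < N"
  shows "ev (bad_exp e f h) R A = of_bool (badA A (ev e R A) (ev f R A) (ev h R A))"
proof -
  let ?a = "ev e R A" and ?x = "ev f R A" and ?y = "ev h R A"
  have "A 0 ?x \<le> N" "A 0 ?y \<le> N" "wt A ?a ?y ?x \<le> N" "wt A ?a ?x ?y \<le> N"
    using assms K_N unfolding wf_def by (metis Suc_leI less_imp_le order_trans)+
  then have "A 0 ?x + wt A ?a ?y ?x < 2 ^ w" "A 0 ?y + wt A ?a ?x ?y < 2 ^ w"
    using N_word by linarith+
  then show ?thesis using assms
    by (simp add: bad_exp_def index1 index3 badA_def bad_def wt_def)
qed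

lemma hwp_and_not:
  assumes "k < 8" "ev e R A < N * N * N" "ev f R A = of_bool P" "A k (ev e R A) \<le> 1"
  shows "hwp (and_not (Cell k e) f) Q R A =
    Q R (A(k := (A k)(ev e R A := A k (ev e R A) * of_bool (\<not> P))))"
proof -
  have "A k (ev e R A) < 2 ^ w" "1 < (2::nat) ^ w" using assms(4) word by linarith+
  then show ?thesis using assms by (simp add: and_not_def)
qed

definition refreshed :: "regs \<Rightarrow> arrays \<Rightarrow> regs \<Rightarrow> arrays \<Rightarrow> bool" where
  "refreshed R A R' A' \<longleftrightarrow> same {6, 8} R R' \<and> same {6} A A' \<and> wf A' \<and>
    (\<forall>a<N. \<forall>y<N. A' 6 (a * N + y) = (if y = R 7 then of_bool (demandA A a y)
    else A 6 (a * N + y) * of_bool (\<not> badA A a (R 7) y)))"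

lemma refresh_correct:
  assumes wf: "wf A" and b: "R 7 < N"
  shows "hr refresh R A (N * (N * 200 + 50) + 50) (refreshed R A)"
proof -
  let ?body = "Seq (and_not (Cell 6 (Ix2 (Reg 6) (Reg 7))) (bad_exp (Reg 6) (Reg 8) (Reg 7)))
    (and_not (Cell 6 (Ix2 (Reg 6) (Reg 8))) (bad_exp (Reg 6) (Reg 7) (Reg 8)))"
  define fin where "fin a y = (if y = R 7 then of_bool (demandA A a y)
    else A 6 (a * N + y) * of_bool (\<not> badA A a (R 7) y))" for a y
  have fin1: "fin x y \<le> 1" if "x < N" "y < N" for x y
    using that wf unfolding fin_def wf_def by (auto simp: of_bool_def)
  define base where "base R' A' \<longleftrightarrow> same {6, 8} R R' \<and> same {6} A A'" for R' A'
  have base_wf: "wf A'" if "base R' A'" "\<forall>x<N. \<forall>y<N. A' 6 (x * N + y) \<le> 1" for R' A'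
  proof -
    have "A' 0 = A 0" "A' 7 = A 7" using that(1) by (auto simp: base_def same_def)
    then show ?thesis using wf that(2) by (simp add: wf_def wt_def)
  qed
  have base_bad: "badA A' = badA A" if "base R' A'" for R' A'
    by (rule badA_cong) (use that in \<open>auto simp: base_def same_def\<close>)
  have base7: "R' 7 = R 7" if "base R' A'" for R' A'
    using that by (auto simp: base_def same_def)
  define Inner where "Inner a d R' A' \<longleftrightarrow> base R' A' \<and> R' 6 = a \<and> (\<forall>x<N. \<forall>y<N. A' 6 (x * N + y) =
    (if x < a then fin x y else if x = a then (if y = R 7 then of_bool (\<forall>d'<d. \<not> badA A a d' y)
    else if y < d then fin x y else A 6 (x * N + y)) else A 6 (x * N + y)))" for a d R' A'
  have A1: "A 6 (x * N + y) \<le> 1" if "x < N" "y < N" for x y using wf that by (auto simp: wf_def)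
  have Inner1: "A' 6 (x * N + y) \<le> 1" if "Inner a d R' A'" "x < N" "y < N" for a d R' A' x y
    using that A1[of x y] fin1[of x y] unfolding Inner_def by auto
  have inner: "hr ?body R' A' 190
    (counted 8 (R' 8) (Inner a))"
    if J: "Inner a (R' 8) R' A'" and a: "a < N" and d: "R' 8 < N" for a R' A'
  proof (rule hr_straight)
    have B: "base R' A'" and R6: "R' 6 = a" using J by (auto simp: Inner_def)
    note wf' = base_wf[OF B] and R7 = base7[OF B]
    have wfA': "wf A'" by (rule wf') (use Inner1[OF J] in auto)
    let ?d = "R' 8" and ?b = "R 7"
    let ?A1 = "A'(6 := (A' 6)(a * N + ?b := A' 6 (a * N + ?b) * of_bool (\<not> badA A a ?d ?b)))"
    let ?A2 = "?A1(6 := (?A1 6)(a * N + ?d := ?A1 6 (a * N + ?d) * of_bool (\<not> badA A a ?b ?d)))"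
    have bnd: "a * N + ?b < N * N * N" "a * N + ?d < N * N * N" using index2' a b d by auto
    have le1: "A' 6 (a * N + ?b) \<le> 1" "?A1 6 (a * N + ?d) \<le> 1"
      using Inner1[OF J] a b d by (auto simp: of_bool_def)
    have B1: "base R' ?A1" using B by (auto simp: base_def)
    have wfA1: "wf ?A1" by (rule base_wf[OF B1]) (use Inner1[OF J] a b in \<open>auto simp: of_bool_def\<close>)
    \<comment> \<open>For \<open>?d = ?b\<close> both updates hit the same cell; no object is bad
      against itself, so nothing is cleared wrongly.\<close>
    have nb: "\<not> badA A a ?b ?b" by (simp add: badA_def bad_def)
    have "Inner a (Suc ?d) (R'(8 := Suc ?d)) ?A2"
      unfolding Inner_def
    proof (intro conjI allI impI)
      show "base (R'(8 := Suc ?d)) ?A2" using B by (auto simp: base_def)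
      show "(R'(8 := Suc ?d)) 6 = a" using R6 by simp
      fix x y assume xy: "x < N" "y < N"
      have old: "A' 6 (x * N + y) = (if x < a then fin x y else if x = a then (if y = R 7 then of_bool (\<forall>d'<?d. \<not> badA A a d' y)
        else if y < ?d then fin x y else A 6 (x * N + y)) else A 6 (x * N + y))"
        using J xy unfolding Inner_def by blast
      show "?A2 6 (x * N + y) = (if x < a then fin x y else if x = a then (if y = R 7 then of_bool (\<forall>d'<Suc ?d. \<not> badA A a d' y)
        else if y < Suc ?d then fin x y else A 6 (x * N + y)) else A 6 (x * N + y))"
        using old xy b d nb by (auto simp: index_inj less_Suc_eq fin_def)
    qed
    then show "hwp ?body
      (counted 8 (R' 8) (Inner a)) R' A'"
      using wfA' wfA1 bnd le1 a b d R6 R7 base_bad[OF B] base_bad[OF B1]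
      by (simp add: hwp_and_not ev_bad_exp del: fun_upd_apply)
  qed (simp add: and_not_def bad_exp_def Cell_def Ix2_def Ix3_def)
  let ?J = "\<lambda>a R' A'. base R' A' \<and> (\<forall>x<N. \<forall>y<N. A' 6 (x * N + y) =
    (if x < a then fin x y else A 6 (x * N + y)))"
  show ?thesis
    unfolding refresh_def
  proof (rule hr_For[where J = ?J])
    fix R' A' assume a: "R' 6 < N" and J: "?J (R' 6) R' A'"
    let ?a = "R' 6"
    show "hr (Seq (Store (Cell 6 (Ix2 (Reg 6) (Reg 7))) (Const 1))
     (For 8 ?body)) R' A' (N * 198 + 40)
      (counted 6 ?a ?J)"
    proof (rule hr_Seq)
      show "hr (Store (Cell 6 (Ix2 (Reg 6) (Reg 7))) (Const 1)) R' A' 30 (\<lambda>R'' A''. Inner ?a 0 (R''(8 := 0)) A'')"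
      proof (rule hr_straight)
        have "Inner ?a 0 (R'(8 := 0)) (A'(6 := (A' 6)(?a * N + R 7 := 1)))"
          using J a b unfolding Inner_def by (auto simp: index_inj base_def)
        then show "hwp (Store (Cell 6 (Ix2 (Reg 6) (Reg 7))) (Const 1)) (\<lambda>R'' A''. Inner ?a 0 (R''(8 := 0)) A'') R' A'"
          using a b base7[of R' A'] J index2' by simp
      qed (simp add: Cell_def Ix2_def)
    next
      fix R'' A'' assume "Inner ?a 0 (R''(8 := 0)) A''"
      then show "hr (For 8 ?body) R'' A'' (N * 198 + 6)
       (counted 6 ?a ?J)"
      proof (intro hr_For[where J = "Inner ?a" and T = 190])
        fix R'' A'' assume J': "Inner ?a N R'' A''"
        have "(\<forall>d'<N. \<not> badA A ?a d' (R 7)) = demandA A ?a (R 7)"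
          by (simp add: demandA_def demand_def badA_def)
        then show "counted 6 ?a ?J R'' A''"
          using J' unfolding Inner_def by (auto simp: base_def fin_def less_Suc_eq)
      qed (use inner a in auto)
    qed simp
  next
    fix R' A' assume J: "?J N R' A'"
    then have "\<forall>x<N. \<forall>y<N. A' 6 (x * N + y) \<le> 1" using fin1 by auto
    with J show "refreshed R A R' A'"
      unfolding refreshed_def
      using base_wf[of R' A'] by (auto simp: base_def fin_def)
  qed (auto simp: base_def algebra_simps)
qed

end

section \<open>Auction phase\<close>

text \<open>Objects bid for agents. \<open>y\<close> holds the labels, \<open>cur\<close> the
  bidding object plus 1, or 0 if none bids, and \<open>b\<close> the last object introduced. The
  clause with \<open>y a' + 1\<close> is complementary slackness up to 1; the last clause says that
  an unmatched object other than the bidder has given up, all its neighbors being at the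
  cap.\<close>

definition auction_inv :: "nat \<Rightarrow> (nat \<Rightarrow> nat \<Rightarrow> bool) \<Rightarrow> nat \<Rightarrow> nat \<Rightarrow> nat \<Rightarrow> vec \<Rightarrow> vec \<Rightarrow> bool" where
  "auction_inv N E c b cur m y \<longleftrightarrow> pmatch N E m \<and> (\<forall>a<N. m a \<le> Suc b) \<and>
    cur \<le> Suc b \<and> (cur \<noteq> 0 \<longrightarrow> (\<forall>a<N. m a \<noteq> cur)) \<and>
    (\<forall>a<N. m a = 0 \<longrightarrow> y a = 0) \<and> (\<forall>a<N. y a \<le> c) \<and>
    (\<forall>a<N. m a \<noteq> 0 \<longrightarrow> (\<forall>a'<N. E a' (m a - 1) \<longrightarrow> y a \<le> y a' + 1)) \<and>
    (\<forall>x\<le>b. Suc x \<noteq> cur \<longrightarrow> (\<forall>a<N. m a \<noteq> Suc x) \<longrightarrow> (\<forall>a<N. E a x \<longrightarrow> c \<le> y a))"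

lemma auction_inv_init: "auction_inv N E c 0 1 (\<lambda>_. 0) (\<lambda>_. 0)"
  by (auto simp: auction_inv_def pmatch_def)

lemma auction_inv_cong:
  assumes "auction_inv N E c b cur m y" "\<And>a. a < N \<Longrightarrow> m' a = m a" "\<And>a. a < N \<Longrightarrow> y' a = y a"
  shows "auction_inv N E c b cur m' y'"
  using assms unfolding auction_inv_def pmatch_def by auto

text \<open>The bound \<open>m a \<le> Suc b\<close> makes the new bidder unmatched.\<close>

lemma auction_inv_next:
  assumes "auction_inv N E c b 0 m y"
  shows "auction_inv N E c (Suc b) (Suc (Suc b)) m y"
  using assms unfolding auction_inv_def by (fastforce simp: le_Suc_eq)

lemma auction_inv_drop:
  assumes "auction_inv N E c b cur m y" "\<forall>a<N. E a (cur - 1) \<longrightarrow> c \<le> y a"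
  shows "auction_inv N E c b 0 m y"
proof -
  have "c \<le> y a" if "x \<le> b" "\<forall>a<N. m a \<noteq> Suc x" "a < N" "E a x" for x a
    using assms that unfolding auction_inv_def by (cases "Suc x = cur") auto
  then show ?thesis using assms(1) unfolding auction_inv_def by auto
qed

text \<open>A neighbor with the least label is taken, so raising it by 1 keeps it within 1 of the
  others. The object she held becomes the bidder; her old entry encodes it, with 0 if she was
  free.\<close>

lemma auction_inv_bid:
  assumes inv: "auction_inv N E c b cur m y" and cur: "cur \<noteq> 0" "cur \<le> N"
    and a: "a < N" "E a (cur - 1)" "y a < c" and best: "\<forall>a'<N. E a' (cur - 1) \<longrightarrow> y a \<le> y a'"
  shows "auction_inv N E c b (m a) (m(a := cur)) (y(a := y a + 1))"
  unfolding auction_inv_def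
proof (intro conjI)
  have pm: "pmatch N E m" and curm: "\<forall>a<N. m a \<noteq> cur" using inv cur unfolding auction_inv_def by auto
  show "pmatch N E (m(a := cur))" using pm a cur curm unfolding pmatch_def by auto
  show "\<forall>a'<N. (m(a := cur)) a' \<le> Suc b" "m a \<le> Suc b" using inv a unfolding auction_inv_def by auto
  show "m a \<noteq> 0 \<longrightarrow> (\<forall>a'<N. (m(a := cur)) a' \<noteq> m a)"
    using pm a curm unfolding pmatch_def by (metis fun_upd_apply)
  show "\<forall>a'<N. (m(a := cur)) a' = 0 \<longrightarrow> (y(a := y a + 1)) a' = 0" "\<forall>a'<N. (y(a := y a + 1)) a' \<le> c"
    using inv a cur unfolding auction_inv_def by auto
  show "\<forall>a'<N. (m(a := cur)) a' \<noteq> 0 \<longrightarrow> (\<forall>a''<N. E a'' ((m(a := cur)) a' - 1) \<longrightarrow> (y(a := y a + 1)) a' \<le> (y(a := y a + 1)) a'' + 1)"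
    using inv best unfolding auction_inv_def by (auto simp: le_SucI)
  show "\<forall>x\<le>b. Suc x \<noteq> m a \<longrightarrow> (\<forall>a'<N. (m(a := cur)) a' \<noteq> Suc x) \<longrightarrow> (\<forall>a'<N. E a' x \<longrightarrow> c \<le> (y(a := y a + 1)) a')"
  proof (intro allI impI)
    fix x a' assume x: "x \<le> b" "Suc x \<noteq> m a" "\<forall>a'<N. (m(a := cur)) a' \<noteq> Suc x" and a': "a' < N" "E a' x"
    have 1: "Suc x \<noteq> cur" using x(3) a(1) by (metis fun_upd_same)
    have "\<forall>a'<N. m a' \<noteq> Suc x" using x(2,3) by (metis fun_upd_apply)
    then have "c \<le> y a'" using inv x(1) 1 a' unfolding auction_inv_def by blast
    then show "c \<le> (y(a := y a + 1)) a'" by (auto intro: le_SucI)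
  qed
qed

text \<open>The bidder \<open>Suc N\<close> names no object and serves as a sentinel, so every
  unmatched object has given up.\<close>

lemma auction_inv_final:
  assumes "auction_inv N E c N (Suc N) m y" "N \<le> c * c" "pmatch N E m'"
  shows "msize N m' \<le> msize N m + c"
proof (rule auction_bound[where y = y and E = E])
  show "\<forall>b<N. (\<forall>a<N. m a \<noteq> Suc b) \<longrightarrow> (\<forall>a<N. E a b \<longrightarrow> c \<le> y a)"
    using assms(1) unfolding auction_inv_def by (metis less_imp_le_nat nat.inject nat_neq_iff)
qed (use assms in \<open>auto simp: auction_inv_def\<close>)

text \<open>Register 10 starts at the cap and stays there exactly if no neighbor has a smaller
  label, in which case the bidder gives up.\<close>

definition scan :: cmd where
  "scan = Seq (Assign 10 (Reg 3)) (Seq (Assign 11 (Const 0)) (For 6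
    (If (Op Times (Mem (Cell 6 (Ix2 (Reg 6) (Op Minus (Reg 9) (Const 1))))) (Op Less (Mem (Cell 1 (Reg 6))) (Reg 10)))
    (Seq (Assign 10 (Mem (Cell 1 (Reg 6)))) (Assign 11 (Reg 6))) Skip)))"

definition bid :: cmd where
  "bid = If (Op Less (Reg 10) (Reg 3))
    (Seq (Assign 12 (Mem (Cell 2 (Reg 11)))) (Seq (Store (Cell 2 (Reg 11)) (Reg 9))
    (Seq (Store (Cell 1 (Reg 11)) (Op Plus (Reg 10) (Const 1))) (Assign 9 (Reg 12)))))
    (Assign 9 (Const 0))"

definition auction :: cmd where
  "auction = Seq (For 6 (Seq (Store (Cell 1 (Reg 6)) (Const 0)) (Store (Cell 2 (Reg 6)) (Const 0))))
    (Seq (Assign 7 (Const 0)) (Seq (Assign 9 (Const 1))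
    (While (Op Less (Reg 7) (Reg 1))
    (If (Reg 9) (Seq scan bid)
    (Seq (Assign 7 (Op Plus (Reg 7) (Const 1))) (Assign 9 (Op Plus (Reg 7) (Const 1))))))))"

context ram
begin

lemma hwp_mono: "hwp c Q R A \<Longrightarrow> (\<And>R A. Q R A \<Longrightarrow> Q' R A) \<Longrightarrow> hwp c Q' R A"
proof (induction c arbitrary: Q Q' R A)
  case (Store e e')
  then show ?case unfolding hwp.simps by blast
next
  case (Seq c c')
  from Seq.prems(1) have "hwp c (hwp c' Q) R A" by simp
  from Seq.IH(1)[OF this, of "hwp c' Q'"] Seq.IH(2) Seq.prems(2) show ?case by auto
qed (auto split: if_splits)

definition okA :: "arrays \<Rightarrow> nat \<Rightarrow> nat \<Rightarrow> bool" where
  "okA A a b \<longleftrightarrow> A 6 (a * N + b) \<noteq> 0"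

lemma okA_cong: "A' 6 = A 6 \<Longrightarrow> okA A' = okA A"
  by (simp add: okA_def fun_eq_iff)

lemma wf_cong: "same S A A' \<Longrightarrow> S \<inter> {0, 6, 7} = {} \<Longrightarrow> wf A' = wf A"
proof -
  assume "same S A A'" "S \<inter> {0, 6, 7} = {}"
  then have "A' 0 = A 0" "A' 6 = A 6" "A' 7 = A 7" by (auto simp: same_def)
  then show ?thesis by (simp add: wf_def wt_def)
qed

definition scanned :: "regs \<Rightarrow> arrays \<Rightarrow> regs \<Rightarrow> arrays \<Rightarrow> bool" where
  "scanned R A R' A' \<longleftrightarrow> same {6, 10, 11} R R' \<and> A' = A \<and> R' 10 \<le> cap \<and>
    (\<forall>a<N. okA A a (R 9 - 1) \<longrightarrow> R' 10 \<le> A 1 a \<or> cap \<le> A 1 a) \<and>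
    (R' 10 < cap \<longrightarrow> R' 11 < N \<and> okA A (R' 11) (R 9 - 1) \<and> A 1 (R' 11) = R' 10)"

lemma scan_correct:
  assumes wf: "wf A" and cur: "R 9 \<noteq> 0" "R 9 \<le> N"
  shows "hr scan R A (N * 60 + 20) (scanned R A)"
proof -
  let ?body = "If (Op Times (Mem (Cell 6 (Ix2 (Reg 6) (Op Minus (Reg 9) (Const 1))))) (Op Less (Mem (Cell 1 (Reg 6))) (Reg 10)))
    (Seq (Assign 10 (Mem (Cell 1 (Reg 6)))) (Assign 11 (Reg 6))) Skip"
  let ?b = "R 9 - 1"
  define J where "J i R' A' \<longleftrightarrow> same {6, 10, 11} R R' \<and> A' = A \<and> R' 10 \<le> cap \<and>
    (\<forall>a<i. okA A a ?b \<longrightarrow> R' 10 \<le> A 1 a) \<and>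
    (R' 10 < cap \<longrightarrow> R' 11 < N \<and> okA A (R' 11) ?b \<and> A 1 (R' 11) = R' 10)" for i R' A'
  have "hr scan R A (N * 60 + 20) (J N)"
    unfolding scan_def
  proof (rule hr_Seq, rule hr_straight)
    show "hwp (Assign 10 (Reg 3)) (\<lambda>R' A'. A' = A \<and> same {6,10,11} R R' \<and> R' 10 = cap) R A"
      by (simp add: cst_def)
    show "straight_cost (Assign 10 (Reg 3)) \<le> 2" by simp
  next
    fix R1 A1 assume 1: "A1 = A \<and> same {6,10,11} R R1 \<and> R1 10 = cap"
    show "hr (Seq (Assign 11 (Const 0)) (For 6
     ?body)) R1 A1 (N * 60 + 18) (J N)"
    proof (rule hr_Seq, rule hr_straight)
      show "hwp (Assign 11 (Const 0)) (\<lambda>R' A'. A' = A \<and> same {6,10,11} R R' \<and> R' 10 = cap) R1 A1"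
        using 1 by simp
      show "straight_cost (Assign 11 (Const 0)) \<le> 2" by simp
    next
      fix R2 A2 assume 2: "A2 = A \<and> same {6,10,11} R R2 \<and> R2 10 = cap"
      show "hr (For 6
     ?body) R2 A2 (N * 60 + 16) (J N)"
      proof (rule hr_For[where J = J])
        fix R' A' assume i: "R' 6 < N" and J: "J (R' 6) R' A'"
        have A': "A' = A" and R9: "R' 9 = R 9" using J by (auto simp: J_def same_def)
        have b: "?b < N" "R 9 < 2 ^ w" using cur N_word by auto
        have ok: "A 6 (R' 6 * N + ?b) \<le> 1" using wf i b(1) unfolding wf_def by blast
        have ixb: "R' 6 * N + ?b < N * N * N" using index2' i b by blast
        have p1: "A 6 (R' 6 * N + ?b) * of_bool P < 2 ^ w" for P
        proof -
          have "A 6 (R' 6 * N + ?b) * of_bool P \<le> 1" using ok by (cases P) auto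
          then show ?thesis using N_word by linarith
        qed
        have "hwp ?body
          (counted 6 (R' 6) J) R' A'"
        proof -
          have e: "ev (Op Times (Mem (Cell 6 (Ix2 (Reg 6) (Op Minus (Reg 9) (Const 1))))) (Op Less (Mem (Cell 1 (Reg 6))) (Reg 10))) R' A'
            = A 6 (R' 6 * N + ?b) * of_bool (A 1 (R' 6) < R' 10)"
            using i b ixb p1 R9 A' by (simp add: index1)
          have e1: "ev (Mem (Cell 1 (Reg 6))) R' A' = A 1 (R' 6)" using i A' by (simp add: index1)
          show ?thesis
          proof (cases "A 6 (R' 6 * N + ?b) \<noteq> 0 \<and> A 1 (R' 6) < R' 10")
            case True
            have "J (Suc (R' 6)) (R'(10 := A 1 (R' 6), 11 := R' 6, 6 := Suc (R' 6))) A'"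
              unfolding J_def
            proof (intro conjI allI impI)
              fix a assume "a < Suc (R' 6)" "okA A a ?b"
              then show "(R'(10 := A 1 (R' 6), 11 := R' 6, 6 := Suc (R' 6))) 10 \<le> A 1 a"
                using J True unfolding J_def by (auto simp: less_Suc_eq dest: spec[of _ a])
            qed (use J True i in \<open>auto simp: J_def okA_def\<close>)
            then show ?thesis using True e1 unfolding hwp.simps(5) e by simp
          next
            case False
            have "J (Suc (R' 6)) (R'(6 := Suc (R' 6))) A'"
              unfolding J_def
            proof (intro conjI allI impI)
              fix a assume "a < Suc (R' 6)" "okA A a ?b"
              then show "(R'(6 := Suc (R' 6))) 10 \<le> A 1 a"
                using J False unfolding J_def by (auto simp: less_Suc_eq okA_def)
            qed (use J in \<open>auto simp: J_def\<close>)
            then show ?thesis using False unfolding hwp.simps(5) e by auto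
          qed
        qed
        then show "hr ?body R' A' 50
          (counted 6 (R' 6) J)"
          by (rule hr_straight) (simp add: Cell_def Ix2_def)
      qed (use 2 in \<open>auto simp: J_def\<close>)
    qed simp
  qed simp
  then show ?thesis by (rule hr_mono) (auto simp: J_def scanned_def)
qed

definition auctioned :: "regs \<Rightarrow> arrays \<Rightarrow> regs \<Rightarrow> arrays \<Rightarrow> bool" where
  "auctioned R A R' A' \<longleftrightarrow> same {6, 7, 9, 10, 11, 12} R R' \<and> same {1, 2} A A' \<and> pmatch N (okA A) (A' 2) \<and>
    (\<forall>m. pmatch N (okA A) m \<longrightarrow> msize N m \<le> msize N (A' 2) + cap)"

lemma auction_correct:
  assumes wf: "wf A"
  shows "hr auction R A ((N * cap + 2 * N + 1) * (N * 60 + 100) + N * 40 + 100) (\<lambda>R' A'. auctioned R A R' A')"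
proof -
  let ?body = "If (Reg 9) (Seq scan bid)
    (Seq (Assign 7 (Op Plus (Reg 7) (Const 1))) (Assign 9 (Op Plus (Reg 7) (Const 1))))"
  let ?win = "Seq (Assign 12 (Mem (Cell 2 (Reg 11)))) (Seq (Store (Cell 2 (Reg 11)) (Reg 9))
    (Seq (Store (Cell 1 (Reg 11)) (Op Plus (Reg 10) (Const 1))) (Assign 9 (Reg 12))))"
  let ?reset = "Seq (Store (Cell 1 (Reg 6)) (Const 0)) (Store (Cell 2 (Reg 6)) (Const 0))"
  define base where "base R' A' \<longleftrightarrow> same {6, 7, 9, 10, 11, 12} R R' \<and> same {1, 2} A A'" for R' A'
  have base_wf: "wf A'" "okA A' = okA A" if "base R' A'" for R' A'
    using that wf wf_cong[of "{1,2}" A A'] okA_cong[of A' A] by (auto simp: base_def same_def)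
  define Inv where "Inv R' A' \<longleftrightarrow> base R' A' \<and> auction_inv N (okA A) cap (R' 7) (R' 9) (A' 2) (A' 1) \<and>
    R' 7 \<le> N \<and> (R' 7 = N \<longrightarrow> R' 9 = Suc N)" for R' A'
  \<comment> \<open>A bid raises a label below the cap, giving up clears register 9, and introducing
    an object sets it again; the factor 2 pays for the latter.\<close>
  define \<mu> where "\<mu> R' A' = (\<Sum>a<N. cap - A' 1 a) + 2 * (N - R' 7) + of_bool (R' 9 \<noteq> 0)"
    for R' :: regs and A' :: arrays
  have step: "hr ?body R1 A1 (N * 60 + 70)
    (\<lambda>R' A'. Inv R' A' \<and> \<mu> R' A' < \<mu> R1 A1)"
    if inv: "Inv R1 A1" and b: "R1 7 < N" for R1 A1
  proof (rule hr_If)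
    assume "ev (Reg 9) R1 A1 \<noteq> 0"
    then have cur: "R1 9 \<noteq> 0" by simp
    have B: "base R1 A1" and auc: "auction_inv N (okA A) cap (R1 7) (R1 9) (A1 2) (A1 1)"
      using inv by (auto simp: Inv_def)
    have curN: "R1 9 \<le> N" using auc b unfolding auction_inv_def by linarith
    note sc = scan_correct[where R = R1 and A = A1, OF base_wf(1)[OF B] cur curN]
    show "hr (Seq scan bid) R1 A1 (N * 60 + 68) (\<lambda>R' A'. Inv R' A' \<and> \<mu> R' A' < \<mu> R1 A1)"
    proof (rule hr_Seq[OF sc, where ?T2.0 = 48])
      fix R2 A2 assume "scanned R1 A1 R2 A2"
      note 2 = this[unfolded scanned_def]
      have R: "R2 7 = R1 7" "R2 9 = R1 9" using 2 by (auto simp: same_def)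
      have A2: "A2 = A1" using 2 by blast
      have ok: "okA A1 = okA A" using base_wf(2)[OF B] .
      have B2: "base R2 A1" using B 2 unfolding base_def same_def by auto
      show "hr bid R2 A2 48 (\<lambda>R' A'. Inv R' A' \<and> \<mu> R' A' < \<mu> R1 A1)"
        unfolding bid_def
      proof (rule hr_If)
        assume "ev (Op Less (Reg 10) (Reg 3)) R2 A2 \<noteq> 0"
        then have lt: "R2 10 < cap" by (simp add: cst_def split: if_splits)
        define a where "a = R2 11"
        have a: "a < N" "okA A a (R1 9 - 1)" "A1 1 a = R2 10" using 2 lt ok by (auto simp: a_def)
        have best: "\<forall>a'<N. okA A a' (R1 9 - 1) \<longrightarrow> A1 1 a \<le> A1 1 a'" using 2 a lt ok by fastforce
        let ?A = "A1(2 := (A1 2)(a := R1 9), 1 := (A1 1)(a := R2 10 + 1))"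
        let ?R = "R2(12 := A1 2 a, 9 := A1 2 a)"
        have auc': "auction_inv N (okA A) cap (R1 7) (A1 2 a) ((A1 2)(a := R1 9)) ((A1 1)(a := R2 10 + 1))"
          using auction_inv_bid[OF auc cur curN a(1,2) _ best] a(3) lt by simp
        have "Inv ?R ?A"
          using auc' B2 b unfolding Inv_def by (auto simp: R base_def)
        moreover have "\<mu> ?R ?A < \<mu> R1 A1"
        proof -
          have "(\<Sum>a'<N. cap - ((A1 1)(a := R2 10 + 1)) a') < (\<Sum>a'<N. cap - A1 1 a')"
            by (rule sum_strict_mono_ex1) (use a lt in \<open>auto intro!: bexI[of _ a]\<close>)
          then show ?thesis using cur R by (simp add: \<mu>_def)
        qed
        moreover have "R2 10 + 1 < 2 ^ w" using lt cap_N N_word by linarith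
        ultimately show "hr ?win R2 A2 44 (\<lambda>R' A'. Inv R' A' \<and> \<mu> R' A' < \<mu> R1 A1)"
        proof (intro hr_straight)
          assume h: "Inv ?R ?A" "\<mu> ?R ?A < \<mu> R1 A1" "R2 10 + 1 < 2 ^ w"
          have goal: "hwp ?win
            (\<lambda>R' A'. R' = ?R \<and> A' = ?A) R2 A1"
            using a(1) h(3) R a_def by (simp add: index1)
          show "hwp ?win
            (\<lambda>R' A'. Inv R' A' \<and> \<mu> R' A' < \<mu> R1 A1) R2 A2"
            unfolding A2 by (rule hwp_mono[OF goal]) (use h in simp)
        qed (simp add: Cell_def)
      next
        assume "ev (Op Less (Reg 10) (Reg 3)) R2 A2 = 0"
        then have ge: "cap \<le> R2 10" by (simp add: cst_def split: if_splits)
        have "auction_inv N (okA A) cap (R1 7) 0 (A1 2) (A1 1)"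
          by (rule auction_inv_drop[OF auc]) (use 2 ge ok in fastforce)
        then have "Inv (R2(9 := 0)) A2" using B2 2 b unfolding Inv_def by (auto simp: R base_def)
        moreover have "\<mu> (R2(9 := 0)) A2 < \<mu> R1 A1" using cur unfolding A2 by (simp add: \<mu>_def R)
        ultimately show "hr (Assign 9 (Const 0)) R2 A2 44 (\<lambda>R' A'. Inv R' A' \<and> \<mu> R' A' < \<mu> R1 A1)"
          by (intro hr_straight) auto
      qed simp
    qed simp
  next
    assume "ev (Reg 9) R1 A1 = 0"
    then have cur: "R1 9 = 0" by simp
    have auc: "auction_inv N (okA A) cap (R1 7) 0 (A1 2) (A1 1)"
      using inv cur by (auto simp: Inv_def)
    let ?R = "R1(7 := R1 7 + 1, 9 := R1 7 + 2)"
    have "Inv ?R A1" using auction_inv_next[OF auc] inv b unfolding Inv_def by (auto simp: base_def)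
    moreover have "\<mu> ?R A1 < \<mu> R1 A1" using cur b by (simp add: \<mu>_def)
    moreover have "R1 7 + 2 < 2 ^ w" using b N_word by linarith
    ultimately show "hr (Seq (Assign 7 (Op Plus (Reg 7) (Const 1))) (Assign 9 (Op Plus (Reg 7) (Const 1)))) R1 A1 (N * 60 + 68)
      (\<lambda>R' A'. Inv R' A' \<and> \<mu> R' A' < \<mu> R1 A1)"
      by (intro hr_straight) auto
  qed simp
  let ?zero = "\<lambda>i R' A'. base R' A' \<and> (\<forall>a<i. A' 1 a = 0 \<and> A' 2 a = 0)"
  show ?thesis
    unfolding auction_def
  proof (rule hr_Seq)
    show "hr (For 6 ?reset) R A (N * 40 + 6)
      (?zero N)"
    proof (rule hr_For[where J = ?zero])
      fix R' A' assume "R' 6 < N" "?zero (R' 6) R' A'"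
      then show "hr ?reset R' A' 32
        (counted 6 (R' 6) ?zero)"
      proof (intro hr_straight)
        assume h: "R' 6 < N" "?zero (R' 6) R' A'"
        then show "hwp ?reset
        (counted 6 (R' 6) ?zero) R' A'"
          by (simp add: index1) (simp add: base_def less_Suc_eq)
      qed (simp add: Cell_def)
    qed (auto simp: base_def)
  next
    fix R1 A1 assume 1: "?zero N R1 A1"
    show "hr (Seq (Assign 7 (Const 0)) (Seq (Assign 9 (Const 1))
      (While (Op Less (Reg 7) (Reg 1))
      ?body))) R1 A1
      ((N * cap + 2 * N + 1) * (N * 60 + 100) + 50) (auctioned R A)"
    proof (rule hr_Seq)
      show "hr (Assign 7 (Const 0)) R1 A1 2 (\<lambda>R' A'. R' = R1(7 := 0) \<and> A' = A1)"
        by (rule hr_straight) auto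
    next
      fix R2 A2 assume 2: "R2 = R1(7 := 0) \<and> A2 = A1"
      show "hr (Seq (Assign 9 (Const 1))
       (While (Op Less (Reg 7) (Reg 1))
        ?body)) R2 A2
       ((N * cap + 2 * N + 1) * (N * 60 + 100) + 40) (auctioned R A)"
      proof (rule hr_Seq)
        show "hr (Assign 9 (Const 1)) R2 A2 2 (\<lambda>R' A'. R' = R1(7 := 0, 9 := 1) \<and> A' = A1)"
          by (rule hr_straight) (use 2 in auto)
      next
        fix R3 A3 assume 3: "R3 = R1(7 := 0, 9 := 1) \<and> A3 = A1"
        have \<mu>3: "\<mu> R3 A3 \<le> N * cap + 2 * N + 1"
          using sum_bounded_above[of "{..<N}" "\<lambda>a. cap - A3 1 a" cap] 3 unfolding \<mu>_def by simp
        show "hr (While (Op Less (Reg 7) (Reg 1))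
         ?body) R3 A3
          ((N * cap + 2 * N + 1) * (N * 60 + 100) + 30) (auctioned R A)"
        proof (rule hr_While[where J = Inv and \<mu> = \<mu> and T = "N * 60 + 70"])
          have "auction_inv N (okA A) cap 0 1 (A1 2) (A1 1)"
            by (rule auction_inv_cong[OF auction_inv_init]) (use 1 in auto)
          then show "Inv R3 A3" using 3 1 N2 unfolding Inv_def by (auto simp: base_def)
        next
          fix R' A' assume J: "Inv R' A'" and "ev (Op Less (Reg 7) (Reg 1)) R' A' \<noteq> 0"
          then have "R' 7 < N" by (simp add: cst_def split: if_splits)
          from step[OF J this] show "hr ?body R' A' (N * 60 + 70)
            (\<lambda>R'' A''. Inv R'' A'' \<and> \<mu> R'' A'' < \<mu> R' A')" .
        next
          fix R' A' assume J: "Inv R' A'" and "ev (Op Less (Reg 7) (Reg 1)) R' A' = 0"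
          then have "R' 7 = N" by (simp add: cst_def Inv_def split: if_splits)
          then have fin: "auction_inv N (okA A) cap N (Suc N) (A' 2) (A' 1)" and "base R' A'"
            using J by (auto simp: Inv_def)
          then show "auctioned R A R' A'"
            unfolding auctioned_def
            using auction_inv_final[OF fin N_cap] unfolding base_def auction_inv_def by blast
        next
          have "\<mu> R3 A3 * (N * 60 + 70 + 1 + exp_cost (Op Less (Reg 7) (Reg 1))) \<le> (N * cap + 2 * N + 1) * (N * 60 + 100)"
            by (rule mult_mono[OF \<mu>3]) auto
          then show "\<mu> R3 A3 * (N * 60 + 70 + 1 + exp_cost (Op Less (Reg 7) (Reg 1))) + 1 + exp_cost (Op Less (Reg 7) (Reg 1))
            \<le> (N * cap + 2 * N + 1) * (N * 60 + 100) + 30" by simp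
        qed
      qed simp
    qed simp
  qed simp
qed

end

section \<open>Augmenting paths\<close>

text \<open>Objects in the order of their expansion: the root has number 0, and the agent at queue
  position \<open>k - 1\<close> contributes the object she holds as number \<open>k\<close>.\<close>

definition source :: "vec \<Rightarrow> nat \<Rightarrow> vec \<Rightarrow> nat \<Rightarrow> nat" where
  "source m b Q k = (if k = 0 then b else m (Q (k - 1)) - 1)"

text \<open>Predecessors stand earlier in the queue, so the walk back to the root terminates; a zero
  in \<open>prev\<close> means reached directly from the root. Agents before the head
  \<open>h\<close> are matched, since an unmatched one ends the search.\<close>

definition bfs :: "nat \<Rightarrow> (nat \<Rightarrow> nat \<Rightarrow> bool) \<Rightarrow> vec \<Rightarrow> nat \<Rightarrow> vec \<Rightarrow> vec \<Rightarrow> vec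
  \<Rightarrow> nat \<Rightarrow> nat \<Rightarrow> bool" where
  "bfs N E m b vis prev Q h t \<longleftrightarrow> h \<le> t \<and> inj_on Q {..<t} \<and> Q ` {..<t} \<subseteq> {..<N} \<and>
    (\<forall>a<N. vis a \<le> 1 \<and> (vis a \<noteq> 0 \<longleftrightarrow> a \<in> Q ` {..<t})) \<and>
    (\<forall>j<t. prev (Q j) = 0 \<and> E (Q j) b \<or>
    (\<exists>i<j. prev (Q j) = Suc (Q i) \<and> m (Q i) \<noteq> 0 \<and> E (Q j) (m (Q i) - 1))) \<and>
    (\<forall>i<h. m (Q i) \<noteq> 0)"

lemma bfs_t: "bfs N E m b vis prev Q h t \<Longrightarrow> t \<le> N"
  unfolding bfs_def using card_inj_on_le[of Q "{..<t}" "{..<N}"] by auto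

text \<open>The new agent is written at the tail, which is not before the head, so the objects
  numbered up to \<open>h\<close> keep their numbers.\<close>

lemma bfs_add:
  assumes bfs: "bfs N E m b vis prev Q h t" and a: "a < N" "vis a = 0" "E a (source m b Q h)"
  shows "bfs N E m b (vis(a := 1)) (prev(a := if h = 0 then 0 else Suc (Q (h - 1)))) (Q(t := a)) h (Suc t)"
    and "t < N" and "k \<le> h \<Longrightarrow> source m b (Q(t := a)) k = source m b Q k"
proof -
  have ht: "h \<le> t" and an: "a \<notin> Q ` {..<t}" using bfs a unfolding bfs_def by auto
  then have ne: "\<forall>j<t. Q j \<noteq> a" by auto
  show src: "source m b (Q(t := a)) k = source m b Q k" if "k \<le> h" for k
    using that ht by (auto simp: source_def)
  show B: "bfs N E m b (vis(a := 1)) (prev(a := if h = 0 then 0 else Suc (Q (h - 1)))) (Q(t := a)) h (Suc t)"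
    unfolding bfs_def
  proof (intro conjI)
    show "inj_on (Q(t := a)) {..<Suc t}"
      using bfs an unfolding bfs_def lessThan_Suc by (auto simp: inj_on_def)
    have img: "(Q(t := a)) ` {..<Suc t} = insert a (Q ` {..<t})"
      by (auto simp: lessThan_Suc image_iff)
    show "(Q(t := a)) ` {..<Suc t} \<subseteq> {..<N}" using bfs a unfolding img bfs_def by auto
    show "\<forall>a'<N. (vis(a := 1)) a' \<le> 1 \<and> ((vis(a := 1)) a' \<noteq> 0 \<longleftrightarrow> a' \<in> (Q(t := a)) ` {..<Suc t})"
      using bfs unfolding img bfs_def by auto
    show "\<forall>i<h. m ((Q(t := a)) i) \<noteq> 0" using bfs ht unfolding bfs_def by auto
    let ?prev = "prev(a := if h = 0 then 0 else Suc (Q (h - 1)))" and ?Q = "Q(t := a)"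
    let ?P = "\<lambda>j. ?prev (?Q j) = 0 \<and> E (?Q j) b \<or>
      (\<exists>i<j. ?prev (?Q j) = Suc (?Q i) \<and> m (?Q i) \<noteq> 0 \<and> E (?Q j) (m (?Q i) - 1))"
    show "\<forall>j<Suc t. ?P j"
    proof (intro allI impI)
      fix j assume "j < Suc t"
      show "?P j"
      proof (cases "j = t")
        case False
        then have "j < t" using \<open>j < Suc t\<close> by simp
        then have "prev (Q j) = 0 \<and> E (Q j) b \<or>
          (\<exists>i<j. prev (Q j) = Suc (Q i) \<and> m (Q i) \<noteq> 0 \<and> E (Q j) (m (Q i) - 1))"
          using bfs unfolding bfs_def by blast
        then show ?thesis
        proof (elim disjE exE conjE)
          fix i assume "i < j" "prev (Q j) = Suc (Q i)" "m (Q i) \<noteq> 0" "E (Q j) (m (Q i) - 1)"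
          then show ?thesis using \<open>j < t\<close> ne by (intro disjI2 exI[of _ i]) auto
        qed (use \<open>j < t\<close> ne in auto)
      next
        case True
        show ?thesis
        proof (cases "h = 0")
          case False
          then have "h - 1 < t" "m (Q (h - 1)) \<noteq> 0" using bfs ht unfolding bfs_def by auto
          then show ?thesis using True False a by (intro disjI2 exI[of _ "h - 1"]) (auto simp: source_def)
        qed (use True a in \<open>auto simp: source_def\<close>)
      qed
    qed
  qed (use ht in simp)
  show "t < N" using bfs_t[OF B] by simp
qed

lemma bfs_pop:
  assumes "bfs N E m b vis prev Q h t" "h < t" "m (Q h) \<noteq> 0"
  shows "bfs N E m b vis prev Q (Suc h) t"
  using assms unfolding bfs_def by (auto simp: less_Suc_eq)

text \<open>
  \<open>x\<close> is the agent of the augmenting path that is about to get a new object; the entry \<open>m' x\<close> is stale.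
\<close>

definition augment_inv :: "nat \<Rightarrow> (nat \<Rightarrow> nat \<Rightarrow> bool) \<Rightarrow> vec \<Rightarrow> nat \<Rightarrow> vec \<Rightarrow> nat \<Rightarrow> nat
  \<Rightarrow> nat \<Rightarrow> vec \<Rightarrow> bool" where
  "augment_inv N E m b Q t a0 j m' \<longleftrightarrow> j < t \<and> (let x = Q j; n = m'(x := 0) in
    pmatch N E n \<and> (\<forall>a<N. n a \<noteq> Suc b) \<and>
    insert x {a. a < N \<and> n a \<noteq> 0} = insert a0 {a. a < N \<and> m a \<noteq> 0} \<and>
    (\<forall>i\<le>j. m' (Q i) = m (Q i)) \<and>
    (\<forall>a<N. m a \<noteq> 0 \<longrightarrow> (\<exists>a'<N. n a' = m a)))"

lemma augment_inv_init:
  assumes "pmatch N E m" "\<forall>a<N. m a \<noteq> Suc b" "j < t" "m (Q j) = 0"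
  shows "augment_inv N E m b Q t (Q j) j m"
proof -
  have "m(Q j := 0) = m" using assms(4) by auto
  then show ?thesis using assms unfolding augment_inv_def Let_def by auto
qed

text \<open>The predecessor hands her object over. It is still the one seen by the search, because
  entries at queue positions up to \<open>j\<close> are unchanged. She then becomes the agent in
  need of an object, at a smaller position.\<close>

lemma augment_inv_step:
  assumes bfs: "bfs N E m b vis prev Q h t" and inv: "augment_inv N E m b Q t a0 j m'"
    and prev: "prev (Q j) \<noteq> 0"
  shows "\<exists>i<j. prev (Q j) = Suc (Q i) \<and> augment_inv N E m b Q t a0 i (m'(Q j := m' (Q i)))"
proof -
  have jt: "j < t" and Qinj: "inj_on Q {..<t}" and QN: "Q ` {..<t} \<subseteq> {..<N}"
    using inv bfs unfolding augment_inv_def bfs_def by auto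
  obtain i where i: "i < j" "prev (Q j) = Suc (Q i)" "m (Q i) \<noteq> 0" "E (Q j) (m (Q i) - 1)"
  proof -
    have "prev (Q j) = 0 \<and> E (Q j) b \<or>
      (\<exists>i<j. prev (Q j) = Suc (Q i) \<and> m (Q i) \<noteq> 0 \<and> E (Q j) (m (Q i) - 1))"
      using bfs jt unfolding bfs_def by blast
    then show thesis using prev that by metis
  qed
  define x y where "x = Q j" and "y = Q i"
  have Qne: "Q i' \<noteq> Q j" if "i' < j" for i'
    using inj_onD[OF Qinj, of i' j] that jt by auto
  have xy: "x \<noteq> y" using Qne[OF i(1)] unfolding x_def y_def by simp
  have xN: "x < N" "y < N" using QN i jt unfolding x_def y_def by (auto simp: image_subset_iff)
  define n where "n = m'(x := 0)"
  have inv': "pmatch N E n" "\<forall>a<N. n a \<noteq> Suc b"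
     "insert x {a. a < N \<and> n a \<noteq> 0} = insert a0 {a. a < N \<and> m a \<noteq> 0}"
     "\<forall>i\<le>j. m' (Q i) = m (Q i)" "\<forall>a<N. m a \<noteq> 0 \<longrightarrow> (\<exists>a'<N. n a' = m a)"
    using inv unfolding augment_inv_def Let_def n_def x_def by auto
  have my: "m' y = m y" "n y = m y" "m y \<noteq> 0" using inv'(4) i xy unfolding y_def n_def by auto
  let ?m = "m'(x := m' y)"
  have n': "?m(y := 0) = n(x := n y, y := 0)" using my xy unfolding n_def by auto
  have yN: "m y \<le> N" using inv'(1) xN my unfolding pmatch_def by metis
  have "augment_inv N E m b Q t a0 i ?m"
    unfolding augment_inv_def Let_def y_def[symmetric] n'
  proof (intro conjI)
    show "i < t" using i jt by simp
    have "\<forall>a<N. \<forall>a'<N. n a = n a' \<longrightarrow> n a \<noteq> 0 \<longrightarrow> a = a'"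
      and e: "\<forall>a<N. n a \<noteq> 0 \<longrightarrow> n a \<le> N \<and> E a (n a - 1)" using inv'(1) unfolding pmatch_def by auto
    moreover have n0: "n x = 0" unfolding n_def by simp
    ultimately show "pmatch N E (n(x := n y, y := 0))"
      using i(4) xN yN my unfolding pmatch_def x_def[symmetric] y_def[symmetric] by (auto simp: my(2))
    show "\<forall>a<N. (n(x := n y, y := 0)) a \<noteq> Suc b" using inv'(2) xN by auto
    show "insert y {a. a < N \<and> (n(x := n y, y := 0)) a \<noteq> 0} = insert a0 {a. a < N \<and> m a \<noteq> 0}"
      unfolding inv'(3)[symmetric] using xy xN my by auto
    show "\<forall>i'\<le>i. ?m (Q i') = m (Q i')"
    proof (intro allI impI)
      fix i' assume "i' \<le> i"
      then have "Q i' \<noteq> x" using Qne[of i'] i(1) unfolding x_def by simp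
      then show "?m (Q i') = m (Q i')" using inv'(4) \<open>i' \<le> i\<close> i by auto
    qed
    show "\<forall>a<N. m a \<noteq> 0 \<longrightarrow> (\<exists>a'<N. (n(x := n y, y := 0)) a' = m a)"
    proof (intro allI impI)
      fix a assume a: "a < N" "m a \<noteq> 0"
      then obtain a' where a': "a' < N" "n a' = m a" using inv'(5) by blast
      show "\<exists>a'<N. (n(x := n y, y := 0)) a' = m a"
      proof (cases "a' = y")
        case True
        then show ?thesis using a' xN xy by (intro exI[of _ x]) auto
      next
        case False
        moreover have "a' \<noteq> x" using a' a unfolding n_def by auto
        ultimately show ?thesis using a' by (intro exI[of _ a']) auto
      qed
    qed
  qed
  then show ?thesis using i unfolding x_def y_def by blast
qed

text \<open>A zero predecessor means that the agent demands the root \<open>b\<close> itself. The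
  last claim, that matched objects stay matched, lets a round visit each object only once.\<close>

lemma augment_inv_final:
  assumes bfs: "bfs N E m b vis prev Q h t" and inv: "augment_inv N E m b Q t a0 j m'"
    and prev: "prev (Q j) = 0" and a0: "a0 < N" "m a0 = 0" and b: "b < N"
  defines "m1 \<equiv> m'(Q j := Suc b)"
  shows "pmatch N E m1" "msize N m1 = Suc (msize N m)" "\<exists>a<N. m1 a = Suc b"
    "\<forall>a<N. m a \<noteq> 0 \<longrightarrow> (\<exists>a'<N. m1 a' = m a)"
proof -
  define x where "x = Q j"
  define n where "n = m'(x := 0)"
  have inv': "pmatch N E n" "\<forall>a<N. n a \<noteq> Suc b"
     "insert x {a. a < N \<and> n a \<noteq> 0} = insert a0 {a. a < N \<and> m a \<noteq> 0}"
     "\<forall>a<N. m a \<noteq> 0 \<longrightarrow> (\<exists>a'<N. n a' = m a)" "j < t"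
    using inv unfolding augment_inv_def Let_def n_def x_def by auto
  have xN: "x < N" using inv'(5) bfs unfolding bfs_def x_def by auto
  have "prev (Q j) = 0 \<and> E (Q j) b \<or>
    (\<exists>i<j. prev (Q j) = Suc (Q i) \<and> m (Q i) \<noteq> 0 \<and> E (Q j) (m (Q i) - 1))"
    using bfs inv'(5) unfolding bfs_def by blast
  then have E: "E x b" using prev unfolding x_def by simp
  have m1: "m1 = n(x := Suc b)" unfolding m1_def n_def x_def by simp
  have n0: "n x = 0" unfolding n_def by simp
  show "pmatch N E m1" using inv'(1,2) E xN b unfolding m1 pmatch_def by auto
  have "{a. a < N \<and> m1 a \<noteq> 0} = insert a0 {a. a < N \<and> m a \<noteq> 0}"
    using inv'(3) n0 xN unfolding m1 by auto
  then show "msize N m1 = Suc (msize N m)" using a0 by (simp add: msize_def)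
  show "\<exists>a<N. m1 a = Suc b" using xN unfolding m1 by auto
  show "\<forall>a<N. m a \<noteq> 0 \<longrightarrow> (\<exists>a'<N. m1 a' = m a)" using inv'(4) n0 unfolding m1 by (metis fun_upd_apply)
qed

definition search_scan :: cmd where
  "search_scan = For 6 (If (Op Times (Mem (Cell 6 (Ix2 (Reg 6) (Reg 9)))) (Op Minus (Const 1) (Mem (Cell 3 (Reg 6)))))
    (Seq (Store (Cell 3 (Reg 6)) (Const 1)) (Seq (Store (Cell 4 (Reg 6)) (Reg 15))
    (Seq (Store (Cell 5 (Reg 14)) (Reg 6)) (Assign 14 (Op Plus (Reg 14) (Const 1)))))) Skip)"

text \<open>Register 17 is cleared when the queue is empty or an unmatched agent is found; register
  16 tells the two cases apart, with 0 for failure and the agent plus 1 for success.\<close>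

definition search_pop :: cmd where
  "search_pop = If (Op Less (Reg 13) (Reg 14))
    (Seq (Assign 12 (Mem (Cell 5 (Reg 13)))) (Seq (Assign 13 (Op Plus (Reg 13) (Const 1)))
    (If (Mem (Cell 2 (Reg 12)))
    (Seq (Assign 9 (Op Minus (Mem (Cell 2 (Reg 12))) (Const 1))) (Assign 15 (Op Plus (Reg 12) (Const 1))))
    (Seq (Assign 16 (Op Plus (Reg 12) (Const 1))) (Assign 17 (Const 0))))))
    (Assign 17 (Const 0))"

definition search :: cmd where
  "search = Seq (For 6 (Store (Cell 3 (Reg 6)) (Const 0)))
    (Seq (Seq (Assign 13 (Const 0)) (Seq (Assign 14 (Const 0)) (Seq (Assign 9 (Reg 7)) (Seq (Assign 15 (Const 0))
    (Seq (Assign 16 (Const 0)) (Assign 17 (Const 1)))))))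
    (While (Reg 17) (Seq search_scan search_pop)))"

definition augment :: cmd where
  "augment = Seq (Assign 12 (Op Minus (Reg 16) (Const 1)))
    (Seq (While (Mem (Cell 4 (Reg 12))) (Seq (Assign 9 (Op Minus (Mem (Cell 4 (Reg 12))) (Const 1)))
    (Seq (Store (Cell 2 (Reg 12)) (Mem (Cell 2 (Reg 9)))) (Assign 12 (Reg 9)))))
    (Store (Cell 2 (Reg 12)) (Op Plus (Reg 7) (Const 1))))"

context ram
begin

definition search_at :: "nat \<Rightarrow> regs \<Rightarrow> arrays \<Rightarrow> bool" where
  "search_at b R A \<longleftrightarrow> bfs N (okA A) (A 2) b (A 3) (A 4) (A 5) (R 13) (R 14)"

definition source_scanned :: "nat \<Rightarrow> regs \<Rightarrow> arrays \<Rightarrow> regs \<Rightarrow> arrays \<Rightarrow> bool" where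
  "source_scanned b R A R' A' \<longleftrightarrow> same {6, 14} R R' \<and> same {3, 4, 5} A A' \<and> search_at b R' A' \<and>
    (\<forall>k\<le>R 13. \<forall>a<N. okA A a (source (A 2) b (A' 5) k) \<longrightarrow> A' 3 a \<noteq> 0)"

lemma search_scan_correct:
  assumes wf: "wf A" and s: "search_at b R A" and b: "b < N" and m: "pmatch N (okA A) (A 2)"
    and cur: "R 9 = source (A 2) b (A 5) (R 13)" "R 15 = (if R 13 = 0 then 0 else Suc (A 5 (R 13 - 1)))"
    and don: "\<forall>k<R 13. \<forall>a<N. okA A a (source (A 2) b (A 5) k) \<longrightarrow> A 3 a \<noteq> 0"
  shows "hr search_scan R A (N * 70 + 10) (source_scanned b R A)"
proof -
  let ?body = "If (Op Times (Mem (Cell 6 (Ix2 (Reg 6) (Reg 9)))) (Op Minus (Const 1) (Mem (Cell 3 (Reg 6)))))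
    (Seq (Store (Cell 3 (Reg 6)) (Const 1)) (Seq (Store (Cell 4 (Reg 6)) (Reg 15))
    (Seq (Store (Cell 5 (Reg 14)) (Reg 6)) (Assign 14 (Op Plus (Reg 14) (Const 1)))))) Skip"
  let ?h = "R 13"
  define J where "J i R' A' \<longleftrightarrow> same {6, 14} R R' \<and> same {3, 4, 5} A A' \<and> search_at b R' A' \<and>
    (\<forall>k\<le>?h. source (A 2) b (A' 5) k = source (A 2) b (A 5) k) \<and>
    (?h = 0 \<or> A' 5 (?h - 1) = A 5 (?h - 1)) \<and>
    (\<forall>a<N. A 3 a \<noteq> 0 \<longrightarrow> A' 3 a \<noteq> 0) \<and> (\<forall>a<i. okA A a (R 9) \<longrightarrow> A' 3 a \<noteq> 0)" for i R' A'
  have curN: "R 9 < N"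
  proof (cases "?h = 0")
    case False
    then have "A 2 (A 5 (?h - 1)) \<noteq> 0" "A 5 (?h - 1) < N"
      using s unfolding search_at_def bfs_def by (auto simp: image_subset_iff)
    then show ?thesis using m cur(1) False unfolding pmatch_def by (fastforce simp: source_def)
  qed (use cur b in \<open>simp add: source_def\<close>)
  show ?thesis
    unfolding search_scan_def
  proof (rule hr_For[where J = J])
    show "J 0 (R(6 := 0)) A" using s by (auto simp: J_def search_at_def)
  next
    fix R1 A1 assume i: "R1 6 < N" and J: "J (R1 6) R1 A1"
    let ?a = "R1 6" and ?t = "R1 14"
    have R1: "R1 9 = R 9" "R1 13 = ?h" "R1 15 = R 15" and A1: "A1 2 = A 2" "A1 6 = A 6"
      using J by (auto simp: J_def same_def)
    have ok: "okA A1 = okA A" by (rule okA_cong) (rule A1)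
    have ok1: "A 6 (?a * N + R 9) \<le> 1" using wf i curN unfolding wf_def by blast
    have B: "bfs N (okA A) (A 2) b (A1 3) (A1 4) (A1 5) ?h ?t"
      using J R1 A1 ok unfolding J_def search_at_def by simp
    have vis: "A1 3 ?a \<le> 1" using B i unfolding bfs_def by blast
    have src: "source (A 2) b (A1 5) ?h = R 9" using J cur unfolding J_def by auto
    have ix: "?a * N + R 9 < N * N * N" using index2' i curN by blast
    have "A 6 (?a * N + R 9) * (1 - A1 3 ?a) \<le> 1 * 1" by (rule mult_mono) (use ok1 in auto)
    then have w: "A 6 (?a * N + R 9) * (1 - A1 3 ?a) < 2 ^ w" "1 - A1 3 ?a < 2 ^ w" using N_word by linarith+
    have e: "ev (Op Times (Mem (Cell 6 (Ix2 (Reg 6) (Reg 9)))) (Op Minus (Const 1) (Mem (Cell 3 (Reg 6))))) R1 A1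
      = A 6 (?a * N + R 9) * (1 - A1 3 ?a)"
      using i curN ix w R1 A1 by (simp add: index1)
    let ?P = "counted 6 ?a J"
    have "hwp ?body ?P R1 A1"
    proof (cases "A 6 (?a * N + R 9) \<noteq> 0 \<and> A1 3 ?a = 0")
      case True
      have okc: "okA A ?a (source (A 2) b (A1 5) ?h)" using True src by (simp add: okA_def)
      let ?A = "A1(3 := (A1 3)(?a := 1), 4 := (A1 4)(?a := R 15), 5 := (A1 5)(?t := ?a))"
      have pr: "R 15 = (if ?h = 0 then 0 else Suc (A1 5 (?h - 1)))" using J cur(2) unfolding J_def by auto
      note add = bfs_add[OF B i _ okc, folded pr]
      have tN: "?t < N" using add(2) True by simp
      have ht: "?h \<le> ?t" using B unfolding bfs_def by simp
      have B': "bfs N (okA A) (A 2) b ((A1 3)(?a := 1)) ((A1 4)(?a := R 15)) ((A1 5)(?t := ?a)) ?h (Suc ?t)"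
        using add(1) True by simp
      have "J (Suc ?a) (R1(14 := Suc ?t, 6 := Suc ?a)) ?A"
        unfolding J_def
      proof (intro conjI)
        have "okA ?A = okA A" by (rule okA_cong) (simp add: A1)
        then show "search_at b (R1(14 := Suc ?t, 6 := Suc ?a)) ?A"
          using B' R1 A1 unfolding search_at_def by simp
        show "\<forall>k\<le>?h. source (A 2) b (?A 5) k = source (A 2) b (A 5) k"
          using add(3) True J unfolding J_def by auto
        show "?h = 0 \<or> ?A 5 (?h - 1) = A 5 (?h - 1)" using J ht unfolding J_def by auto
        show "\<forall>a<N. A 3 a \<noteq> 0 \<longrightarrow> ?A 3 a \<noteq> 0" using J unfolding J_def by simp
        show "\<forall>a<Suc ?a. okA A a (R 9) \<longrightarrow> ?A 3 a \<noteq> 0" using J unfolding J_def by (simp add: less_Suc_eq)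
      qed (use J in \<open>auto simp: J_def\<close>)
      moreover have "Suc ?t < 2 ^ w" using tN N_word by linarith
      ultimately show ?thesis using True tN i R1 unfolding hwp.simps(5) e by (simp add: index1)
    next
      case False
      then have v: "A 6 (?a * N + R 9) * (1 - A1 3 ?a) = 0" using vis by auto
      have "J (Suc ?a) (R1(6 := Suc ?a)) A1"
      proof -
        have "okA A ?a (R 9) \<longrightarrow> A1 3 ?a \<noteq> 0" using False by (auto simp: okA_def)
        then show ?thesis using J unfolding J_def search_at_def by (simp add: less_Suc_eq)
      qed
      then show ?thesis unfolding hwp.simps(5) e v by simp
    qed
    then show "hr ?body R1 A1 62 ?P"
      by (rule hr_straight) (simp add: Cell_def Ix2_def)
  next
    fix R' A' assume J: "J N R' A'"
    show "source_scanned b R A R' A'"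
      unfolding source_scanned_def
    proof (intro conjI allI impI)
      fix k a assume k: "k \<le> ?h" "a < N" "okA A a (source (A 2) b (A' 5) k)"
      then have o: "okA A a (source (A 2) b (A 5) k)" using J unfolding J_def by simp
      show "A' 3 a \<noteq> 0"
      proof (cases "k = ?h")
        case True
        then show ?thesis using J o k cur(1) unfolding J_def by simp
      next
        case False
        then have "k < ?h" using k(1) by simp
        then have "A 3 a \<noteq> 0" using don o k(2) by blast
        then show ?thesis using J k unfolding J_def by blast
      qed
    qed (use J in \<open>auto simp: J_def\<close>)
  qed simp_all
qed

text \<open>On failure, \<open>h = t\<close> makes all reached agents matched, and the visited set
  is closed under demand for the root and for the objects they hold.\<close>

definition search_result :: "nat \<Rightarrow> nat \<Rightarrow> arrays \<Rightarrow> bool" where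
  "search_result b found A \<longleftrightarrow> (\<exists>h t. bfs N (okA A) (A 2) b (A 3) (A 4) (A 5) h t \<and>
    (if found = 0 then h = t \<and> (\<forall>k\<le>t. \<forall>a<N. okA A a (source (A 2) b (A 5) k) \<longrightarrow> A 3 a \<noteq> 0)
    else \<exists>j<t. found = Suc (A 5 j) \<and> A 2 (A 5 j) = 0))"

definition searched :: "regs \<Rightarrow> arrays \<Rightarrow> regs \<Rightarrow> arrays \<Rightarrow> bool" where
  "searched R A R' A' \<longleftrightarrow> same {6, 9, 12, 13, 14, 15, 16, 17} R R' \<and> same {3, 4, 5} A A' \<and> search_result (R 7) (R' 16) A'"

lemma search_correct:
  assumes wf: "wf A" and b: "R 7 < N" and m: "pmatch N (okA A) (A 2)"
  shows "hr search R A ((N + 1) * (N * 70 + 80) + N * 30 + 40) (\<lambda>R' A'. searched R A R' A')"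
proof -
  let ?init = "Seq (Assign 13 (Const 0)) (Seq (Assign 14 (Const 0)) (Seq (Assign 9 (Reg 7)) (Seq (Assign 15 (Const 0))
    (Seq (Assign 16 (Const 0)) (Assign 17 (Const 1))))))"
  let ?b = "R 7"
  define base where "base R' A' \<longleftrightarrow> same {6, 9, 12, 13, 14, 15, 16, 17} R R' \<and> same {3, 4, 5} A A'" for R' A'
  have base: "wf A'" "okA A' = okA A" "A' 2 = A 2" "R' 7 = ?b" if "base R' A'" for R' A'
    using that wf wf_cong[of "{3,4,5}" A A'] okA_cong[of A' A] by (auto simp: base_def same_def)
  define Run where "Run R' A' \<longleftrightarrow> R' 16 = 0 \<and> search_at ?b R' A' \<and> R' 9 = source (A 2) ?b (A' 5) (R' 13) \<and>
    R' 15 = (if R' 13 = 0 then 0 else Suc (A' 5 (R' 13 - 1))) \<and>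
    (\<forall>k<R' 13. \<forall>a<N. okA A a (source (A 2) ?b (A' 5) k) \<longrightarrow> A' 3 a \<noteq> 0)" for R' A'
  define Inv where "Inv R' A' \<longleftrightarrow> base R' A' \<and> R' 17 \<le> 1 \<and>
    (if R' 17 = 0 then search_result ?b (R' 16) A' else Run R' A')" for R' A'
  \<comment> \<open>One expansion for the root and at most one for each agent: the head of the queue
    advances or the running flag falls.\<close>
  define \<mu> where "\<mu> R' A' = N - R' 13 + R' 17"
    for R' :: regs and A' :: arrays
  have step: "hr (Seq search_scan search_pop) R1 A1 (N * 70 + 70) (\<lambda>R' A'. Inv R' A' \<and> \<mu> R' A' < \<mu> R1 A1)"
    if inv: "Inv R1 A1" and go: "R1 17 \<noteq> 0" for R1 A1
  proof -
    have B: "base R1 A1" and run: "Run R1 A1" and go1: "R1 17 = 1" using inv go by (auto simp: Inv_def)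
    note B' = base[OF B]
    have scan: "hr search_scan R1 A1 (N * 70 + 10) (source_scanned ?b R1 A1)"
      using run m b by (intro search_scan_correct) (auto simp: B' Run_def)
    show ?thesis
    proof (rule hr_Seq[OF scan, where ?T2.0 = 55])
      fix R2 A2 assume "source_scanned ?b R1 A1 R2 A2"
      note 2 = this[unfolded source_scanned_def]
      let ?h = "R2 13" and ?t = "R2 14"
      have R2: "R2 13 = R1 13" "R2 16 = 0" "R2 17 = 1"
        using 2 run go1 by (auto simp: same_def Run_def)
      have B2: "base R2 A2"
        using same_trans[of _ R R1 "{6, 14}" R2] same_trans[of _ A A1 "{3, 4, 5}" A2] B 2
        unfolding base_def by simp
      note B2' = base[OF B2]
      have bfs: "bfs N (okA A) (A 2) ?b (A2 3) (A2 4) (A2 5) ?h ?t"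
        using 2 B2' unfolding search_at_def by simp
      have don: "\<forall>k\<le>?h. \<forall>a<N. okA A a (source (A 2) ?b (A2 5) k) \<longrightarrow> A2 3 a \<noteq> 0"
        using 2 B' R2 by simp
      have tN: "?t \<le> N" and ht: "?h \<le> ?t" using bfs_t[OF bfs] bfs unfolding bfs_def by auto
      let ?x = "A2 5 ?h"
      have xN: "?x < N" if "?h < ?t" using bfs that unfolding bfs_def by (auto simp: image_subset_iff)
      have "hwp search_pop (\<lambda>R' A'. Inv R' A' \<and> \<mu> R' A' < \<mu> R1 A1) R2 A2"
      proof (cases "?h < ?t")
        case lt: True
        have w: "Suc ?h < 2 ^ w" "Suc ?x < 2 ^ w" using lt tN xN[OF lt] N_word by linarith+
        have h3: "?h < N * N * N" "?x < N * N * N" using index1[of ?h] index1[of ?x] lt tN xN[OF lt] by simp_all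
        show ?thesis
        proof (cases "A 2 ?x = 0")
          case False
          let ?R = "R2(12 := ?x, 13 := Suc ?h, 9 := A 2 ?x - 1, 15 := Suc ?x)"
          have "A 2 ?x \<le> N" using m False xN[OF lt] unfolding pmatch_def by blast
          then have w2: "A 2 ?x - 1 < 2 ^ w" using N_word by linarith
          have "search_at ?b ?R A2"
            using bfs_pop[OF bfs lt False] B2' unfolding search_at_def by simp
          then have "Run ?R A2" using don R2 unfolding Run_def by (auto simp: source_def less_Suc_eq_le)
          then have "Inv ?R A2" using B2 R2 unfolding Inv_def by (auto simp: base_def)
          moreover have "\<mu> ?R A2 < \<mu> R1 A1" using R2 lt tN go1 unfolding \<mu>_def by simp
          ultimately show ?thesis using lt w w2 h3 False B2' unfolding search_pop_def by simp
        next
          case True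
          let ?R = "R2(12 := ?x, 13 := Suc ?h, 16 := Suc ?x, 17 := 0)"
          have "search_result ?b (Suc ?x) A2"
            unfolding search_result_def B2' using bfs lt True by auto
          then have "Inv ?R A2" using B2 R2 unfolding Inv_def by (auto simp: base_def)
          moreover have "\<mu> ?R A2 < \<mu> R1 A1" using R2 lt tN go1 unfolding \<mu>_def by simp
          ultimately show ?thesis using lt w h3 True B2' unfolding search_pop_def by simp
        qed
      next
        case False
        then have "?h = ?t" using ht by simp
        then have "search_result ?b 0 A2"
          unfolding search_result_def B2' using bfs don by auto
        then have "Inv (R2(17 := 0)) A2" using B2 R2 unfolding Inv_def by (auto simp: base_def)
        moreover have "\<mu> (R2(17 := 0)) A2 < \<mu> R1 A1" using R2 go1 unfolding \<mu>_def by simp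
        ultimately show ?thesis using False unfolding search_pop_def by simp
      qed
      then show "hr search_pop R2 A2 55 (\<lambda>R' A'. Inv R' A' \<and> \<mu> R' A' < \<mu> R1 A1)"
        by (rule hr_straight) (simp add: search_pop_def Cell_def)
    qed simp
  qed
  let ?zero = "\<lambda>i R' A'. base R' A' \<and> (\<forall>a<i. A' 3 a = 0)"
  show ?thesis
    unfolding search_def
  proof (rule hr_Seq)
    show "hr (For 6 (Store (Cell 3 (Reg 6)) (Const 0))) R A (N * 30 + 6)
      (?zero N)"
    proof (rule hr_For[where J = ?zero])
      fix R' A' assume h: "R' 6 < N" "?zero (R' 6) R' A'"
      then have "hwp (Store (Cell 3 (Reg 6)) (Const 0))
        (counted 6 (R' 6) ?zero) R' A'"
        by (simp add: index1) (simp add: base_def less_Suc_eq)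
      then show "hr (Store (Cell 3 (Reg 6)) (Const 0)) R' A' 22
        (counted 6 (R' 6) ?zero)"
        by (rule hr_straight) (simp add: Cell_def)
    qed (auto simp: base_def)
  next
    fix R1 A1 assume 1: "?zero N R1 A1"
    show "hr (Seq ?init
      (While (Reg 17) (Seq search_scan search_pop))) R1 A1 ((N + 1) * (N * 70 + 80) + 30)
      (searched R A)"
    proof (rule hr_Seq, rule hr_straight)
      let ?R = "R1(13 := 0, 14 := 0, 9 := ?b, 15 := 0, 16 := 0, 17 := 1)"
      show "hwp ?init (\<lambda>R' A'. R' = ?R \<and> A' = A1) R1 A1"
        using base(4)[of R1 A1] 1 by simp
      show "straight_cost ?init \<le> 15" by simp
      fix R2 A2 assume 2: "R2 = ?R \<and> A2 = A1"
      show "hr (While (Reg 17) (Seq search_scan search_pop)) R2 A2 ((N + 1) * (N * 70 + 80) + 15)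
        (searched R A)"
      proof (rule hr_While[where J = Inv and \<mu> = \<mu> and T = "N * 70 + 70"])
        have "bfs N (okA A) (A 2) ?b (A1 3) (A1 4) (A1 5) 0 0" using 1 by (auto simp: bfs_def)
        then have "Run ?R A1" using base[of R1 A1] 1 unfolding Run_def search_at_def by (simp add: source_def)
        then show "Inv R2 A2" using 1 2 unfolding Inv_def by (simp add: base_def)
      next
        fix R' A' assume "Inv R' A'" "ev (Reg 17) R' A' \<noteq> 0"
        then show "hr (Seq search_scan search_pop) R' A' (N * 70 + 70) (\<lambda>R'' A''. Inv R'' A'' \<and> \<mu> R'' A'' < \<mu> R' A')"
          using step by simp
      next
        fix R' A' assume "Inv R' A'" "ev (Reg 17) R' A' = 0"
        then show "searched R A R' A'"
          unfolding searched_def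
          by (simp add: Inv_def base_def)
      next
        have "\<mu> R2 A2 = N + 1" using 2 unfolding \<mu>_def by simp
        moreover have "(N + 1) * (N * 70 + 70 + 1 + exp_cost (Reg 17)) \<le> (N + 1) * (N * 70 + 80)"
          by (rule mult_left_mono) auto
        ultimately show "\<mu> R2 A2 * (N * 70 + 70 + 1 + exp_cost (Reg 17)) + 1 + exp_cost (Reg 17)
          \<le> (N + 1) * (N * 70 + 80) + 15" by simp
      qed
    qed simp
  qed simp
qed

definition augmented :: "regs \<Rightarrow> arrays \<Rightarrow> regs \<Rightarrow> arrays \<Rightarrow> bool" where
  "augmented R A R' A' \<longleftrightarrow> same {9, 12} R R' \<and> same {2} A A' \<and>
    pmatch N (okA A) (A' 2) \<and> msize N (A' 2) = Suc (msize N (A 2)) \<and> (\<exists>a<N. A' 2 a = Suc (R 7)) \<and>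
    (\<forall>a<N. A 2 a \<noteq> 0 \<longrightarrow> (\<exists>a'<N. A' 2 a' = A 2 a))"

lemma augment_correct:
  assumes b: "R 7 < N" and m: "pmatch N (okA A) (A 2)" and free: "\<forall>a<N. A 2 a \<noteq> Suc (R 7)"
    and res: "search_result (R 7) (R 16) A" and found: "R 16 \<noteq> 0"
  shows "hr augment R A (N * 60 + 80) (augmented R A)"
proof -
  let ?body = "Seq (Assign 9 (Op Minus (Mem (Cell 4 (Reg 12))) (Const 1)))
    (Seq (Store (Cell 2 (Reg 12)) (Mem (Cell 2 (Reg 9)))) (Assign 12 (Reg 9)))"
  let ?last = "Store (Cell 2 (Reg 12)) (Op Plus (Reg 7) (Const 1))"
  let ?b = "R 7" and ?m = "A 2" and ?Q = "A 5" and ?prev = "A 4"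
  obtain h t j0 where bfs: "bfs N (okA A) ?m ?b (A 3) ?prev ?Q h t" and j0: "j0 < t" "R 16 = Suc (?Q j0)" "?m (?Q j0) = 0"
    using res found unfolding search_result_def by auto
  let ?a0 = "?Q j0"
  have QN: "?Q j < N" if "j < t" for j using bfs that unfolding bfs_def by (auto simp: image_subset_iff)
  have Qinj: "inj_on ?Q {..<t}" using bfs unfolding bfs_def by blast
  have inv_j: "inv_into {..<t} ?Q (?Q j) = j" if "j < t" for j
    using inv_into_f_f[OF Qinj, of j] that by simp
  have prevN: "?prev (?Q j) \<le> N" if "j < t" for j
  proof -
    have "?prev (?Q j) = 0 \<or> (\<exists>i<j. ?prev (?Q j) = Suc (?Q i))"
      using bfs that unfolding bfs_def by blast
    then show ?thesis using QN that by (auto simp: Suc_le_eq)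
  qed
  define Inv where "Inv R' A' \<longleftrightarrow> same {9, 12} R R' \<and> same {2} A A' \<and>
    (\<exists>j<t. R' 12 = ?Q j \<and> augment_inv N (okA A) ?m ?b ?Q t ?a0 j (A' 2))" for R' A'
  \<comment> \<open>The queue position of the agent in need of an object; it shrinks because
    predecessors stand earlier.\<close>
  define \<mu> where "\<mu> R' A' = inv_into {..<t} ?Q (R' 12)"
    for R' :: regs and A' :: arrays
  show ?thesis
    unfolding augment_def
  proof (rule hr_Seq, rule hr_straight)
    have "R 16 < 2 ^ w" using j0 QN[OF j0(1)] N_word by linarith
    then show "hwp (Assign 12 (Op Minus (Reg 16) (Const 1))) (\<lambda>R' A'. R' = R(12 := ?a0) \<and> A' = A) R A"
      using j0 by simp
    show "straight_cost (Assign 12 (Op Minus (Reg 16) (Const 1))) \<le> 4" by simp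
  next
    fix R1 A1 assume 1: "R1 = R(12 := ?a0) \<and> A1 = A"
    show "hr (Seq (While (Mem (Cell 4 (Reg 12))) ?body)
      ?last) R1 A1 (N * 60 + 74) (augmented R A)"
    proof (rule hr_Seq)
      show "hr (While (Mem (Cell 4 (Reg 12))) ?body) R1 A1 (N * 60 + 30)
        (\<lambda>R' A'. Inv R' A' \<and> ?prev (R' 12) = 0)"
      proof (rule hr_While[where J = Inv and \<mu> = \<mu> and T = 45])
        show "Inv R1 A1" unfolding Inv_def using 1 j0 augment_inv_init[where Q = ?Q and j = j0, OF m free j0(1,3)] by auto
      next
        fix R' A' assume J: "Inv R' A'" and ev: "ev (Mem (Cell 4 (Reg 12))) R' A' \<noteq> 0"
        obtain j where j: "j < t" "R' 12 = ?Q j" "augment_inv N (okA A) ?m ?b ?Q t ?a0 j (A' 2)"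
          using J unfolding Inv_def by blast
        have A': "A' 4 = ?prev" using J unfolding Inv_def same_def by simp
        have jN: "?Q j < N * N * N" using QN[OF j(1)] index1 by blast
        have p0: "?prev (?Q j) \<noteq> 0" using ev jN j(2) A' by simp
        obtain i where i: "i < j" "?prev (?Q j) = Suc (?Q i)"
          "augment_inv N (okA A) ?m ?b ?Q t ?a0 i ((A' 2)(?Q j := A' 2 (?Q i)))"
          using augment_inv_step[where Q = ?Q and j = j and m' = "A' 2", OF bfs j(3) p0] by blast
        have iN: "?Q i < N * N * N" using QN[of i] i j index1 by simp
        have w: "Suc (?Q i) < 2 ^ w" "?Q i < 2 ^ w"
        proof -
          have "?Q i < N" using QN[of i] i j by simp
          then show "Suc (?Q i) < 2 ^ w" "?Q i < 2 ^ w" using N_word by linarith+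
        qed
        let ?R = "R'(9 := ?Q i, 12 := ?Q i)" and ?A = "A'(2 := (A' 2)(?Q j := A' 2 (?Q i)))"
        have goal: "Inv ?R ?A \<and> \<mu> ?R ?A < \<mu> R' A'"
        proof
          show "Inv ?R ?A" using J i j unfolding Inv_def by (auto intro!: exI[of _ i])
          show "\<mu> ?R ?A < \<mu> R' A'" using inv_j[of i] inv_j[of j] i j unfolding \<mu>_def by simp
        qed
        show "hr ?body R' A' 45
          (\<lambda>R'' A''. Inv R'' A'' \<and> \<mu> R'' A'' < \<mu> R' A')"
        proof (rule hr_straight)
          show "hwp ?body
          (\<lambda>R'' A''. Inv R'' A'' \<and> \<mu> R'' A'' < \<mu> R' A') R' A'"
            using goal iN jN w i(2) j(2) A' by simp
        qed (simp add: Cell_def)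
      next
        fix R' A' assume J: "Inv R' A'" and ev: "ev (Mem (Cell 4 (Reg 12))) R' A' = 0"
        then obtain j where "j < t" "R' 12 = ?Q j" unfolding Inv_def by blast
        then have "R' 12 < N * N * N" using QN index1 by simp
        moreover have "A' 4 = ?prev" using J unfolding Inv_def same_def by simp
        ultimately show "Inv R' A' \<and> ?prev (R' 12) = 0" using ev J by simp
      next
        have "\<mu> R1 A1 = j0" using 1 inv_j[OF j0(1)] unfolding \<mu>_def by simp
        then have "\<mu> R1 A1 \<le> N" using bfs_t[OF bfs] j0 by simp
        then have "\<mu> R1 A1 * (45 + 1 + exp_cost (Mem (Cell 4 (Reg 12)))) \<le> N * 60"
          by (rule mult_mono) (auto simp: Cell_def)
        then show "\<mu> R1 A1 * (45 + 1 + exp_cost (Mem (Cell 4 (Reg 12)))) + 1 + exp_cost (Mem (Cell 4 (Reg 12))) \<le> N * 60 + 30"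
          by (simp add: Cell_def)
      qed
    next
      fix R' A' assume 2: "Inv R' A' \<and> ?prev (R' 12) = 0"
      then obtain j where j: "j < t" "R' 12 = ?Q j" "augment_inv N (okA A) ?m ?b ?Q t ?a0 j (A' 2)" "?prev (?Q j) = 0"
        unfolding Inv_def by auto
      have same: "same {9, 12} R R'" "same {2} A A'" using 2 unfolding Inv_def by auto
      have R7: "R' 7 = ?b" using same(1) unfolding same_def by simp
      have jN: "?Q j < N * N * N" using QN[OF j(1)] index1 by blast
      have w: "Suc ?b < 2 ^ w" using b N_word by linarith
      note fin = augment_inv_final[where Q = ?Q and j = j and m' = "A' 2" and ?a0.0 = ?a0, OF bfs j(3,4) QN[OF j0(1)] j0(3) b]
      show "hr ?last R' A' 40 (augmented R A)"
      proof (rule hr_straight)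
        show "hwp ?last (augmented R A) R' A'"
          using same R7 jN w j(2) fin by (simp del: fun_upd_apply add: fun_upd_same augmented_def)
      qed (simp add: Cell_def)
    qed simp
  qed simp
qed

end

section \<open>Price reductions\<close>

definition free_test :: cmd where
  "free_test = Seq (Assign 18 (Const 1)) (For 6
    (If (Op Equal (Mem (Cell 2 (Reg 6))) (Op Plus (Reg 7) (Const 1))) (Assign 18 (Const 0)) Skip))"

text \<open>The value \<open>N + 1\<close> in register 7 leaves the sweep over the objects and marks
  it as interrupted, while a completed sweep ends with \<open>N\<close>.\<close>

definition cut :: cmd where
  "cut = Seq (Store (Cell 0 (Reg 7)) (Op Minus (Mem (Cell 0 (Reg 7))) (Const 1)))
    (Seq refresh (Assign 7 (Op Plus (Reg 1) (Const 1))))"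

definition next_object :: cmd where
  "next_object = Assign 7 (Op Plus (Reg 7) (Const 1))"

definition improve_step :: cmd where
  "improve_step = Seq free_test (If (Reg 18)
    (Seq search (If (Reg 16) (Seq augment next_object) cut)) next_object)"

definition improve :: cmd where
  "improve = Seq (Assign 7 (Const 0)) (While (Op Less (Reg 7) (Reg 1)) improve_step)"

definition solve :: cmd where
  "solve = Seq (Assign 7 (Op Plus (Reg 1) (Const 1)))
    (While (Op Equal (Op Equal (Reg 7) (Reg 1)) (Const 0)) (Seq auction improve))"

lemma pmatch_cong:
  assumes "\<forall>a<N. \<forall>b<N. E a b = E' a b"
  shows "pmatch N E m = pmatch N E' m"
proof -
  have "E a (m a - 1) = E' a (m a - 1)" if "a < N" "m a \<noteq> 0" "m a \<le> N" for a
    using assms that by auto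
  then show ?thesis unfolding pmatch_def by blast
qed

text \<open>Counting: as many agents as objects, so covering all objects forces a bijection.\<close>

lemma perfect_bij:
  assumes m: "pmatch N E m" and all: "\<forall>b<N. \<exists>a<N. m a = Suc b"
  shows "bij_betw (\<lambda>a. m a - 1) {..<N} {..<N}" "\<forall>a<N. m a \<noteq> 0"
proof -
  have sub: "{..<N} \<subseteq> (\<lambda>a. m a - 1) ` {..<N}"
  proof
    fix b assume "b \<in> {..<N}"
    then obtain a where "a < N" "m a = Suc b" using all by auto
    then show "b \<in> (\<lambda>a. m a - 1) ` {..<N}" by (intro image_eqI[of _ _ a]) auto
  qed
  have "card ((\<lambda>a. m a - 1) ` {..<N}) \<le> N" using card_image_le[of "{..<N}" "\<lambda>a. m a - 1"] by simp
  then have im: "(\<lambda>a. m a - 1) ` {..<N} = {..<N}"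
    using card_subset_eq[OF _ sub] card_mono[OF _ sub] by simp
  then have inj: "inj_on (\<lambda>a. m a - 1) {..<N}"
    by (intro eq_card_imp_inj_on) auto
  show "bij_betw (\<lambda>a. m a - 1) {..<N} {..<N}" using im inj unfolding bij_betw_def by simp
  show "\<forall>a<N. m a \<noteq> 0"
  proof (intro allI impI notI)
    fix a assume a: "a < N" "m a = 0"
    \<comment> \<open>By truncated subtraction an unmatched agent and the holder of object 0 both
      have value 0, so injectivity would identify them.\<close>
    then obtain a' where a': "a' < N" "m a' = Suc 0" using all by (metis gr_implies_not0 neq0_conv)
    have "a = a'" using inj_onD[OF inj, of a a'] a a' by simp
    then show False using a a' by simp
  qed
qed

context ram
begin

text \<open>\<open>z'\<close> and \<open>\<sigma>\<close> are the fixed equilibrium of the analysis.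
  \<open>W\<close> pins down the comparison table, so that the final prices are known to refer to
  the original instance.\<close>

definition good :: "vec \<Rightarrow> vec \<Rightarrow> vec \<Rightarrow> arrays \<Rightarrow> bool" where
  "good W z' \<sigma> A \<longleftrightarrow> wf A \<and> A 7 = W \<and> (\<forall>a<N. \<forall>b<N. okA A a b = demandA A a b) \<and>
    equilibrium N (wt A) z' \<sigma> \<and> (\<forall>b<N. z' b \<le> A 0 b)"

lemma wt_cong: "A' 7 = A 7 \<Longrightarrow> wt A' = wt A"
  by (simp add: wt_def fun_eq_iff)

lemma demandA_cong: "A' 0 = A 0 \<Longrightarrow> A' 7 = A 7 \<Longrightarrow> demandA A' = demandA A"
  using wt_cong[of A' A] by (simp add: demandA_def)

lemma good_cong:
  assumes "A' 0 = A 0" "A' 6 = A 6" "A' 7 = A 7"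
  shows "good W z' \<sigma> A' = good W z' \<sigma> A"
  using wt_cong[of A' A, OF assms(3)] demandA_cong[of A' A, OF assms(1,3)] okA_cong[of A' A, OF assms(2)] assms
  by (simp add: good_def wf_def)

lemma free_test_correct:
  assumes b: "R 7 < N"
  shows "hr free_test R A (N * 30 + 10) (\<lambda>R' A'. same {6, 18} R R' \<and> A' = A \<and>
    (R' 18 \<noteq> 0 \<longleftrightarrow> (\<forall>a<N. A 2 a \<noteq> Suc (R 7))))"
proof -
  let ?body = "If (Op Equal (Mem (Cell 2 (Reg 6))) (Op Plus (Reg 7) (Const 1))) (Assign 18 (Const 0)) Skip"
  define J where "J i R' A' \<longleftrightarrow> same {6, 18} R R' \<and> A' = A \<and> (R' 18 \<noteq> 0 \<longleftrightarrow> (\<forall>a<i. A 2 a \<noteq> Suc (R 7)))"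
    for i R' A'
  have "hr free_test R A (N * 30 + 10) (J N)"
    unfolding free_test_def
  proof (rule hr_Seq)
    show "hr (Assign 18 (Const 1)) R A 2 (J 0)" by (rule hr_straight) (auto simp: J_def)
  next
    fix R' A' assume "J 0 R' A'"
    then show "hr (For 6
     ?body) R' A' (N * 30 + 8) (J N)"
    proof (intro hr_For[where J = J and T = 22])
      fix R1 A1 assume i: "R1 6 < N" and J: "J (R1 6) R1 A1"
      have R7: "R1 7 = R 7" and A1: "A1 = A" using J unfolding J_def same_def by auto
      have w: "Suc (R 7) < 2 ^ w" using b N_word by linarith
      have e: "ev (Op Equal (Mem (Cell 2 (Reg 6))) (Op Plus (Reg 7) (Const 1))) R1 A1 = of_bool (A 2 (R1 6) = Suc (R 7))"
        using i w R7 A1 by (simp add: index1)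
      have "hwp ?body
        (counted 6 (R1 6) J) R1 A1"
        using J unfolding hwp.simps(5) e by (auto simp: J_def less_Suc_eq)
      then show "hr ?body R1 A1 22
        (counted 6 (R1 6) J)"
        by (rule hr_straight) (simp add: Cell_def)
    qed (auto simp: J_def)
  qed simp
  then show ?thesis by (rule hr_mono) (auto simp: J_def)
qed

text \<open>A failed search supplies the closed set of matched agents that \<open>overpriced\<close>
  asks for.\<close>

lemma search_failed:
  assumes good: "good W z' \<sigma> A" and m: "pmatch N (okA A) (A 2)" and b: "b < N"
    and free: "\<forall>a<N. A 2 a \<noteq> Suc b" and res: "search_result b 0 A"
  shows "z' b < A 0 b"
proof -
  obtain h t where bfs: "bfs N (okA A) (A 2) b (A 3) (A 4) (A 5) h t" and ht: "h = t"
    and cl: "\<forall>k\<le>t. \<forall>a<N. okA A a (source (A 2) b (A 5) k) \<longrightarrow> A 3 a \<noteq> 0"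
    using res unfolding search_result_def by auto
  have ok: "\<forall>a<N. \<forall>b<N. okA A a b = demand N (wt A) (A 0) a b"
    using good by (simp add: good_def demandA_def)
  define V where "V = A 5 ` {..<t}"
  have vis: "A 3 a \<noteq> 0 \<longleftrightarrow> a \<in> V" if "a < N" for a using bfs that unfolding bfs_def V_def by blast
  have VN: "V \<subseteq> {..<N}" and V0: "\<forall>a\<in>V. A 2 a \<noteq> 0" using bfs ht unfolding bfs_def V_def by auto
  show ?thesis
  proof (rule overpriced[where V = V and N = N and g = "wt A" and z = "A 0" and m = "A 2" and \<sigma> = \<sigma>])
    show "equilibrium N (wt A) z' \<sigma>" "\<forall>b<N. z' b \<le> A 0 b" using good by (auto simp: good_def)
    show "pmatch N (demand N (wt A) (A 0)) (A 2)" using m pmatch_cong[OF ok] by blast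
    show "\<forall>a<N. demand N (wt A) (A 0) a b \<longrightarrow> a \<in> V"
    proof (intro allI impI)
      fix a assume a: "a < N" "demand N (wt A) (A 0) a b"
      then have "okA A a (source (A 2) b (A 5) 0)" using ok b by (simp add: source_def)
      then show "a \<in> V" using cl vis a by blast
    qed
    show "\<forall>v\<in>V. \<forall>a<N. demand N (wt A) (A 0) a (A 2 v - 1) \<longrightarrow> a \<in> V"
    proof (intro ballI allI impI)
      fix v a assume v: "v \<in> V" and a: "a < N" "demand N (wt A) (A 0) a (A 2 v - 1)"
      obtain i where i: "i < t" "v = A 5 i" using v unfolding V_def by auto
      have "A 2 v \<noteq> 0" "A 2 v \<le> N" using V0 VN v m unfolding pmatch_def by auto
      then have "okA A a (A 2 v - 1)" using ok a by auto
      \<comment> \<open>The object held by the agent at queue position \<open>i\<close> was expanded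
        as number \<open>Suc i\<close>.\<close>
      then have "okA A a (source (A 2) b (A 5) (Suc i))" using i by (simp add: source_def)
      moreover have "Suc i \<le> t" using i by simp
      ultimately show "a \<in> V" using cl vis a by blast
    qed
  qed (use b free VN V0 in auto)
qed

definition lowered :: "vec \<Rightarrow> vec \<Rightarrow> vec \<Rightarrow> arrays \<Rightarrow> regs \<Rightarrow> arrays \<Rightarrow> bool" where
  "lowered W z' \<sigma> A R' A' \<longleftrightarrow> good W z' \<sigma> A' \<and> R' 7 = Suc N \<and> sum (A' 0) {..<N} < sum (A 0) {..<N}"

lemma cut_correct:
  assumes good: "good W z' \<sigma> A" and b: "R 7 < N" and z: "z' (R 7) < A 0 (R 7)"
  shows "hr cut R A (N * (N * 200 + 50) + 90) (lowered W z' \<sigma> A)"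
proof -
  let ?b = "R 7"
  let ?A = "A(0 := (A 0)(?b := A 0 ?b - 1))"
  have wf: "wf A" using good by (simp add: good_def)
  have wt1: "wt ?A = wt A" by (rule wt_cong) simp
  have zK: "\<forall>b<N. A 0 b \<le> K" using wf by (simp add: wf_def)
  have "\<forall>b<N. ((A 0)(?b := A 0 ?b - 1)) b \<le> K" using zK by (auto intro: le_trans[OF diff_le_self])
  then have wf1: "wf ?A" using wf wt1 by (simp add: wf_def)
  have less: "sum (?A 0) {..<N} < sum (A 0) {..<N}"
    by (rule sum_strict_mono_ex1) (use b z in \<open>auto intro!: bexI[of _ ?b]\<close>)
  show ?thesis
    unfolding cut_def
  proof (rule hr_Seq)
    have "A 0 ?b \<le> K" using zK b by blast
    then have "A 0 ?b - 1 < 2 ^ w" using K_N N_word by linarith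
    then show "hr (Store (Cell 0 (Reg 7)) (Op Minus (Mem (Cell 0 (Reg 7))) (Const 1))) R A 25 (\<lambda>R' A'. R' = R \<and> A' = ?A)"
      by (intro hr_straight) (use b in \<open>simp_all add: index1\<close>, simp add: Cell_def)
  next
    fix R1 A1 assume 1: "R1 = R \<and> A1 = ?A"
    show "hr (Seq refresh (Assign 7 (Op Plus (Reg 1) (Const 1)))) R1 A1 (N * (N * 200 + 50) + 65)
      (lowered W z' \<sigma> A)"
      unfolding conjunct1[OF 1] conjunct2[OF 1]
    proof (rule hr_Seq[OF refresh_correct[where R = R and A = ?A, OF wf1 b]])
      fix R2 A2 assume "refreshed R ?A R2 A2"
      note 2 = this[unfolded refreshed_def]
      have A2: "A2 0 = ?A 0" "A2 7 = ?A 7" using 2 unfolding same_def by auto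
      have dem2: "demandA A2 = demandA ?A" using demandA_cong A2 by blast
      have ok: "okA A2 a y = demandA A2 a y" if ay: "a < N" "y < N" for a y
      proof (cases "y = ?b")
        case True
        then show ?thesis using 2 ay dem2 by (simp add: okA_def)
      next
        case False
        have same: "badA ?A a b' y = badA A a b' y" if "b' \<noteq> ?b" for b'
          using that False wt1 by (simp add: badA_def bad_def)
        \<comment> \<open>Only comparisons with the cheaper object change, and where that object was
          already better it remains so. Hence one new test per entry replaces a full
          recomputation.\<close>
        have mono: "badA A a ?b y \<Longrightarrow> badA ?A a ?b y"
          using False wt1 by (simp add: badA_def bad_def)
        have d: "demandA A' a y \<longleftrightarrow> (\<forall>b'<N. \<not> badA A' a b' y)" for A' by (simp add: demandA_def demand_def badA_def)
        have "okA A2 a y \<longleftrightarrow> okA A a y \<and> \<not> badA ?A a ?b y"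
          using 2 ay False by (simp add: okA_def)
        also have "okA A a y \<longleftrightarrow> demandA A a y" using good ay by (simp add: good_def)
        also have "demandA A a y \<and> \<not> badA ?A a ?b y \<longleftrightarrow> demandA ?A a y"
          unfolding d using same mono b by metis
        finally show ?thesis using dem2 by simp
      qed
      have "wt A2 = wt A" using wt_cong[of A2 ?A, OF A2(2)] wt1 by simp
      moreover have "\<forall>b<N. z' b \<le> A2 0 b" using good z unfolding A2 good_def by auto
      ultimately have "good W z' \<sigma> A2" using good 2 ok A2 by (simp add: good_def)
      moreover have "Suc N < 2 ^ w" using N_word by linarith
      ultimately show "hr (Assign 7 (Op Plus (Reg 1) (Const 1))) R2 A2 5
        (lowered W z' \<sigma> A)"
        by (intro hr_straight) (use less in \<open>simp_all add: A2 cst_def lowered_def\<close>)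
    qed simp
  qed simp
qed

definition extended :: "regs \<Rightarrow> arrays \<Rightarrow> regs \<Rightarrow> arrays \<Rightarrow> bool" where
  "extended R A R' A' \<longleftrightarrow> R' 7 = Suc (R 7) \<and> same {2, 3, 4, 5} A A' \<and> pmatch N (okA A) (A' 2) \<and>
    msize N (A' 2) = Suc (msize N (A 2)) \<and> (\<forall>b<Suc (R 7). \<exists>a<N. A' 2 a = Suc b)"

text \<open>The two time bounds are kept apart for the amortization: passing a matched object costs
  only a linear scan, whereas at most \<open>cap + 1\<close> objects of a round need a
  search.\<close>

lemma improve_step_correct:
  fixes M0 :: nat
  assumes good: "good W z' \<sigma> A" and b: "R 7 < N" and m: "pmatch N (okA A) (A 2)"
    and earlier: "\<forall>b<R 7. \<exists>a<N. A 2 a = Suc b"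
  shows "hr improve_step R A (N * 30 + 40) (\<lambda>R' A'. R' 7 = Suc (R 7) \<and> A' = A \<and> (\<exists>a<N. A 2 a = Suc (R 7))) \<or>
    hr improve_step R A (600 * (N * N)) (\<lambda>R' A'. extended R A R' A' \<or> lowered W z' \<sigma> A R' A')"
    (is "hr _ _ _ _ ?P \<or> hr _ _ _ _ ?Q")
proof (cases "\<forall>a<N. A 2 a \<noteq> Suc (R 7)")
  case False
  have "hr improve_step R A (N * 30 + 40) ?P"
    unfolding improve_step_def
  proof (rule hr_Seq[OF free_test_correct[where R = R and A = A, OF b], where ?T2.0 = 20])
    fix R1 A1 assume 1: "same {6, 18} R R1 \<and> A1 = A \<and> (R1 18 \<noteq> 0 \<longleftrightarrow> (\<forall>a<N. A 2 a \<noteq> Suc (R 7)))"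
    have R7: "R1 7 = R 7" using 1 unfolding same_def by simp
    have w: "Suc (R 7) < 2 ^ w" using b N_word by linarith
    show "hr (If (Reg 18) (Seq search (If (Reg 16) (Seq augment next_object) cut)) next_object) R1 A1 20
      ?P"
    proof (rule hr_If)
      show "hr next_object R1 A1 10 ?P"
        unfolding next_object_def by (rule hr_straight) (use 1 False R7 w in auto)
    qed (use 1 False in auto)
  qed simp
  then show ?thesis ..
next
  case free: True
  have wf: "wf A" using good by (simp add: good_def)
  have w: "Suc (R 7) < 2 ^ w" using b N_word by linarith
  have "hr improve_step R A (600 * (N * N)) ?Q"
    unfolding improve_step_def
  proof (rule hr_Seq[OF free_test_correct[where R = R and A = A, OF b], where ?T2.0 = "570 * (N * N)"])
    fix R1 A1 assume 1: "same {6, 18} R R1 \<and> A1 = A \<and> (R1 18 \<noteq> 0 \<longleftrightarrow> (\<forall>a<N. A 2 a \<noteq> Suc (R 7)))"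
    have R7: "R1 7 = R 7" using 1 unfolding same_def by simp
    have A1: "A1 = A" using 1 by simp
    show "hr (If (Reg 18) (Seq search (If (Reg 16) (Seq augment next_object) cut)) next_object) R1 A1
      (570 * (N * N)) ?Q"
    proof (rule hr_If)
      have b1: "R1 7 < N" using b R7 by simp
      show "hr (Seq search (If (Reg 16) (Seq augment next_object) cut)) R1 A1 (560 * (N * N)) ?Q"
        unfolding A1
      proof (rule hr_Seq[OF search_correct[where R = R1 and A = A, OF wf b1 m], where ?T2.0 = "320 * (N * N)"])
        fix R2 A2 assume "searched R1 A R2 A2"
        note 2 = this[unfolded searched_def]
        have R27: "R2 7 = R 7" using 2 R7 unfolding same_def by simp
        have A2: "A2 0 = A 0" "A2 2 = A 2" "A2 6 = A 6" "A2 7 = A 7" using 2 unfolding same_def by simp_all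
        have ok2: "okA A2 = okA A" by (rule okA_cong) (rule A2)
        have res: "search_result (R 7) (R2 16) A2" using 2 R7 by simp
        show "hr (If (Reg 16) (Seq augment next_object) cut) R2 A2 (320 * (N * N)) ?Q"
        proof (rule hr_If)
          assume "ev (Reg 16) R2 A2 \<noteq> 0"
          then have found: "R2 16 \<noteq> 0" by simp
          have "hr augment R2 A2 (N * 60 + 80) (augmented R2 A2)"
            by (rule augment_correct) (use b m free res found in \<open>simp_all add: R27 A2 ok2\<close>)
          then show "hr (Seq augment next_object) R2 A2 (310 * (N * N)) ?Q"
          proof (rule hr_Seq)
            fix R3 A3 assume "augmented R2 A2 R3 A3"
            note 3 = this[unfolded augmented_def]
            have R37: "R3 7 = R 7" using 3 R27 unfolding same_def by simp
            have "same {2, 3, 4, 5} A A3" using 2 3 unfolding same_def by simp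
            moreover have "\<exists>a<N. A3 2 a = Suc b'" if "b' < Suc (R 7)" for b'
            proof (cases "b' = R 7")
              case True
              then show ?thesis using 3 R27 by simp
            next
              case False
              then have "b' < R 7" using that by simp
              then obtain a where "a < N" "A 2 a = Suc b'" using earlier by blast
              then show ?thesis using 3 A2(2) by (metis nat.distinct(1))
            qed
            ultimately show "hr next_object R3 A3 10 ?Q"
              unfolding next_object_def extended_def by (intro hr_straight) (use 3 R37 w A2 ok2 in simp_all)
          qed (use N_square in linarith)
        next
          assume "ev (Reg 16) R2 A2 = 0"
          then have r0: "search_result (R 7) 0 A2" using res by simp
          have g2: "good W z' \<sigma> A2" using good_cong[of A2 A] A2 good by simp
          have z: "z' (R2 7) < A2 0 (R2 7)" unfolding R27
            by (rule search_failed[OF g2 _ b _ r0]) (use m free in \<open>simp_all add: A2 ok2\<close>)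
          have "hr cut R2 A2 (N * (N * 200 + 50) + 90) (lowered W z' \<sigma> A2)"
            by (rule cut_correct[where R = R2 and A = A2, OF g2 _ z]) (use b R27 in simp)
          moreover have "N * (N * 200 + 50) + 90 \<le> 310 * (N * N)"
          proof -
            have "N * (N * 200 + 50) + 90 = 200 * (N * N) + 50 * N + 90" by (simp add: algebra_simps)
            then show ?thesis using N_square by linarith
          qed
          ultimately show "hr cut R2 A2 (310 * (N * N)) ?Q"
            by (rule hr_mono) (simp add: A2 lowered_def)
        qed (simp only: exp_cost.simps, use N_square in linarith)
      next
        have "(N + 1) * (N * 70 + 80) + N * 30 + 40 = 70 * (N * N) + 180 * N + 120" by (simp add: algebra_simps)
        then show "(N + 1) * (N * 70 + 80) + N * 30 + 40 + 320 * (N * N) \<le> 560 * (N * N)" using N_square by linarith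
      qed
    next
      assume "ev (Reg 18) R1 A1 = 0"
      then show "hr next_object R1 A1 (560 * (N * N)) ?Q" using 1 free by simp
    qed (simp only: exp_cost.simps, use N_square in linarith)
  qed (use N_square in linarith)
  then show ?thesis ..
qed

definition solved :: "vec \<Rightarrow> vec \<Rightarrow> vec \<Rightarrow> arrays \<Rightarrow> bool" where
  "solved W z' \<sigma> A \<longleftrightarrow> good W z' \<sigma> A \<and> pmatch N (okA A) (A 2) \<and> (\<forall>b<N. \<exists>a<N. A 2 a = Suc b)"

lemma improve_correct:
  assumes good: "good W z' \<sigma> A" and m: "pmatch N (okA A) (A 2)"
    and max: "\<forall>m. pmatch N (okA A) m \<longrightarrow> msize N m \<le> msize N (A 2) + cap"
  shows "hr improve R A ((cap + 1) * (600 * (N * N) + 4) + N * (N * 30 + 44) + 10) (\<lambda>R' A'. R' 7 = N \<and> solved W z' \<sigma> A' \<and> A' 0 = A 0 \<or>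
    R' 7 = Suc N \<and> good W z' \<sigma> A' \<and> sum (A' 0) {..<N} < sum (A 0) {..<N})"
    (is "hr _ _ _ _ ?post")
proof -
  let ?e = "Op Less (Reg 7) (Reg 1)" and ?T = "600 * (N * N)"
  define Inv where "Inv R' A' \<longleftrightarrow> (if R' 7 \<le> N
    then same {2, 3, 4, 5} A A' \<and> pmatch N (okA A) (A' 2) \<and> msize N (A 2) \<le> msize N (A' 2) \<and>
    (\<forall>b<R' 7. \<exists>a<N. A' 2 a = Suc b)
    else R' 7 = Suc N \<and> good W z' \<sigma> A' \<and> sum (A' 0) {..<N} < sum (A 0) {..<N})"
    for R' :: regs and A'
  \<comment> \<open>The first summand pays for the augmentations that can still succeed and for one
    failing search, the second for passing the remaining objects. After a reduction the sweep is
    over and nothing is left to pay.\<close>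
  define \<Phi> where "\<Phi> R' A' = (if R' 7 > N then 0 else
    (msize N (A 2) + cap + 1 - msize N (A' 2)) * (600 * (N * N) + 4) + (N - R' 7) * (N * 30 + 44))"
    for R' :: regs and A' :: arrays
  have A_eq: "A' 0 = A 0" "okA A' = okA A" "good W z' \<sigma> A'" if "same {2, 3, 4, 5} A A'" for A'
  proof -
    have h: "A' 0 = A 0" "A' 6 = A 6" "A' 7 = A 7" using that unfolding same_def by simp_all
    show "A' 0 = A 0" "okA A' = okA A" "good W z' \<sigma> A'"
      using h okA_cong[of A' A] good_cong[of A' A] good by simp_all
  qed
  show ?thesis
    unfolding improve_def
  proof (rule hr_Seq)
    show "hr (Assign 7 (Const 0)) R A 2 (\<lambda>R' A'. R' = R(7 := 0) \<and> A' = A)" by (rule hr_straight) auto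
  next
    fix R1 A1 assume 1: "R1 = R(7 := 0) \<and> A1 = A"
    show "hr (While ?e improve_step) R1 A1
      ((cap + 1) * (600 * (N * N) + 4) + N * (N * 30 + 44) + 4) ?post"
    proof (rule hr_While_potential[where J = Inv and \<Phi> = \<Phi>])
      show "Inv R1 A1" using 1 m unfolding Inv_def by simp
    next
      fix R' A' assume J: "Inv R' A'" and "ev ?e R' A' \<noteq> 0"
      then have b: "R' 7 < N" by (simp add: cst_def split: if_splits)
      then have inv: "same {2, 3, 4, 5} A A'" "pmatch N (okA A) (A' 2)" "msize N (A 2) \<le> msize N (A' 2)"
        "\<forall>b<R' 7. \<exists>a<N. A' 2 a = Suc b"
        using J unfolding Inv_def by simp_all
      note eq = A_eq[OF inv(1)]
      have m': "pmatch N (okA A') (A' 2)" using inv(2) eq(2) by simp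
      have le: "msize N (A' 2) \<le> msize N (A 2) + cap" using max inv(2) by blast
      from improve_step_correct[where R = R' and A = A', OF eq(3) b m' inv(4)]
      show "\<exists>T. hr improve_step R' A' T (\<lambda>R'' A''. Inv R'' A'' \<and> \<Phi> R'' A'' + T + 1 + exp_cost ?e \<le> \<Phi> R' A')"
      proof
        assume h: "hr improve_step R' A' (N * 30 + 40) (\<lambda>R'' A''. R'' 7 = Suc (R' 7) \<and> A'' = A' \<and> (\<exists>a<N. A' 2 a = Suc (R' 7)))"
        show ?thesis
        proof (intro exI[of _ "N * 30 + 40"] hr_mono[OF h])
          fix R'' :: regs and A'' assume *: "R'' 7 = Suc (R' 7) \<and> A'' = A' \<and> (\<exists>a<N. A' 2 a = Suc (R' 7))"
          have "Inv R'' A''" using * inv b unfolding Inv_def by (simp add: less_Suc_eq)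
          moreover have "N - R' 7 = Suc (N - R'' 7)" using * b by simp
          then have "\<Phi> R'' A'' + (N * 30 + 44) = \<Phi> R' A'" using * b unfolding \<Phi>_def by simp
          ultimately show "Inv R'' A'' \<and> \<Phi> R'' A'' + (N * 30 + 40) + 1 + exp_cost ?e \<le> \<Phi> R' A'"
            by simp
        qed simp
      next
        assume h: "hr improve_step R' A' ?T (\<lambda>R'' A''. extended R' A' R'' A'' \<or> lowered W z' \<sigma> A' R'' A'')"
        show ?thesis
        proof (intro exI[of _ ?T] hr_mono[OF h])
          fix R'' :: regs and A'' assume "extended R' A' R'' A'' \<or> lowered W z' \<sigma> A' R'' A''"
          then show "Inv R'' A'' \<and> \<Phi> R'' A'' + ?T + 1 + exp_cost ?e \<le> \<Phi> R' A'"
          proof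
            assume "extended R' A' R'' A''"
            note * = this[unfolded extended_def]
            have "same {2, 3, 4, 5} A A''" using same_trans[OF inv(1)] * by blast
            then have "Inv R'' A''" using * inv b eq unfolding Inv_def by simp
            moreover have "msize N (A 2) + cap + 1 - msize N (A' 2) = Suc (msize N (A 2) + cap + 1 - msize N (A'' 2))"
              using * le by simp
            moreover have "N - R' 7 = Suc (N - R'' 7)" using * b by simp
            ultimately show ?thesis using * b unfolding \<Phi>_def by simp
          next
            assume "lowered W z' \<sigma> A' R'' A''"
            note * = this[unfolded lowered_def]
            have "Inv R'' A''" using * eq unfolding Inv_def by simp
            moreover obtain k where "msize N (A 2) + cap + 1 - msize N (A' 2) = Suc k"
              using le by (metis Suc_diff_le add.commute plus_1_eq_Suc)
            ultimately show ?thesis using * b unfolding \<Phi>_def by simp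
          qed
        qed simp
      qed
    next
      fix R' A' assume J: "Inv R' A'" and ev: "ev ?e R' A' = 0"
      then have "N \<le> R' 7" by (simp add: cst_def split: if_splits)
      show "?post R' A'"
      proof (cases "R' 7 = N")
        case True
        then have "same {2, 3, 4, 5} A A'" "pmatch N (okA A) (A' 2)" "\<forall>b<N. \<exists>a<N. A' 2 a = Suc b"
          using J unfolding Inv_def by simp_all
        then show ?thesis using A_eq[of A'] True unfolding solved_def by simp
      next
        case False
        then show ?thesis using J \<open>N \<le> R' 7\<close> unfolding Inv_def by simp
      qed
    qed (use 1 in \<open>simp add: \<Phi>_def\<close>)
  qed simp
qed

lemma solve_correct:
  assumes good: "good W z' \<sigma> A"
  shows "hr solve R A ((N * K + 1) * (2000 * (cap * (N * N))) + 20) (\<lambda>R' A'. solved W z' \<sigma> A')"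
  unfolding solve_def
proof (rule hr_Seq)
  have "Suc N < 2 ^ w" using N_word by linarith
  then show "hr (Assign 7 (Op Plus (Reg 1) (Const 1))) R A 5 (\<lambda>R' A'. R' = R(7 := Suc N) \<and> A' = A)"
    by (intro hr_straight) (simp_all add: cst_def)
next
  fix R1 A1 assume 1: "R1 = R(7 := Suc N) \<and> A1 = A"
  let ?e = "Op Equal (Op Equal (Reg 7) (Reg 1)) (Const 0)" and ?T = "1990 * (cap * (N * N))"
  define Inv where "Inv R' A' \<longleftrightarrow> good W z' \<sigma> A' \<and> (R' 7 = N \<longrightarrow> solved W z' \<sigma> A')"
    for R' :: regs and A'
  \<comment> \<open>An interrupted round lowers the sum of prices; the extra 1 pays for the round
    that completes.\<close>
  define \<mu> where "\<mu> R' A' = sum (A' 0) {..<N} + (if R' 7 = N then 0 else 1)"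
    for R' :: regs and A' :: arrays
  \<comment> \<open>A cap of at least 2 lets terms of order \<open>N * N\<close> be absorbed into
    \<open>cap * (N * N)\<close>.\<close>
  have cap2: "2 \<le> cap"
  proof (rule ccontr)
    assume "\<not> 2 \<le> cap"
    then have "cap * cap \<le> 1 * 1" by (intro mult_le_mono) auto
    then show False using N_cap N2 by simp
  qed
  have cNN: "2 * (N * N) \<le> cap * (N * N)" "2 * (cap * N) \<le> cap * (N * N)"
    using cap2 mult_le_mono2[OF N_square(1), of cap] by (auto simp: algebra_simps)
  have T: "((N * cap + 2 * N + 1) * (N * 60 + 100) + N * 40 + 100) +
    ((cap + 1) * (600 * (N * N) + 4) + N * (N * 30 + 44) + 10) \<le> ?T"
  proof -
    have "((N * cap + 2 * N + 1) * (N * 60 + 100) + N * 40 + 100) +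
      ((cap + 1) * (600 * (N * N) + 4) + N * (N * 30 + 44) + 10) =
      660 * (cap * (N * N)) + 100 * (cap * N) + 4 * cap + 750 * (N * N) + 344 * N + 214"
      by (simp add: algebra_simps)
    moreover have "cap \<le> cap * N" using N2 by simp
    ultimately show ?thesis using N_square cNN by linarith
  qed
  show "hr (While ?e (Seq auction improve)) R1 A1
    ((N * K + 1) * (2000 * (cap * (N * N))) + 15) (\<lambda>R' A'. solved W z' \<sigma> A')"
  proof (rule hr_While[where J = Inv and \<mu> = \<mu> and T = ?T])
    show "Inv R1 A1" using 1 good unfolding Inv_def by simp
  next
    fix R' A' assume J: "Inv R' A'" and "ev ?e R' A' \<noteq> 0"
    then have b: "R' 7 \<noteq> N" by (simp add: cst_def split: if_splits)
    have good': "good W z' \<sigma> A'" using J unfolding Inv_def by blast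
    then have wf': "wf A'" by (simp add: good_def)
    show "hr (Seq auction improve) R' A' ?T (\<lambda>R'' A''. Inv R'' A'' \<and> \<mu> R'' A'' < \<mu> R' A')"
    proof (rule hr_Seq[OF auction_correct[where R = R' and A = A', OF wf']])
      fix R2 A2 assume "auctioned R' A' R2 A2"
      note 2 = this[unfolded auctioned_def]
      have h: "A2 0 = A' 0" "A2 6 = A' 6" "A2 7 = A' 7" using 2 unfolding same_def by simp_all
      have ok: "okA A2 = okA A'" using okA_cong[of A2 A'] h by simp
      have g2: "good W z' \<sigma> A2" using good_cong[of A2 A'] h good' by simp
      show "hr improve R2 A2 ((cap + 1) * (600 * (N * N) + 4) + N * (N * 30 + 44) + 10)
        (\<lambda>R'' A''. Inv R'' A'' \<and> \<mu> R'' A'' < \<mu> R' A')"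
      proof (rule hr_mono[OF improve_correct[where R = R2 and A = A2, OF g2]])
        fix R3 :: regs and A3 assume 3: "R3 7 = N \<and> solved W z' \<sigma> A3 \<and> A3 0 = A2 0 \<or>
          R3 7 = Suc N \<and> good W z' \<sigma> A3 \<and> sum (A3 0) {..<N} < sum (A2 0) {..<N}"
        then show "Inv R3 A3 \<and> \<mu> R3 A3 < \<mu> R' A'"
          using b h unfolding Inv_def \<mu>_def by (auto simp: solved_def)
      qed (use 2 ok in auto)
    qed (use T in simp)
  next
    fix R' A' assume J: "Inv R' A'" and "ev ?e R' A' = 0"
    then have b: "R' 7 = N" by (simp add: cst_def split: if_splits)
    then show "solved W z' \<sigma> A'" using J unfolding Inv_def by blast
  next
    have "sum (A 0) {..<N} \<le> N * K"
      using sum_bounded_above[of "{..<N}" "A 0" K] good by (simp add: good_def wf_def)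
    then have "\<mu> R1 A1 \<le> N * K + 1" using 1 unfolding \<mu>_def by simp
    then have "\<mu> R1 A1 * (?T + 1 + exp_cost ?e) \<le>
      (N * K + 1) * (2000 * (cap * (N * N)))"
      by (rule mult_le_mono) (simp only: exp_cost.simps, use N_square cNN in linarith)
    then show "\<mu> R1 A1 * (?T + 1 + exp_cost ?e) +
      1 + exp_cost ?e \<le> (N * K + 1) * (2000 * (cap * (N * N))) + 15"
      by simp
  qed
qed simp

end

section \<open>Reading the instance\<close>

definition edge_test :: "nat \<Rightarrow> nat \<Rightarrow> cmd" where
  "edge_test r x = If (Op Less (Reg x) (Reg 5))
    (Assign r (Mem (Op Plus (Const 3) (Op Plus (Op Times (Reg 6) (Reg 5)) (Reg x)))))
    (Assign r (Op Equal (Reg x) (Op Plus (Reg 5) (Reg 6))))"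

definition pref_exp :: exp where
  "pref_exp = Mem (Op Plus (Op Plus (Const 3) (Op Times (Reg 4) (Reg 5)))
    (Op Plus (Op Times (Op Plus (Op Times (Reg 6) (Reg 5)) (Reg 7)) (Reg 5)) (Reg 8)))"

definition gain_cmd :: cmd where
  "gain_cmd = If (Op Less (Reg 6) (Reg 4))
    (Seq (edge_test 9 7) (Seq (edge_test 10 8)
    (If (Reg 9)
    (If (Reg 10)
    (If (Op Less (Reg 7) (Reg 5))
    (If (Op Less (Reg 8) (Reg 5)) (Assign 11 pref_exp) (Assign 11 (Reg 2)))
    (Assign 11 (Const 0)))
    (Assign 11 (Op Plus (Reg 2) (Const 1))))
    (Assign 11 (Const 0)))))
    (Assign 11 (Const 0))"

definition fill :: cmd where
  "fill = Seq gain_cmd (Store (Cell 7 (Ix3 (Reg 6) (Reg 7) (Reg 8))) (Reg 11))"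

text \<open>Refreshing all objects in turn builds the demand matrix: a column completed earlier
  passes the tests that later calls apply to it.\<close>

definition prepare :: cmd where
  "prepare = Seq (For 6 (For 7 (For 8 fill)))
    (Seq (For 7 (Store (Cell 0 (Reg 7)) (Reg 2))) (For 7 refresh))"

text \<open>Entries above \<open>q\<close> stand for last resorts and become 0. The result
  overwrites the beginning of the input.\<close>

definition output_cmd :: cmd where
  "output_cmd = For 6 (If (Op Less (Reg 6) (Reg 4))
    (Store (Reg 6) (Op Times (Mem (Cell 2 (Reg 6))) (Op Less (Mem (Cell 2 (Reg 6))) (Op Plus (Reg 5) (Const 1))))) Skip)"

locale ram_instance = ram w X N K cap p q for w X N K cap p q :: nat +
  fixes G :: "(nat, nat) bipartite_prefs"
  assumes p_G: "p = card (agents G)" and q_G: "q = card (objects G)"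
begin

definition input_at :: "vec \<Rightarrow> bool" where
  "input_at I \<longleftrightarrow> (\<forall>a<p. \<forall>b<q. I (3 + (a * q + b)) = of_bool ((a, b) \<in> edges G)) \<and>
    (\<forall>a<p. \<forall>b<q. \<forall>b'<q. I (3 + p * q + ((a * q + b) * q + b')) = of_bool ((b, b') \<in> prefs G a))"

lemma adj_index: "a < p \<Longrightarrow> b < q \<Longrightarrow> 3 + (a * q + b) < X"
  using mult_le_mono1[of "Suc a" p q] X_adj by simp

lemma pref_index:
  assumes "a < p" "b < q" "b' < q"
  shows "3 + p * q + ((a * q + b) * q + b') < X"
proof -
  have "Suc (a * q + b) \<le> p * q" using mult_le_mono1[of "Suc a" p q] assms by simp
  from mult_le_mono1[OF this, of q] show ?thesis using X_adj assms(3) by simp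
qed

lemma X_word: "X + 2 * N + 100 \<le> 2 ^ w"
  using word N_N3 by linarith

lemma edge_test_correct:
  assumes I: "input_at (A 8)" and r: "6 \<le> r" and x: "6 \<le> x" and a: "R 6 < p" and b: "R x < N"
  shows "hwp (edge_test r x) Q R A = Q (R(r := of_bool (ext_edge G (R 6) (R x)))) A"
proof (cases "R x < q")
  case True
  have "R 6 * q + R x < 2 ^ w" "3 + (R 6 * q + R x) < 2 ^ w" "R 6 * q < 2 ^ w"
    using adj_index[OF a True] X_word by linarith+
  then show ?thesis
    using True x r I a adj_index[OF a True]
    by (simp add: edge_test_def cst_def ev_Mem_input input_at_def ext_edge_def q_G[symmetric])
next
  case False
  have "q + R 6 < 2 ^ w" using N_word a N_pq by linarith
  then show ?thesis using False x r by (simp add: edge_test_def cst_def ext_edge_def q_G[symmetric])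
qed

lemma gain_cmd_correct:
  assumes I: "input_at (A 8)" and R: "R 6 < N" "R 7 < N" "R 8 < N"
    and Q: "\<And>x y. Q (R(9 := x, 10 := y, 11 := ext_gain G K (R 6) (R 7) (R 8))) A"
      "Q (R(11 := ext_gain G K (R 6) (R 7) (R 8))) A"
  shows "hwp gain_cmd Q R A"
proof (cases "R 6 < p")
  case False
  then show ?thesis using Q(2) unfolding gain_cmd_def by (simp add: cst_def ext_gain_def p_G[symmetric])
next
  case a: True
  let ?e = "ext_edge G (R 6)"
  define R1 where "R1 = R(9 := of_bool (?e (R 7)), 10 := of_bool (?e (R 8)))"
  define c where "c = If (Reg 9)
    (If (Reg 10)
    (If (Op Less (Reg 7) (Reg 5))
    (If (Op Less (Reg 8) (Reg 5)) (Assign 11 pref_exp) (Assign 11 (Reg 2)))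
    (Assign 11 (Const 0)))
    (Assign 11 (Op Plus (Reg 2) (Const 1))))
    (Assign 11 (Const 0))"
  have "hwp c Q R1 A"
  proof (cases "?e (R 7) \<and> ?e (R 8) \<and> R 7 < q \<and> R 8 < q")
    case True
    note ix = pref_index[OF a, of "R 7" "R 8"]
    have "(R 6 * q + R 7) * q + R 8 < 2 ^ w" "(R 6 * q + R 7) * q < 2 ^ w" "3 + p * q + ((R 6 * q + R 7) * q + R 8) < 2 ^ w"
      "3 + p * q < 2 ^ w" "p * q < 2 ^ w"
      using ix True X_word by linarith+
    moreover have "R 6 * q + R 7 < 2 ^ w" "R 6 * q < 2 ^ w" using adj_index[OF a, of "R 7"] True X_word by linarith+
    ultimately have "ev pref_exp R1 A = A 8 (3 + p * q + ((R 6 * q + R 7) * q + R 8))"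
      using ix True unfolding pref_exp_def R1_def by (simp add: cst_def ev_Mem_input)
    also have "\<dots> = of_bool ((R 7, R 8) \<in> prefs G (R 6))" using I True a unfolding input_at_def by blast
    finally have "ev pref_exp R1 A = ext_gain G K (R 6) (R 7) (R 8)"
      using True a by (simp add: ext_gain_def p_G[symmetric] q_G[symmetric])
    then show ?thesis using True Q(1)[of "of_bool (?e (R 7))" "of_bool (?e (R 8))"]
      unfolding c_def R1_def by (simp add: cst_def)
  next
    case False
    have "Suc K < 2 ^ w" using K_N N_word by linarith
    then show ?thesis using False a Q(1)[of "of_bool (?e (R 7))" "of_bool (?e (R 8))"]
      unfolding c_def R1_def by (auto simp add: cst_def ext_gain_def p_G[symmetric] q_G[symmetric])
  qed
  then have "hwp (Seq (edge_test 9 7) (Seq (edge_test 10 8) c)) Q R A"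
    using edge_test_correct[where A = A, OF I] a R unfolding R1_def by simp
  then show ?thesis using a unfolding gain_cmd_def c_def[symmetric] by (simp add: cst_def)
qed

lemma fill_correct:
  assumes "input_at (A 8)" "R 6 < N" "R 7 < N" "R 8 < N"
  shows "hr fill R A 150 (\<lambda>R' A'. same {9, 10, 11} R R' \<and>
    A' = A(7 := (A 7)((R 6 * N + R 7) * N + R 8 := ext_gain G K (R 6) (R 7) (R 8))))"
    (is "hr _ _ _ _ ?Q")
proof (rule hr_straight)
  show "hwp fill ?Q R A"
    unfolding fill_def hwp.simps(4)
    by (rule gain_cmd_correct[where R = R and A = A, OF assms]) (use assms in \<open>simp_all add: index3\<close>)
qed (simp add: fill_def gain_cmd_def edge_test_def pref_exp_def Cell_def Ix3_def)

definition filled :: "nat \<Rightarrow> nat \<Rightarrow> nat \<Rightarrow> arrays \<Rightarrow> bool" where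
  "filled a b d A \<longleftrightarrow> (\<forall>x<N. \<forall>y<N. \<forall>e<N. x < a \<or> x = a \<and> (y < b \<or> y = b \<and> e < d) \<longrightarrow>
    wt A x y e = ext_gain G K x y e)"

lemma filled_step:
  assumes "filled a b d A" "a < N" "b < N" "d < N"
  shows "filled a b (Suc d) (A(7 := (A 7)((a * N + b) * N + d := ext_gain G K a b d)))"
  unfolding filled_def
proof (intro allI impI)
  fix x y e assume h: "x < N" "y < N" "e < N" "x < a \<or> x = a \<and> (y < b \<or> y = b \<and> e < Suc d)"
  have i: "(x * N + y) * N + e = (a * N + b) * N + d \<longleftrightarrow> x = a \<and> y = b \<and> e = d"
    using index_inj h assms by auto
  show "wt (A(7 := (A 7)((a * N + b) * N + d := ext_gain G K a b d))) x y e = ext_gain G K x y e"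
  proof (cases "x = a \<and> y = b \<and> e = d")
    case False
    then have "x < a \<or> x = a \<and> (y < b \<or> y = b \<and> e < d)" using h(4) by auto
    then have "wt A x y e = ext_gain G K x y e" using assms(1) h unfolding filled_def by blast
    then show ?thesis using False i by (simp add: wt_def)
  qed (simp add: wt_def)
qed

lemma fill_all_correct:
  assumes I: "input_at (A 8)"
  shows "hr (For 6 (For 7 (For 8 fill))) R A (N * (N * (N * 158 + 20) + 20) + 6) (\<lambda>R' A'. same {7} A A' \<and> filled N 0 0 A')"
proof -
  define base where "base A' \<longleftrightarrow> same {7} A A'" for A'
  have base: "input_at (A' 8)" if "base A'" for A'
    using that I unfolding base_def same_def by simp
  let ?J = "\<lambda>R1 d (R' :: regs) A'. R' 6 = R1 6 \<and> R' 7 = R1 7 \<and> base A' \<and> filled (R1 6) (R1 7) d A'"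
  let ?I = "\<lambda>R1 b (R' :: regs) A'. R' 6 = R1 6 \<and> base A' \<and> filled (R1 6) b 0 A'"
  let ?O = "\<lambda>R1 (R' :: regs) A'. R' 6 = R1 6 \<and> base A' \<and> filled (Suc (R1 6)) 0 0 A'"
  have d: "hr (For 8 fill) R1 A1 (N * 158 + 8) (\<lambda>R' A'. R' 6 = R1 6 \<and> R' 7 = R1 7 \<and> base A' \<and> filled (R1 6) (Suc (R1 7)) 0 A')"
    if h: "R1 6 < N" "R1 7 < N" "base A1" "filled (R1 6) (R1 7) 0 A1" for R1 A1
  proof (rule hr_For[where J = "?J R1"])
    fix R' :: regs and A' assume 1: "R' 8 < N" "?J R1 (R' 8) R' A'"
    have "hr fill R' A' 150 (\<lambda>R'' A''. same {9, 10, 11} R' R'' \<and>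
      A'' = A'(7 := (A' 7)((R' 6 * N + R' 7) * N + R' 8 := ext_gain G K (R' 6) (R' 7) (R' 8))))"
      by (rule fill_correct) (use 1 h base in auto)
    then show "hr fill R' A' 150 (counted 8 (R' 8) (?J R1))"
    proof (rule hr_mono)
      fix R'' A'' assume 2: "same {9, 10, 11} R' R'' \<and>
        A'' = A'(7 := (A' 7)((R' 6 * N + R' 7) * N + R' 8 := ext_gain G K (R' 6) (R' 7) (R' 8)))"
      have "R'' 6 = R1 6" "R'' 7 = R1 7" "R'' 8 = R' 8" using 2 1 unfolding same_def by simp_all
      moreover have "filled (R1 6) (R1 7) (Suc (R' 8)) A''" using filled_step[of "R1 6" "R1 7" "R' 8" A'] 1 2 h by simp
      ultimately show "counted 8 (R' 8) (?J R1) R'' A''"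
        using 1 2 unfolding base_def by simp
    qed simp
  next
    fix R' :: regs and A' assume "?J R1 N R' A'"
    then show "R' 6 = R1 6 \<and> R' 7 = R1 7 \<and> base A' \<and> filled (R1 6) (Suc (R1 7)) 0 A'"
      unfolding filled_def by (auto simp: less_Suc_eq)
  qed (use h in \<open>auto simp: base_def\<close>)
  have b: "hr (For 7 (For 8 fill)) R1 A1 (N * (N * 158 + 20) + 10) (?O R1)"
    if h: "R1 6 < N" "base A1" "filled (R1 6) 0 0 A1" for R1 A1
  proof (rule hr_For[where J = "?I R1"])
    fix R' :: regs and A' assume 1: "R' 7 < N" "?I R1 (R' 7) R' A'"
    then have "hr (For 8 fill) R' A' (N * 158 + 8) (\<lambda>R'' A''. R'' 6 = R' 6 \<and> R'' 7 = R' 7 \<and> base A'' \<and> filled (R' 6) (Suc (R' 7)) 0 A'')"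
      by (intro d) (use h in auto)
    then show "hr (For 8 fill) R' A' (N * 158 + 8) (counted 7 (R' 7) (?I R1))"
      by (rule hr_mono) (use 1 in \<open>auto simp: base_def\<close>)
  next
    fix R' :: regs and A' assume "?I R1 N R' A'"
    then show "R' 6 = R1 6 \<and> base A' \<and> filled (Suc (R1 6)) 0 0 A'"
      unfolding filled_def by (auto simp: less_Suc_eq)
  qed (use h in \<open>auto simp: base_def algebra_simps\<close>)
  show ?thesis
  proof (rule hr_For[where J = "\<lambda>a R' A'. base A' \<and> filled a 0 0 A'"])
    fix R' :: regs and A' assume 1: "R' 6 < N" "base A' \<and> filled (R' 6) 0 0 A'"
    then have "hr (For 7 (For 8 fill)) R' A' (N * (N * 158 + 20) + 10) (?O R')"
      by (intro b) auto
    then show "hr (For 7 (For 8 fill)) R' A' (N * (N * 158 + 20) + 10) (?O R')"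
      by (rule hr_mono) (auto simp: base_def)
  qed (auto simp: base_def filled_def algebra_simps)
qed

lemma ext_gain_le: "ext_gain G K a b b' \<le> Suc K"
  by (simp add: ext_gain_def)

definition faithful :: "arrays \<Rightarrow> bool" where
  "faithful A \<longleftrightarrow> (\<forall>a<N. \<forall>b<N. \<forall>b'<N. wt A a b b' = ext_gain G K a b b')"

text \<open>The constant price \<open>K\<close> dominates every equilibrium in the admissible range,
  so the lower bound on prices holds at the start.\<close>

lemma prepare_correct:
  assumes I: "input_at (A 8)" and zero: "A 6 = (\<lambda>_. 0)"
    and eq: "equilibrium N (ext_gain G K) z' \<sigma>" and z': "\<forall>b<N. z' b \<le> K"
  shows "hr prepare R A (1000 * (N * (N * N))) (\<lambda>R' A'. \<exists>W. good W z' \<sigma> A' \<and> faithful A')"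
  unfolding prepare_def
proof (rule hr_Seq[OF fill_all_correct[where R = R and A = A, OF I]])
  fix R1 A1 assume 1: "same {7} A A1 \<and> filled N 0 0 A1"
  have wt1: "wt A1 a b d = ext_gain G K a b d" if "a < N" "b < N" "d < N" for a b d
    using 1 that unfolding filled_def by simp
  have A16: "A1 6 = (\<lambda>_. 0)" using 1 zero unfolding same_def by simp
  let ?J = "\<lambda>i (R' :: regs) A'. same {0} A1 A' \<and> (\<forall>b<i. A' 0 b = K)"
  show "hr (Seq (For 7 (Store (Cell 0 (Reg 7)) (Reg 2))) (For 7 refresh)) R1 A1
    (N * (N * (N * 200 + 50) + 60) + N * 40 + 20) (\<lambda>R' A'. \<exists>W. good W z' \<sigma> A' \<and> faithful A')"
  proof (rule hr_Seq)
    show "hr (For 7 (Store (Cell 0 (Reg 7)) (Reg 2))) R1 A1 (N * 30 + 6)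
      (?J N)"
    proof (rule hr_For[where J = ?J])
      fix R' :: regs and A' assume h: "R' 7 < N" "?J (R' 7) R' A'"
      then have "hwp (Store (Cell 0 (Reg 7)) (Reg 2))
        (counted 7 (R' 7) ?J) R' A'"
        by (simp add: index1) (simp add: less_Suc_eq cst_def)
      then show "hr (Store (Cell 0 (Reg 7)) (Reg 2)) R' A' 22
        (counted 7 (R' 7) ?J)"
        by (rule hr_straight) (simp add: Cell_def)
    qed auto
  next
    fix R2 A2 assume 2: "?J N R2 A2"
    have A27: "A2 7 = A1 7" "A2 6 = (\<lambda>_. 0)" using 2 A16 unfolding same_def by simp_all
    have wt2: "wt A2 a b d = ext_gain G K a b d" if "a < N" "b < N" "d < N" for a b d
      using wt1[OF that] A27 by (simp add: wt_def)
    have wf2: "wf A2" unfolding wf_def using 2 wt2 ext_gain_le A27 by simp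
    define J where "J i R' A' \<longleftrightarrow> same {6} A2 A' \<and> wf A' \<and>
      (\<forall>a<N. \<forall>y<i. okA A' a y = demandA A2 a y)" for i and R' :: regs and A'
    show "hr (For 7 refresh) R2 A2 (N * (N * (N * 200 + 50) + 60) + 6) (\<lambda>R' A'. \<exists>W. good W z' \<sigma> A' \<and> faithful A')"
    proof (rule hr_For[where J = J])
      show "J 0 (R2(7 := 0)) A2" using wf2 unfolding J_def by simp
    next
      fix R' A' assume i: "R' 7 < N" and J: "J (R' 7) R' A'"
      have wf': "wf A'" using J unfolding J_def by blast
      have A': "A' 0 = A2 0" "A' 7 = A2 7" using J unfolding J_def same_def by simp_all
      show "hr refresh R' A' (N * (N * 200 + 50) + 50)
        (counted 7 (R' 7) J)"
      proof (rule hr_mono[OF refresh_correct[where R = R' and A = A', OF wf' i]])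
        fix R3 A3 assume "refreshed R' A' R3 A3"
        note 3 = this[unfolded refreshed_def]
        have dem: "demandA A' = demandA A2" "badA A' = badA A2"
          using demandA_cong[of A' A2, OF A'] badA_cong[of A' A2, OF A'] by auto
        have "okA A3 a y = demandA A2 a y" if ay: "a < N" "y < Suc (R' 7)" for a y
        proof (cases "y = R' 7")
          case True
          then show ?thesis using 3 ay i dem by (simp add: okA_def)
        next
          case False
          then have y: "y < R' 7" "y < N" using ay i by auto
          have "okA A' a y = demandA A2 a y" using J ay y unfolding J_def by blast
          moreover have "okA A3 a y \<longleftrightarrow> okA A' a y \<and> \<not> badA A2 a (R' 7) y"
            using 3 ay y dem by (simp add: okA_def)
          moreover have "demandA A2 a y \<Longrightarrow> \<not> badA A2 a (R' 7) y"
            using i by (simp add: demandA_def demand_def badA_def)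
          ultimately show ?thesis by blast
        qed
        moreover have "same {6} A2 A3" using same_trans[of "{6}" A2 A' "{6}" A3] J 3 unfolding J_def by simp
        moreover have "R3 7 = R' 7" using 3 unfolding same_def by simp
        ultimately show "R3 7 = R' 7 \<and> J (Suc (R' 7)) (R3(7 := Suc (R' 7))) A3"
          using 3 unfolding J_def by simp
      qed simp
    next
      fix R' A' assume J: "J N R' A'"
      have A': "A' 0 = A2 0" "A' 7 = A2 7" using J unfolding J_def same_def by simp_all
      have dem: "demandA A' = demandA A2" using demandA_cong[of A' A2, OF A'] .
      have wt': "wt A' a b d = ext_gain G K a b d" if "a < N" "b < N" "d < N" for a b d
        using wt2[OF that] wt_cong[of A' A2] A' by simp
      have "equilibrium N (wt A') z' \<sigma>"
      proof -
        have "\<sigma> a < N" if "a < N" for a using eq that unfolding equilibrium_def by (auto dest: bij_betwE)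
        then show ?thesis using eq wt' unfolding equilibrium_def demand_def bad_def by simp
      qed
      then have "good (A' 7) z' \<sigma> A'"
        using J dem z' 2 unfolding good_def J_def by (simp add: A')
      then show "\<exists>W. good W z' \<sigma> A' \<and> faithful A'"
        using wt' by (auto simp: faithful_def)
    qed (auto simp: algebra_simps)
  qed (auto simp: algebra_simps)
next
  have "2 * (N * N) \<le> N * (N * N)" using N2 by simp
  moreover have "N * (N * (N * 158 + 20) + 20) + 6 + (N * (N * (N * 200 + 50) + 60) + N * 40 + 20) =
    358 * (N * (N * N)) + 70 * (N * N) + 120 * N + 26" by (simp add: algebra_simps)
  ultimately show "N * (N * (N * 158 + 20) + 20) + 6 + (N * (N * (N * 200 + 50) + 60) + N * 40 + 20) \<le> 1000 * (N * (N * N))"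
    using N_square by linarith
qed

lemma output_correct:
  assumes m: "\<forall>a<N. A 2 a \<le> N"
  shows "hr output_cmd R A (N * 50 + 10) (\<lambda>R' A'. \<forall>a<p. A' 8 a = (if A 2 a \<le> q then A 2 a else 0))"
proof -
  define J where "J i R' A' \<longleftrightarrow> same {8} A A' \<and> (\<forall>a<p. a < i \<longrightarrow> A' 8 a = (if A 2 a \<le> q then A 2 a else 0))"
    for i and R' :: regs and A'
  show ?thesis
    unfolding output_cmd_def
  proof (rule hr_For[where J = J])
    show "J 0 (R(6 := 0)) A" by (simp add: J_def)
  next
    fix R' A' assume i: "R' 6 < N" and J: "J (R' 6) R' A'"
    have A2: "A' 2 = A 2" using J unfolding J_def same_def by simp
    let ?c = "Store (Reg 6) (Op Times (Mem (Cell 2 (Reg 6))) (Op Less (Mem (Cell 2 (Reg 6))) (Op Plus (Reg 5) (Const 1))))"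
    have "hwp (If (Op Less (Reg 6) (Reg 4)) ?c Skip)
      (counted 6 (R' 6) J) R' A'"
    proof (cases "R' 6 < p")
      case False
      then have "J (Suc (R' 6)) (R'(6 := Suc (R' 6))) A'" using J unfolding J_def by auto
      then show ?thesis using False by (simp add: cst_def)
    next
      case True
      let ?v = "A 2 (R' 6)"
      have "?v \<le> N" using m i by blast
      then have v: "?v < 2 ^ w" "Suc q < 2 ^ w" using N_word N_pq by linarith+
      have aX: "R' 6 < X" using True X_p by simp
      let ?A = "A'(8 := (A' 8)(R' 6 := ?v * of_bool (?v < Suc q)))"
      have "J (Suc (R' 6)) (R'(6 := Suc (R' 6))) ?A"
        using J unfolding J_def by (auto simp: less_Suc_eq less_Suc_eq_le)
      moreover have "ev (Op Times (Mem (Cell 2 (Reg 6))) (Op Less (Mem (Cell 2 (Reg 6))) (Op Plus (Reg 5) (Const 1)))) R' A'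
        = ?v * of_bool (?v < Suc q)"
        using v i A2 by (simp add: index1 cst_def)
      ultimately show ?thesis
        using True aX unfolding hwp.simps(5) by (simp add: hwp_Store_input cst_def)
    qed
    then show "hr (If (Op Less (Reg 6) (Reg 4)) ?c Skip) R' A' 40
      (counted 6 (R' 6) J)"
      by (rule hr_straight) (simp add: Cell_def)
  next
    fix R' A' assume "J N R' A'"
    then show "\<forall>a<p. A' 8 a = (if A 2 a \<le> q then A 2 a else 0)" using N_pq unfolding J_def by simp
  qed simp_all
qed

end

section \<open>The complete program\<close>

definition setup_cmd :: cmd where
  "setup_cmd = Seq (Assign 4 (Mem (Const 0))) (Seq (Assign 5 (Mem (Const 1))) (Seq (Assign 2 (Mem (Const 2)))
    (Seq (Assign 1 (Op Plus (Reg 4) (Reg 5)))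
    (Seq (Assign 0 (Op Plus (Op Plus (Const 3) (Op Plus (Op Times (Reg 4) (Reg 5))
    (Op Times (Op Times (Reg 4) (Reg 5)) (Reg 5)))) (Reg 4)))
    (Assign 3 (Const 0))))))"

definition sqrt_cmd :: cmd where
  "sqrt_cmd = While (Op Less (Op Times (Reg 3) (Reg 3)) (Reg 1)) (Assign 3 (Op Plus (Reg 3) (Const 1)))"

definition popular_cmd :: cmd where
  "popular_cmd = Seq setup_cmd (Seq sqrt_cmd (Seq prepare (Seq solve output_cmd)))"

text \<open>Minimality of \<open>c\<close> is recorded through \<open>c - 1\<close>; the alternative
  \<open>c = 0\<close> covers the start of the linear search.\<close>

lemma sqrt_cmd_correct:
  assumes w: "N * N + 2 \<le> 2 ^ w" and s: "fst s 1 = N" "fst s 3 = 0"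
  shows "run w sqrt_cmd s (N * 10 + 6) (\<lambda>s'. \<exists>c. s' = ((fst s)(3 := c), snd s) \<and> N \<le> c * c \<and> c \<le> N \<and>
    (c = 0 \<or> (c - 1) * (c - 1) < N))"
    (is "run _ _ _ _ ?Q")
proof -
  define J where "J s' \<longleftrightarrow> (\<exists>c. s' = ((fst s)(3 := c), snd s) \<and> c \<le> N \<and> (c = 0 \<or> (c - 1) * (c - 1) < N))" for s'
  let ?e = "Op Less (Op Times (Reg 3) (Reg 3)) (Reg 1)"
  have ev: "exp_val w ?e s' = of_bool (fst s' 3 * fst s' 3 < N)" if J: "J s'" for s'
  proof -
    obtain c where c: "s' = ((fst s)(3 := c), snd s)" "c \<le> N" using J unfolding J_def by blast
    have "c * c \<le> N * N" using c(2) by (rule mult_le_mono[OF _ c(2)])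
    then have "c * c < 2 ^ w" "1 < (2::nat) ^ w" using w by linarith+
    then show ?thesis using c s by simp
  qed
  have "run w (While ?e (Assign 3 (Op Plus (Reg 3) (Const 1)))) s ((N - fst s 3) * 10 + 1 + exp_cost ?e)
    (\<lambda>s'. J s' \<and> exp_val w ?e s' = 0)"
  proof (rule run_While[where \<Phi> = "\<lambda>s. (N - fst s 3) * 10"])
    show "J s" unfolding J_def using s by (intro exI[of _ 0]) (auto simp: prod_eq_iff fun_eq_iff)
  next
    fix s' assume J: "J s'" and "exp_val w ?e s' \<noteq> 0"
    then have lt: "fst s' 3 * fst s' 3 < N" using ev by (simp split: if_splits)
    obtain c where c: "s' = ((fst s)(3 := c), snd s)" "c \<le> N" using J unfolding J_def by blast
    have cc: "c * c < N" using lt c by simp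
    then have cN: "c < N" by (metis c(2) le_square less_le_trans linorder_not_less order_le_less)
    have "N \<le> N * N" by simp
    then have "c + 1 < 2 ^ w" "1 < (2::nat) ^ w" using cN w by linarith+
    then have "wp w (Assign 3 (Op Plus (Reg 3) (Const 1)))
      (\<lambda>s''. J s'' \<and> (N - fst s'' 3) * 10 + 4 + 1 + exp_cost ?e \<le> (N - fst s' 3) * 10) s'"
      using c cc cN unfolding J_def by (auto intro!: exI[of _ "Suc c"])
    from wp_run[OF this] show "\<exists>T. run w (Assign 3 (Op Plus (Reg 3) (Const 1))) s' T
      (\<lambda>s''. J s'' \<and> (N - fst s'' 3) * 10 + T + 1 + exp_cost ?e \<le> (N - fst s' 3) * 10)"
      by (intro exI[of _ 4], elim run_mono) auto
  qed
  then show ?thesis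
    unfolding sqrt_cmd_def
  proof (rule run_mono)
    fix s' assume h: "J s' \<and> exp_val w ?e s' = 0"
    then show "?Q s'"
      using ev[of s'] unfolding J_def by (auto simp: not_less)
  qed (use s in simp)
qed

lemma input_words_nth:
  fixes G :: "(nat, nat) bipartite_prefs" and \<kappa> :: nat
  assumes "p = card (agents G)" "q = card (objects G)"
  defines "xs \<equiv> input_words G \<kappa>"
  shows "length xs = 3 + p * q + p * q * q" "xs ! 0 = p" "xs ! 1 = q" "xs ! 2 = \<kappa>"
    "a < p \<Longrightarrow> b < q \<Longrightarrow> xs ! (3 + (a * q + b)) = of_bool ((a, b) \<in> edges G)"
    "a < p \<Longrightarrow> b < q \<Longrightarrow> b' < q \<Longrightarrow> xs ! (3 + p * q + ((a * q + b) * q + b')) = of_bool ((b, b') \<in> prefs G a)"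
proof -
  let ?E = "map (\<lambda>i. of_bool ((i div q, i mod q) \<in> edges G)) [0..<p * q] :: nat list"
  let ?P = "map (\<lambda>i. of_bool ((i div q mod q, i mod q) \<in> prefs G (i div (q * q)))) [0..<p * q * q] :: nat list"
  have xs: "xs = [p, q, \<kappa>] @ ?E @ ?P"
    unfolding xs_def input_words_def Let_def assms(1,2)[symmetric] by simp
  show "length xs = 3 + p * q + p * q * q" "xs ! 0 = p" "xs ! 1 = q" "xs ! 2 = \<kappa>" unfolding xs by simp_all
  have ix: "a * q + b < p * q" if "a < p" "b < q" for a b
    using mult_le_mono1[of "Suc a" p q] that by simp
  have "xs ! (3 + i) = ?E ! i" if "i < p * q" for i
    using that unfolding xs by (simp add: nth_append)
  then show "xs ! (3 + (a * q + b)) = of_bool ((a, b) \<in> edges G)" if "a < p" "b < q"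
    using ix[OF that] that by simp
  have P: "xs ! (3 + p * q + i) = ?P ! i" for i
  proof -
    have len: "length ([p, q, \<kappa>] @ ?E) = 3 + p * q" by simp
    have "xs ! (length ([p, q, \<kappa>] @ ?E) + i) = ?P ! i" unfolding xs append_assoc[symmetric] by (rule nth_append_length_plus)
    then show ?thesis unfolding len .
  qed
  show "xs ! (3 + p * q + ((a * q + b) * q + b')) = of_bool ((b, b') \<in> prefs G a)" if h: "a < p" "b < q" "b' < q"
  proof -
    let ?i = "(a * q + b) * q + b'"
    have "?i < p * q * q" using mult_le_mono1[of "Suc (a * q + b)" "p * q" q] ix[OF h(1,2)] h(3) by simp
    moreover have d: "?i div q = a * q + b" "?i mod q = b'" using h(3) by simp_all
    moreover have "?i div (q * q) = a" unfolding div_mult2_eq d using h(2) by simp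
    ultimately show ?thesis unfolding P using h(2) by simp
  qed
qed

text \<open>Minimality of \<open>c\<close> gives c \<le> 2 * sqrt n, so the main term is of order n
  powr (7 / 2) * k; since \<open>k\<close> is at least 1, it is at most its power with exponent 5 /
  2.\<close>

lemma time_bound:
  fixes n k c t :: nat
  assumes n: "2 \<le> n" and k: "1 \<le> k" and c: "c = 0 \<or> (c - 1) * (c - 1) < n"
    and t: "t \<le> 60 + (n * 10 + 6) + 1000 * (n * (n * n)) + ((n * k + 1) * (2000 * (c * (n * n))) + 20) + (n * 50 + 10)"
  shows "real t \<le> 10000 * (real n powr (7 / 2) * real k powr (5 / 2))"
proof -
  define x where "x = sqrt (real n)"
  have x1: "1 \<le> x" using n unfolding x_def by simp
  have xx: "x * x = real n" unfolding x_def by simp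
  have cx: "real c \<le> 2 * x"
  proof (cases "c = 0")
    case False
    then have "(c - 1) * (c - 1) < n" using c by simp
    then have "real ((c - 1) * (c - 1)) < real n" by (simp only: of_nat_less_iff)
    then have "(real c - 1)\<^sup>2 < real n" using False by (simp add: power2_eq_square of_nat_diff)
    then have "real c - 1 \<le> x" unfolding x_def by (intro real_le_rsqrt) simp
    then show ?thesis using x1 by simp
  qed (use x1 in simp)
  have pn: "real n powr (7 / 2) = real n ^ 3 * x"
  proof -
    have "real n powr (7 / 2) = real n powr (3 + 1 / 2)" by simp
    also have "\<dots> = real n powr 3 * real n powr (1 / 2)" by (rule powr_add)
    finally show ?thesis using n unfolding x_def by (simp add: powr_half_sqrt)
  qed
  have pk: "real k \<le> real k powr (5 / 2)" using powr_mono[of 1 "5 / 2" "real k"] k by simp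
  define y where "y = real n ^ 3 * x"
  have y: "real n ^ 3 \<le> y" using x1 unfolding y_def by (simp add: mult_le_cancel_left1)
  have n3: "real n ^ 3 = real (n * (n * n))" by (simp add: power3_eq_cube)
  have nn: "4 \<le> n * n" using mult_le_mono[OF n n] by simp
  have "4 * n \<le> n * (n * n)" using nn by simp
  then have n4: "4 * real n \<le> real n ^ 3" unfolding n3 by (metis of_nat_le_iff of_nat_mult of_nat_numeral)
  have "8 \<le> n * (n * n)" using mult_le_mono[OF n nn] by simp
  then have n8: "8 \<le> real n ^ 3" unfolding n3 by (metis of_nat_le_iff of_nat_numeral)
  \<comment> \<open>The constant is 2 * 2000 * 2, from \<open>n * k + 1 \<le> 2 * (n * k)\<close>
    and \<open>c \<le> 2 * x\<close>.\<close>
  have "real ((n * k + 1) * (2000 * (c * (n * n)))) \<le> 8000 * (y * real k)"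
  proof -
    have "n * k + 1 \<le> 2 * (n * k)" using n k by (simp add: Suc_le_eq)
    then have "(n * k + 1) * (2000 * (c * (n * n))) \<le> 2 * (n * k) * (2000 * (c * (n * n)))" by (rule mult_le_mono1)
    then have "real ((n * k + 1) * (2000 * (c * (n * n)))) \<le> real (2 * (n * k) * (2000 * (c * (n * n))))"
      by (simp only: of_nat_le_iff)
    also have "\<dots> = 4000 * (real n ^ 3 * real k) * real c" by (simp add: power3_eq_cube)
    also have "\<dots> \<le> 4000 * (real n ^ 3 * real k) * (2 * x)" using cx by (intro mult_left_mono) auto
    finally show ?thesis unfolding y_def by (simp add: algebra_simps)
  qed
  moreover have "real t \<le> real (60 + (n * 10 + 6) + 1000 * (n * (n * n)) + ((n * k + 1) * (2000 * (c * (n * n))) + 20) + (n * 50 + 10))"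
    using t by (simp only: of_nat_le_iff)
  then have "real t \<le> 96 + 60 * real n + 1000 * real n ^ 3 + real ((n * k + 1) * (2000 * (c * (n * n))))"
    unfolding n3 by simp
  \<comment> \<open>The remaining terms fit into \<open>2000 * y\<close>, which with the 8000 of the
    main term makes 10000.\<close>
  ultimately have "real t \<le> 2000 * y + 8000 * (y * real k)" using n4 n8 y by linarith
  also have "\<dots> \<le> 10000 * (y * real k)"
  proof -
    have "y * 1 \<le> y * real k" using k y n8 by (intro mult_left_mono) auto
    then show ?thesis by simp
  qed
  also have "\<dots> \<le> 10000 * (y * real k powr (5 / 2))"
    using pk y n8 by (intro mult_left_mono) auto
  finally show ?thesis unfolding pn y_def by simp
qed

lemma popular_cmd_correct:
  fixes G :: "(nat, nat) bipartite_prefs"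
  assumes inst: "popular_matching_instance G" and num: "numbered G" and n: "card (vertices G) = n"
    and k: "\<kappa> \<in> {1..n - 1}" and word: "n ^ 12 \<le> 2 ^ w" and ex: "popular_with_penalty \<kappa> G M"
  shows "\<exists>t s. exec w popular_cmd (initial_state (input_words G \<kappa>)) t s \<and>
    popular_with_penalty \<kappa> G (output_matching G s) \<and>
    real t \<le> 10000 * (real n powr (7 / 2) * real \<kappa> powr (5 / 2))"
proof -
  define p where "p = card (agents G)"
  define q where "q = card (objects G)"
  interpret PI: numbered_instance G \<kappa> p q n
  proof (unfold_locales)
  qed (use inst num n in \<open>auto simp: p_def q_def popular_matching_instance_def vertices_def card_Plus\<close>)
  have npq: "n = p + q" by (rule PI.N_def[THEN meta_eq_to_obj_eq])
  have n2: "2 \<le> n" and kn: "\<kappa> < n" "1 \<le> \<kappa>" using k by auto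
  \<comment> \<open>The last summand \<open>p\<close> reserves cells for the output even if there
    are no objects and the input is short.\<close>
  define X where "X = 3 + (p * q + p * q * q) + p"
  have nn: "4 \<le> n * n" using mult_le_mono[OF n2 n2] by simp
  have n3: "n \<le> n * n * n" using nn by simp
  have big: "X + 8 * (n * n * n) + 100 \<le> 2 ^ w"
  proof -
    have pq: "p \<le> n" "q \<le> n" using npq by auto
    have "p * q \<le> n * n" using mult_le_mono[OF pq] .
    moreover have "p * q * q \<le> n * n * n" using mult_le_mono[OF mult_le_mono[OF pq] pq(2)] .
    ultimately have "X \<le> 3 + (n * n + n * n * n) + n" using pq unfolding X_def by linarith
    moreover have "n * n \<le> n * n * n" "n \<le> n * n * n" "8 \<le> n * n * n" using n2 nn mult_le_mono[OF nn n2] by auto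
    \<comment> \<open>The origin of the exponent 12: addresses need a constant times
      \<open>n ^ 3\<close>, and \<open>n \<ge> 2\<close> bounds the constant 512 = 2 ^ 9 by
      \<open>n ^ 9\<close>.\<close>
    ultimately have "X + 8 * (n * n * n) + 100 \<le> 512 * (n * n * n)" by linarith
    also have "512 * (n * n * n) \<le> n ^ 9 * n ^ 3"
      using power_mono[OF n2, of 9] by (intro mult_le_mono) (auto simp: power3_eq_cube)
    also have "n ^ 9 * n ^ 3 = n ^ 12" by (simp flip: power_add)
    finally show ?thesis using word by simp
  qed
  define xs where "xs = input_words G \<kappa>"
  note nth = input_words_nth[where \<kappa> = \<kappa>, OF p_def q_def, folded xs_def]
  define m where "m i = (if i < length xs then xs ! i else 0)" for i
  have m0: "m 0 = p" "m (Suc 0) = q" "m 2 = \<kappa>" using nth(1-4) unfolding m_def by auto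
  have small: "i < 2 ^ w" if "i \<le> X + 8 * (n * n * n)" for i using that big by linarith
  have init: "initial_state xs = (\<lambda>_. 0, m)" unfolding initial_state_def m_def by simp
  let ?R = "(\<lambda>_. 0 :: nat)(4 := p, 5 := q, 2 := \<kappa>, 1 := n, 0 := X, 3 := 0)"
  have "wp w setup_cmd (\<lambda>s. s = (?R, m)) (\<lambda>_. 0, m)"
  proof -
    have "0 < (2::nat) ^ w" "1 < (2::nat) ^ w" "2 < (2::nat) ^ w" "3 < (2::nat) ^ w" "p * q < 2 ^ w" "p * q * q < 2 ^ w"
      "p * q + p * q * q < 2 ^ w" "3 + (p * q + p * q * q) < 2 ^ w" "X < 2 ^ w"
      using big unfolding X_def by linarith+
    moreover have "n < 2 ^ w" by (rule small) (use n3 in linarith)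
    moreover have "w \<noteq> 0" using big by (cases "w = 0") auto
    ultimately show ?thesis unfolding setup_cmd_def using m0 npq by (simp add: X_def)
  qed
  then have ready: "run w setup_cmd (initial_state xs) 60 (\<lambda>s. s = (?R, m))"
    unfolding init by (rule run_mono[OF wp_run]) (auto simp: setup_cmd_def)
  let ?T = "1000 * (n * (n * n)) :: nat" and ?S = "\<lambda>c. (n * \<kappa> + 1) * (2000 * (c * (n * n))) + 20 :: nat"
  have "\<exists>c. (c = 0 \<or> (c - 1) * (c - 1) < n) \<and>
    run w popular_cmd (initial_state xs) (60 + (n * 10 + 6) + ?T + ?S c + (n * 50 + 10))
    (\<lambda>s. popular_with_penalty \<kappa> G (output_matching G s))"
  proof -
    have "n * n \<le> n * n * n" using n2 by simp
    then have "n * n + 2 \<le> 2 ^ w" using big by linarith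
    from sqrt_cmd_correct[OF this, of "(?R, m)"] obtain t1 c where
      sq: "exec w sqrt_cmd (?R, m) t1 (?R(3 := c), m)" "t1 \<le> n * 10 + 6"
      and c: "n \<le> c * c" "c \<le> n" "c = 0 \<or> (c - 1) * (c - 1) < n"
      unfolding run_def by auto
    interpret ram_instance w X n \<kappa> c p q G
      by unfold_locales (use big c n2 kn npq in \<open>auto simp: X_def p_def q_def\<close>)
    \<comment> \<open>The given popular matching serves only to provide this lower bound on prices;
      the equilibrium that the program finds may be a different one.\<close>
    obtain z \<sigma> where eq: "equilibrium n (ext_gain G \<kappa>) z \<sigma>" "\<forall>b<n. z b \<le> \<kappa>"
      using PI.popular_imp_equilibrium[OF ex] by blast
    \<comment> \<open>The initial memory read as arrays. Cells beyond the input hold 0, so the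
      demand matrix starts empty.\<close>
    define A where "A k i = (if k = 8 then m i else m (X + 8 * i + k))" for k i
    have len: "length xs \<le> X" using nth(1) unfolding X_def by simp
    have mk: "mk (?R(3 := c)) A = (?R(3 := c), m)"
    proof -
      have "X + 8 * ((i - X) div 8) + (i - X) mod 8 = i" if "\<not> i < X" for i using that by simp
      then show ?thesis unfolding mk_def A_def cst_def by (auto simp: fun_eq_iff)
    qed
    have I: "input_at (A 8)"
      unfolding input_at_def
    proof (intro conjI allI impI)
      fix a b assume ab: "a < p" "b < q"
      have "a * q + b < p * q" using mult_le_mono1[of "Suc a" p q] ab by simp
      then show "A 8 (3 + (a * q + b)) = of_bool ((a, b) \<in> edges G)"
        using nth(5)[OF ab] nth(1) unfolding A_def m_def by simp
      fix b' assume b': "b' < q"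
      have "Suc (a * q + b) \<le> p * q" using mult_le_mono1[of "Suc a" p q] ab by simp
      from mult_le_mono1[OF this, of q] have "(a * q + b) * q + b' < p * q * q" using b' by simp
      then show "A 8 (3 + p * q + ((a * q + b) * q + b')) = of_bool ((b, b') \<in> prefs G a)"
        using nth(6)[OF ab b'] nth(1) unfolding A_def m_def by simp
    qed
    have zero: "A 6 = (\<lambda>_. 0)" using len unfolding A_def m_def by auto
    let ?pop = "\<lambda>R' A'. popular_with_penalty \<kappa> G (output_matching G (mk R' A'))"
    have "hr (Seq prepare (Seq solve output_cmd)) (?R(3 := c)) A (?T + (?S c + (n * 50 + 10)))
      ?pop"
    proof (rule hr_Seq[OF prepare_correct[where R = "?R(3 := c)" and A = A, OF I zero eq]])
      fix R1 A1 assume "\<exists>W. good W z \<sigma> A1 \<and> faithful A1"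
      then obtain W where good: "good W z \<sigma> A1"
        and wt1: "faithful A1" by blast
      show "hr (Seq solve output_cmd) R1 A1 (?S c + (n * 50 + 10))
        ?pop"
      proof (rule hr_Seq[OF solve_correct[where R = R1 and A = A1, OF good]])
        fix R2 A2 assume sol: "solved W z \<sigma> A2"
        then have g2: "good W z \<sigma> A2" and pm: "pmatch n (okA A2) (A2 2)" and all: "\<forall>b<n. \<exists>a<n. A2 2 a = Suc b"
          unfolding solved_def by auto
        note perf = perfect_bij[OF pm all]
        define \<tau> where "\<tau> a = A2 2 a - 1" for a
        have le: "\<forall>a<n. A2 2 a \<le> n" using pm perf(2) unfolding pmatch_def by blast
        have "A2 7 = A1 7" using g2 good unfolding good_def by simp
        then have wt2: "\<forall>a<n. \<forall>b<n. \<forall>b'<n. wt A2 a b b' = ext_gain G \<kappa> a b b'"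
          using wt1 by (simp add: wt_def faithful_def)
        have \<tau>n: "\<tau> a < n" if "a < n" for a using le perf(2) that unfolding \<tau>_def by force
        have "demandA A2 a (\<tau> a)" if "a < n" for a
        proof -
          have "okA A2 a (\<tau> a)" using pm perf(2) that unfolding pmatch_def \<tau>_def by blast
          then show ?thesis using g2 \<tau>n that unfolding good_def by blast
        qed
        then have "equilibrium n (ext_gain G \<kappa>) (A2 0) \<tau>"
          using perf(1) wt2 \<tau>n unfolding equilibrium_def demandA_def demand_def bad_def \<tau>_def by simp
        moreover have "\<forall>b<n. A2 0 b \<le> \<kappa>" using g2 unfolding good_def wf_def by blast
        ultimately have pop: "popular_with_penalty \<kappa> G {(a, \<tau> a) |a. a < p \<and> \<tau> a < q}"
          by (rule PI.equilibrium_imp_popular)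
        show "hr output_cmd R2 A2 (n * 50 + 10)
          ?pop"
        proof (rule hr_mono[OF output_correct[where R = R2 and A = A2, OF le]])
          fix R3 :: regs and A3 :: arrays assume 3: "\<forall>a<p. A3 8 a = (if A2 2 a \<le> q then A2 2 a else 0)"
          have "snd (mk R3 A3) a = (if A2 2 a \<le> q then A2 2 a else 0)" if "a < p" for a
            using 3 that X_p unfolding mk_def by simp
          moreover have "A2 2 a = Suc (\<tau> a)" if "a < p" for a using perf(2) that npq unfolding \<tau>_def by simp
          ultimately have "output_matching G (mk R3 A3) = {(a, \<tau> a) |a. a < p \<and> \<tau> a < q}"
            unfolding output_matching_def PI.agents_p by (auto split: if_splits)
          then show "popular_with_penalty \<kappa> G (output_matching G (mk R3 A3))" using pop by simp
        qed simp
      qed simp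
    qed simp
    then obtain t2 s where fin: "exec w (Seq prepare (Seq solve output_cmd)) (?R(3 := c), m) t2 s"
      "t2 \<le> ?T + (?S c + (n * 50 + 10))" "popular_with_penalty \<kappa> G (output_matching G s)"
      unfolding hr_def run_def mk by blast
    obtain t0 where t0: "exec w setup_cmd (initial_state xs) t0 (?R, m)" "t0 \<le> 60"
      using ready unfolding run_def by blast
    have "exec w popular_cmd (initial_state xs) (t0 + (t1 + t2)) s"
      unfolding popular_cmd_def by (intro exec.Seq[OF t0(1)] exec.Seq[OF sq(1)] fin(1))
    moreover have "t0 + (t1 + t2) \<le> 60 + (n * 10 + 6) + ?T + ?S c + (n * 50 + 10)"
      using t0(2) sq(2) fin(2) by linarith
    ultimately show ?thesis using c(3) fin(3) unfolding run_def by blast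
  qed
  then obtain c t s where c: "c = 0 \<or> (c - 1) * (c - 1) < n"
    and t: "t \<le> 60 + (n * 10 + 6) + ?T + ?S c + (n * 50 + 10)"
    and "exec w popular_cmd (initial_state xs) t s" "popular_with_penalty \<kappa> G (output_matching G s)"
    unfolding run_def by blast
  then show ?thesis using time_bound[OF n2 kn(2) c t] unfolding xs_def by blast
qed

text \<open>One fixed command works for all instances and word sizes, with the constants 10000 and
  12.\<close>

theorem theorem10:
  "\<exists>(c :: cmd) (C :: real) (d :: nat).
    \<forall>(G :: (nat, nat) bipartite_prefs) (n :: nat) (\<kappa> :: nat) (w :: nat).
    popular_matching_instance G \<and> numbered G \<and> card (vertices G) = n \<and> \<kappa> \<in> {1..n - 1} \<and>
    n ^ d \<le> 2 ^ w \<and> (\<exists>M. popular_with_penalty \<kappa> G M) \<longrightarrow>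
    (\<exists>t s. exec w c (initial_state (input_words G \<kappa>)) t s \<and>
    popular_with_penalty \<kappa> G (output_matching G s) \<and>
    real t \<le> C * (real n powr (7 / 2) * real \<kappa> powr (5 / 2)))"
  using popular_cmd_correct by blast

end
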